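(* Assume (A0)–(A3) as in the context, $r>-1$, and that (M$_p$) holds for some $p>\max\{2,1+r\}$. Fix $\alpha\ge0$ and let $S^{(\alpha)}_t:=\sum_{s=1}^tX_s^\alpha$. (i) If $-1<r\le1$, then for any $\varepsilon>0$, a.s., for all but finitely many $t$, $$t^{\frac{\alpha+2}{2}}(\log t)^{-\frac{(\alpha+2)(4+r)}{1+r}-\varepsilon}\le S^{(\alpha)}_t\le t^{\frac{\alpha+2}{2}}(\log t)^{\frac{3\alpha+6}{1+r}+2+\varepsilon}.$$ (ii) If $1<r\le1+\alpha$, then for any $\varepsilon>0$, a.s., for all but finitely many $t$, $$t^{\frac{\alpha+2}{1+r}}(\log t)^{-\frac{\alpha+2}{1+r}-\varepsilon}\le S^{(\alpha)}_t\le t^{\frac{\alpha+2}{1+r}}(\log t)^{\frac{2\alpha+4}{1+r}+2+\varepsilon}.$$ (iii) If $r>1+\alpha$, then as $t\to\infty$, a.s., $$t^{-1}S^{(\alpha)}_t\to\frac{\mathbb{E}[\xi^{(\alpha)}_1]}{\mathbb{E}[\eta_1]}=\sum_{x\in\mathbb{S}}x^\alpha\pi(x)\in(0,\infty).$$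
   Context: $\mathbb{N}=\{1,2,\dots\}$. (A0): $\mathbb{S}$ is a locally finite (every bounded set meets it in finitely many points), unbounded subset of $[0,\infty)$ with $0\in\mathbb{S}$; $(X_t)_{t\in\mathbb{N}}$ is an $\mathbb{S}$-valued process adapted to a filtration $(\mathcal{F}_t)_{t\in\mathbb{N}}$ with $\mathbb{P}[X_1=0]=1$. (A1): for each $x,y\in\mathbb{S}$ there exist $m(x,y)\in\mathbb{N}$, $\varphi(x,y)>0$ with $\mathbb{P}[X_{t+m(X_t,y)}=y\mid\mathcal{F}_t]\ge\varphi(X_t,y)$ a.s. for all $t$. Write $\Delta_t:=X_{t+1}-X_t$. (A2): there are $c\in\mathbb{R}$, $s^2\in(0,\infty)$ with, as $X_t\to\infty$, $\mathbb{E}[\Delta_t\mid\mathcal{F}_t]=cX_t^{-1}+o(X_t^{-1}(\log X_t)^{-1})$ and $\mathbb{E}[\Delta_t^2\mid\mathcal{F}_t]=s^2+o((\log X_t)^{-1})$ a.s., where the implicit constants in $o(\cdot)$ are non-random and uniform in $t$ and in the sample point. Set $r:=-2c/s^2$. Excursions: $\tau_0:=1$, $\tau_n:=\min\{t>\tau_{n-1}:X_t=0\}$ ($\min\emptyset=\infty$), $\eta_n:=\tau_n-\tau_{n-1}$, $\mathcal{E}_n:=(X_t)_{\tau_{n-1}\le t\le\tau_n-1}$, $N:=\min\{n\in\mathbb{N}:\tau_n=\infty\}$. (A3): (a) on $\{N=\infty\}$, $(\mathcal{E}_n)_{n\in\mathbb{N}}$ is i.i.d.; (b) $\mathbb{P}[\eta_{n+1}<\infty\mid\tau_n<\infty]=\mathbb{P}[\eta_1<\infty]$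 for all $n$. (M$_p$): there exist $\delta>0$, $C<\infty$ with $\mathbb{E}[|\Delta_t|^p\mid\mathcal{F}_t]\le C(1+X_t)^{p-2-\delta}$ a.s. for all $t$. Also $\xi^{(\alpha)}_1:=\sum_{t=\tau_0}^{\tau_1-1}X_t^\alpha$ (with $0^0=1$), $\ell_1(x):=\sum_{t=\tau_0}^{\tau_1-1}\mathbf{1}\{X_t=x\}$, and $\pi(x):=\mathbb{E}[\ell_1(x)]/\mathbb{E}[\eta_1]$ for $x\in\mathbb{S}$. *)

theory Defs
  imports "HOL-Probability.Probability"
begin

definition rpow :: "real \<Rightarrow> real \<Rightarrow> real" where
  "rpow x a = (if x = 0 then (if a = 0 then 1 else 0) else x powr a)"

definition locally_finite_set :: "real set \<Rightarrow> bool" where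
  "locally_finite_set S \<longleftrightarrow> (\<forall>B. bounded B \<longrightarrow> finite (B \<inter> S))"

fun tau :: "(nat \<Rightarrow> 'a \<Rightarrow> real) \<Rightarrow> nat \<Rightarrow> 'a \<Rightarrow> enat" where
  "tau X 0 \<omega> = enat 1"
| "tau X (Suc n) \<omega> =
     (case tau X n \<omega> of
        \<infinity> \<Rightarrow> \<infinity>
      | enat k \<Rightarrow> (if \<exists>t>k. X t \<omega> = 0 then enat (LEAST t. t > k \<and> X t \<omega> = 0) else \<infinity>))"

text \<open>Excursion lengths eta n = tau n - tau (n-1), for n \<ge> 1 (infinite if tau n is infinite).\<close>
definition eta :: "(nat \<Rightarrow> 'a \<Rightarrow> real) \<Rightarrow> nat \<Rightarrow> 'a \<Rightarrow> enat" where
  "eta X n \<omega> = tau X n \<omega> - tau X (n - 1) \<omega>"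

definition Nexc :: "(nat \<Rightarrow> 'a \<Rightarrow> real) \<Rightarrow> 'a \<Rightarrow> enat" where
  "Nexc X \<omega> = (if \<exists>n\<ge>1. tau X n \<omega> = \<infinity> then enat (LEAST n. n \<ge> 1 \<and> tau X n \<omega> = \<infinity>) else \<infinity>)"

text \<open>The n-th excursion (n \<ge> 1) as the finite list (X_t) for tau (n-1) \<le> t \<le> tau n - 1;
  it is only meaningful when tau n is finite (in particular on the event N = infinity).\<close>
definition excursion :: "(nat \<Rightarrow> 'a \<Rightarrow> real) \<Rightarrow> nat \<Rightarrow> 'a \<Rightarrow> real list" where
  "excursion X n \<omega> = map (\<lambda>t. X t \<omega>) [the_enat (tau X (n - 1) \<omega>) ..< the_enat (tau X n \<omega>)]"

definition xi1 :: "(nat \<Rightarrow> 'a \<Rightarrow> real) \<Rightarrow> real \<Rightarrow> 'a \<Rightarrow> ennreal" where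
  "xi1 X \<alpha> \<omega> = (\<Sum>t. (if enat t \<ge> tau X 0 \<omega> \<and> enat t < tau X 1 \<omega> then ennreal (rpow (X t \<omega>) \<alpha>) else 0))"

definition ell1 :: "(nat \<Rightarrow> 'a \<Rightarrow> real) \<Rightarrow> real \<Rightarrow> 'a \<Rightarrow> ennreal" where
  "ell1 X x \<omega> = (\<Sum>t. (if enat t \<ge> tau X 0 \<omega> \<and> enat t < tau X 1 \<omega> \<and> X t \<omega> = x then 1 else 0))"

definition stat_pi :: "'a measure \<Rightarrow> (nat \<Rightarrow> 'a \<Rightarrow> real) \<Rightarrow> real \<Rightarrow> ennreal" where
  "stat_pi M X x = (\<integral>\<^sup>+ \<omega>. ell1 X x \<omega> \<partial>M) / (\<integral>\<^sup>+ \<omega>. ennreal_of_enat (eta X 1 \<omega>) \<partial>M)"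

definition Salpha :: "(nat \<Rightarrow> 'a \<Rightarrow> real) \<Rightarrow> real \<Rightarrow> nat \<Rightarrow> 'a \<Rightarrow> real" where
  "Salpha X \<alpha> t \<omega> = (\<Sum>s=1..t. rpow (X s \<omega>) \<alpha>)"

end

theory Submission
  imports Defs
begin

text \<open>
  With \<open>g = 1 + r\<close> and small \<open>a > 0\<close>, the functions \<open>x\<^sup>g (log x)\<^sup>-\<^sup>a\<close> and \<open>x\<^sup>g (log x)\<^sup>a\<close> of \<open>X\<^sub>t\<close> have drift
  of order \<open>\<mp> x\<^sup>g\<^sup>-\<^sup>2 (log x)\<^sup>\<mp>\<^sup>a\<^sup>-\<^sup>1\<close> far from the origin. Summing the drift of the first along one excursion
  shows that \<open>w(x) = x\<^sup>g\<^sup>-\<^sup>2 (log x)\<^sup>-\<^sup>a\<^sup>-\<^sup>1\<close> has an excursion sum of finite mean and that the excursion maximum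
  exceeds \<open>x\<close> with probability at most of order \<open>x\<^sup>-\<^sup>g (log x)\<^sup>a\<close>; in particular every excursion is finite, hence
  the excursions are i.i.d. The second function yields the matching lower bound for the maximum, and once
  the process is at height \<open>x\<close> it stays above \<open>x/2\<close> for a time of order \<open>x\<^sup>2\<close> with probability at least one
  half, so the excursion sum \<open>\<xi>\<close> of \<open>X\<^sup>\<alpha>\<close> exceeds \<open>y\<close> with probability at least of order
  \<open>y\<^sup>-\<^sup>\<beta> (log y)\<^sup>-\<^sup>a\<close>, \<open>\<beta> = g / (\<alpha> + 2)\<close>.

  If \<open>\<beta> \<le> 1\<close>, a sum of \<open>n\<close> copies of \<open>\<xi>\<close> is at least its largest term, and at most the \<open>n\<close> excursion sums of
  \<open>w\<close> (controlled by the law of large numbers) times the value of \<open>x\<^sup>\<alpha> / w(x)\<close> at the largest of the \<open>n\<close>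
  maxima (controlled by Borel-Cantelli). Taking \<open>\<alpha> = 0\<close> bounds the number of excursions completed by time
  \<open>t\<close>. If \<open>\<beta> > 1\<close>, then \<open>\<xi>\<close> is integrable and the law of large numbers suffices.
\<close>

section \<open>Powers with logarithmic corrections\<close>

definition powln :: "real \<Rightarrow> real \<Rightarrow> real \<Rightarrow> real" where
  "powln g b u = u powr g * ln u powr b"

lemma powln_pos: "1 < u \<Longrightarrow> 0 < powln g b u"
  by (simp add: powln_def)

lemma powln_has_derivative:
  assumes "1 < u"
  shows "(powln g b has_real_derivative (g * powln (g - 1) b u + b * powln (g - 1) (b - 1) u)) (at u)"
proof -
  have "ln u > 0" using assms by simp
  then have "((\<lambda>u. u powr g * ln u powr b) has_real_derivative
     (u powr g * (b * ln u powr (b - 1) * (1 / u)) + g * u powr (g - 1) * ln u powr b)) (at u)"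
    using assms by (auto intro!: derivative_eq_intros simp: powr_diff field_simps)
  moreover have "u powr g * (b * ln u powr (b - 1) * (1 / u)) + g * u powr (g - 1) * ln u powr b
      = g * powln (g - 1) b u + b * powln (g - 1) (b - 1) u"
    using assms by (simp add: powln_def powr_diff mult_ac)
  ultimately show ?thesis
    unfolding powln_def[abs_def] by (simp only:)
qed

lemma powln_le_powr:
  assumes "0 < nu"
  obtains K where "0 < K" "\<And>u. exp 1 \<le> u \<Longrightarrow> powln g b u \<le> K * u powr (g + nu)"
proof -
  define K where "K = (\<bar>b\<bar> / nu) powr \<bar>b\<bar> + 1"
  have "ln u powr b \<le> K * u powr nu" if u: "exp 1 \<le> u" for u
  proof -
    have l: "1 \<le> ln u" using u by (metis ln_exp ln_le_cancel_iff exp_gt_zero less_le_trans)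
    have u0: "0 < u" using u by (meson exp_gt_zero less_le_trans)
    have u1: "1 \<le> u" using l u0 by (simp flip: ln_ge_zero_iff)
    have "ln u powr b \<le> ln u powr \<bar>b\<bar>" using l by (intro powr_mono) auto
    also have "\<dots> \<le> K * u powr nu"
    proof (cases "b = 0")
      case True
      then show ?thesis using l u1 assms by (auto simp: K_def ge_one_powr_ge_zero)
    next
      case False
      define e where "e = nu / \<bar>b\<bar>"
      have e: "0 < e" using False assms by (simp add: e_def)
      have "ln u \<le> u powr e / e" using ln_powr_bound[OF u1 e] .
      then have "ln u powr \<bar>b\<bar> \<le> (u powr e / e) powr \<bar>b\<bar>" using l by (intro powr_mono2) auto
      also have "\<dots> = u powr nu * (1 / e) powr \<bar>b\<bar>"
        using e False by (simp add: powr_divide powr_powr e_def powr_mult)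
      also have "\<dots> \<le> K * u powr nu" by (simp add: K_def e_def algebra_simps)
      finally show ?thesis .
    qed
    finally show ?thesis .
  qed
  then have "powln g b u \<le> K * u powr (g + nu)" if "exp 1 \<le> u" for u
    unfolding powln_def powr_add using mult_left_mono[of "ln u powr b" "K * u powr nu" "u powr g"] that
    by (simp add: algebra_simps)
  moreover have "0 < K" by (simp add: K_def add_nonneg_pos)
  ultimately show thesis using that by blast
qed

lemma powln_mono:
  assumes g: "0 \<le> g" "0 \<le> g + b" and u: "exp 1 \<le> u" "u \<le> v"
  shows "powln g b u \<le> powln g b v"
proof (rule DERIV_nonneg_imp_nondecreasing[OF u(2)])
  fix x assume x: "u \<le> x" "x \<le> v"
  have ex: "exp 1 \<le> x" using u x by simp
  then have l: "1 \<le> ln x" by (metis ln_exp ln_le_cancel_iff exp_gt_zero less_le_trans)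
  have x1: "1 < x" using ex exp_gt_one[of "1::real"] by linarith
  have "0 \<le> powln (g-1) (b-1) x * (g * ln x + b)"
    using l x1 g by (intro mult_nonneg_nonneg) (auto simp: powln_pos less_imp_le intro!: order_trans[of 0 "g+b" "g * ln x + b"] mult_left_mono[of 1 "ln x" g, simplified])
  also have "\<dots> = g * powln (g - 1) b x + b * powln (g - 1) (b - 1) x"
    using l unfolding powln_def by (simp add: powr_diff[of "ln x"]) (simp add: field_simps)
  finally show "\<exists>y. (powln g b has_real_derivative y) (at x) \<and> 0 \<le> y"
    using powln_has_derivative[OF x1] by blast
qed

definition powln1 where "powln1 g b u = g * powln (g - 1) b u + b * powln (g - 1) (b - 1) u"
definition powln2 where "powln2 g b u = g * powln1 (g - 1) b u + b * powln1 (g - 1) (b - 1) u"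
definition powln3 where "powln3 g b u = g * powln2 (g - 1) b u + b * powln2 (g - 1) (b - 1) u"

lemma powln1_deriv: "1 < u \<Longrightarrow> (powln1 g b has_real_derivative powln2 g b u) (at u)"
  unfolding powln1_def[abs_def] powln2_def
  by (auto intro!: derivative_eq_intros powln_has_derivative)

lemma powln2_deriv: "1 < u \<Longrightarrow> (powln2 g b has_real_derivative powln3 g b u) (at u)"
  unfolding powln2_def[abs_def] powln3_def
  by (auto intro!: derivative_eq_intros powln1_deriv simp: powln2_def algebra_simps)

lemma lin_comb_bound:
  fixes f h k :: "real \<Rightarrow> real"
  assumes "0 < A" "0 < B" "\<And>u. exp 1 \<le> u \<Longrightarrow> \<bar>f u\<bar> \<le> A * k u" "\<And>u. exp 1 \<le> u \<Longrightarrow> \<bar>h u\<bar> \<le> B * k u"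
    "\<And>u. exp 1 \<le> u \<Longrightarrow> 0 \<le> k u"
  shows "\<exists>K>0. \<forall>u\<ge>exp 1. \<bar>g * f u + b * h u\<bar> \<le> K * k u"
proof (intro exI[of _ "\<bar>g\<bar> * A + \<bar>b\<bar> * B + 1"] conjI allI impI)
  show "0 < \<bar>g\<bar> * A + \<bar>b\<bar> * B + 1" using assms by (simp add: add_nonneg_pos)
  fix u :: real assume u: "exp 1 \<le> u"
  have "\<bar>g * f u + b * h u\<bar> \<le> \<bar>g\<bar> * \<bar>f u\<bar> + \<bar>b\<bar> * \<bar>h u\<bar>" by (metis abs_mult abs_triangle_ineq)
  also have "\<dots> \<le> \<bar>g\<bar> * (A * k u) + \<bar>b\<bar> * (B * k u)"
    using assms u by (intro add_mono mult_left_mono) auto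
  also have "\<dots> \<le> (\<bar>g\<bar> * A + \<bar>b\<bar> * B + 1) * k u" using assms(5)[OF u] by (simp add: algebra_simps)
  finally show "\<bar>g * f u + b * h u\<bar> \<le> (\<bar>g\<bar> * A + \<bar>b\<bar> * B + 1) * k u" .
qed

lemma powln_abs_bound:
  assumes "0 < nu" shows "\<exists>K>0. \<forall>u\<ge>exp 1. \<bar>powln g b u\<bar> \<le> K * u powr (g + nu)"
proof -
  obtain K where "0 < K" "\<And>u. exp 1 \<le> u \<Longrightarrow> powln g b u \<le> K * u powr (g + nu)"
    using powln_le_powr[OF assms] by blast
  then show ?thesis by (intro exI[of _ K]) (auto simp: powln_def)
qed

lemma powln1_abs_bound:
  assumes "0 < nu" shows "\<exists>K>0. \<forall>u\<ge>exp 1. \<bar>powln1 g b u\<bar> \<le> K * u powr (g - 1 + nu)"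
proof -
  obtain A B where "0 < A" "0 < B" "\<forall>u\<ge>exp 1. \<bar>powln (g - 1) b u\<bar> \<le> A * u powr (g - 1 + nu)"
    "\<forall>u\<ge>exp 1. \<bar>powln (g - 1) (b - 1) u\<bar> \<le> B * u powr (g - 1 + nu)"
    using powln_abs_bound[OF assms] by meson
  then show ?thesis unfolding powln1_def by (intro lin_comb_bound[of A B]) auto
qed

lemma powln2_abs_bound:
  assumes "0 < nu" shows "\<exists>K>0. \<forall>u\<ge>exp 1. \<bar>powln2 g b u\<bar> \<le> K * u powr (g - 2 + nu)"
proof -
  obtain A B where "0 < A" "0 < B" "\<forall>u\<ge>exp 1. \<bar>powln1 (g - 1) b u\<bar> \<le> A * u powr (g - 1 - 1 + nu)"
    "\<forall>u\<ge>exp 1. \<bar>powln1 (g - 1) (b - 1) u\<bar> \<le> B * u powr (g - 1 - 1 + nu)"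
    using powln1_abs_bound[OF assms] by meson
  then show ?thesis unfolding powln2_def by (intro lin_comb_bound[of A B]) auto
qed

lemma powln3_abs_bound:
  assumes "0 < nu" shows "\<exists>K>0. \<forall>u\<ge>exp 1. \<bar>powln3 g b u\<bar> \<le> K * u powr (g - 3 + nu)"
proof -
  obtain A B where "0 < A" "0 < B" "\<forall>u\<ge>exp 1. \<bar>powln2 (g - 1) b u\<bar> \<le> A * u powr (g - 1 - 2 + nu)"
    "\<forall>u\<ge>exp 1. \<bar>powln2 (g - 1) (b - 1) u\<bar> \<le> B * u powr (g - 1 - 2 + nu)"
    using powln2_abs_bound[OF assms] by meson
  then show ?thesis unfolding powln3_def by (intro lin_comb_bound[of A B]) auto
qed

lemma powln_taylor:
  assumes x: "exp 1 \<le> x" and y: "exp 1 \<le> y"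
  obtains t where "min x y \<le> t" "t \<le> max x y"
    "powln g b y - powln g b x - powln1 g b x * (y - x) - powln2 g b x * (y - x)\<^sup>2 / 2
      = powln3 g b t / 6 * (y - x) ^ 3"
proof (cases "x = y")
  case True then show ?thesis using that[of x] by auto
next
  case False
  define D where "D = (\<lambda>m::nat. if m = 0 then powln g b else if m = 1 then powln1 g b else if m = 2 then powln2 g b else powln3 g b)"
  have e1: "1 < exp (1::real)" by simp
  have "\<forall>m t. m < 3 \<and> exp 1 \<le> t \<and> t \<le> max x y \<longrightarrow> (D m has_real_derivative D (Suc m) t) (at t)"
  proof (intro allI impI)
    fix m :: nat and t assume a: "m < 3 \<and> exp 1 \<le> t \<and> t \<le> max x y"
    then have "1 < t" using e1 by linarith
    moreover have "m = 0 \<or> m = 1 \<or> m = 2" using a by auto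
    ultimately show "(D m has_real_derivative D (Suc m) t) (at t)"
      using powln_has_derivative[of t g b] powln1_deriv[of t g b] powln2_deriv[of t g b]
      by (auto simp: D_def powln1_def)
  qed
  from Taylor[of 3 D "powln g b" "exp 1" "max x y" x y, OF _ _ this] x y False
  obtain t where "if y < x then y < t \<and> t < x else x < t \<and> t < y"
    "powln g b y = (\<Sum>m<3. D m x / fact m * (y - x) ^ m) + D 3 t / fact 3 * (y - x) ^ 3"
    by (auto simp: D_def)
  then show ?thesis using that[of t]
    by (auto simp: D_def numeral_3_eq_3 power2_eq_square fact_numeral split: if_splits)
qed
lemma powr_le_of_comparable:
  fixes x t q :: real
  assumes "0 < x" "x / 2 \<le> t" "t \<le> 2 * x"
  shows "t powr q \<le> 2 powr \<bar>q\<bar> * x powr q"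
proof (cases "0 \<le> q")
  case True
  then have "t powr q \<le> (2 * x) powr q" using assms by (intro powr_mono2) auto
  then show ?thesis using True assms by (simp add: powr_mult)
next
  case False
  then have "t powr q \<le> (x / 2) powr q" using assms by (intro powr_mono2') auto
  then show ?thesis using False assms by (simp add: powr_divide powr_minus field_simps)
qed

lemma large_jump_powr_le:
  fixes x D :: real
  assumes x: "1 \<le> x" and D: "x powr (1 - z) \<le> D" and j: "0 \<le> j" "j \<le> p" and z: "0 \<le> z"
  shows "x powr (q - j) * D powr j \<le> x powr (q - p + z * p) * D powr p"
proof -
  have D0: "0 < D" using D x by (smt (verit) powr_gt_zero)
  have "x powr (p - j - z * p) \<le> x powr ((1 - z) * (p - j))"
    using x z j by (intro powr_mono) (auto simp: algebra_simps)
  also have "\<dots> = (x powr (1 - z)) powr (p - j)" by (simp add: powr_powr)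
  also have "\<dots> \<le> D powr (p - j)" using D j by (intro powr_mono2) auto
  finally have "x powr (q - p + z * p) * D powr j * x powr (p - j - z * p) \<le> x powr (q - p + z * p) * D powr j * D powr (p - j)"
    by (intro mult_left_mono) auto
  moreover have "x powr (q - p + z * p) * D powr j * x powr (p - j - z * p) = x powr (q - j) * D powr j"
    by (simp add: mult_ac flip: powr_add)
  moreover have "x powr (q - p + z * p) * D powr j * D powr (p - j) = x powr (q - p + z * p) * D powr p"
    by (simp add: mult_ac flip: powr_add)
  ultimately show ?thesis by simp
qed

lemma powln_taylor_bound:
  fixes g b p \<delta> :: real
  assumes g: "0 < g" "g < p" and p: "2 < p" and \<delta>: "0 < \<delta>"
  obtains K \<theta> x1 where "0 < K" "0 < \<theta>" "exp 1 \<le> x1"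
    "\<And>x y. x1 \<le> x \<Longrightarrow> 0 \<le> y \<Longrightarrow>
      \<bar>powln g b (max y (exp 1)) - powln g b x - powln1 g b x * (y - x) - powln2 g b x * (y - x)\<^sup>2 / 2\<bar>
      \<le> K * (x powr (g - 2 - \<theta>) * (y - x)\<^sup>2 + x powr (g - p + \<delta> - \<theta>) * \<bar>y - x\<bar> powr p)"
proof -
  define nu where "nu = Min {\<delta> / (2 + 2 * p), p - g, 1/4}"
  have nu: "0 < nu" "nu \<le> \<delta> / (2 + 2 * p)" "nu \<le> p - g" "nu \<le> 1/4"
    unfolding nu_def using assms by (simp, (intro Min_le; simp)+)
  define z where "z = 2 * nu"
  have z: "0 < z" "z \<le> 1/2" using nu by (auto simp: z_def)
  have nud: "nu + z * p \<le> \<delta> - nu" using nu(2) p by (simp add: z_def field_simps)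
  obtain K0 where K0: "0 < K0" "\<And>u. exp 1 \<le> u \<Longrightarrow> \<bar>powln g b u\<bar> \<le> K0 * u powr (g + nu)"
    using powln_abs_bound[OF nu(1)] by meson
  obtain K1 where K1: "0 < K1" "\<And>u. exp 1 \<le> u \<Longrightarrow> \<bar>powln1 g b u\<bar> \<le> K1 * u powr (g - 1 + nu)"
    using powln1_abs_bound[OF nu(1)] by meson
  obtain K2 where K2: "0 < K2" "\<And>u. exp 1 \<le> u \<Longrightarrow> \<bar>powln2 g b u\<bar> \<le> K2 * u powr (g - 2 + nu)"
    using powln2_abs_bound[OF nu(1)] by meson
  obtain K3 where K3: "0 < K3" "\<And>u. exp 1 \<le> u \<Longrightarrow> \<bar>powln3 g b u\<bar> \<le> K3 * u powr (g - 3 + nu)"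
    using powln3_abs_bound[OF nu(1)] by meson
  define C3 where "C3 = K3 * 2 powr \<bar>g - 3 + nu\<bar>"
  define C0 where "C0 = K0 * 2 powr (g + nu)"
  define K where "K = C3 + C0 + K0 + K1 + K2"
  define x1 where "x1 = max (2 * exp 1) (2 powr (1 / z))"
  have C3: "0 < C3" and C0: "0 < C0" using K3 K0 by (auto simp: C3_def C0_def)
  have Kp: "0 < K" using C3 C0 K0 K1 K2 by (simp add: K_def)
  show thesis
  proof (rule that[of K nu x1])
    show "0 < K" by (fact Kp)
    show "0 < nu" by (fact nu(1))
    show "exp 1 \<le> x1" unfolding x1_def using exp_gt_zero[of "1::real"] by linarith
    fix x y :: real assume x: "x1 \<le> x" and y: "0 \<le> y"
    define D where "D = \<bar>y - x\<bar>"
    define R where "R = powln g b (max y (exp 1)) - powln g b x - powln1 g b x * (y - x) - powln2 g b x * (y - x)\<^sup>2 / 2"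
    have xe: "2 * exp 1 \<le> x" and xz: "2 powr (1 / z) \<le> x" using x by (auto simp: x1_def)
    have xe1: "exp 1 \<le> x" using xe exp_gt_zero[of "1::real"] by linarith
    have x1: "1 \<le> x" using xe1 exp_ge_add_one_self[of "1::real"] by linarith
    have D2: "(y - x)\<^sup>2 = D\<^sup>2" by (simp add: D_def)
    have "\<bar>R\<bar> \<le> K * (x powr (g - 2 - nu) * D\<^sup>2 + x powr (g - p + \<delta> - nu) * D powr p)"
    proof (cases "D \<le> x powr (1 - z)")
      case True
      have "x powr z \<ge> 2" using powr_mono2[of z "2 powr (1 / z)" x] xz z by (simp add: powr_powr)
      then have "x powr (1 - z) \<le> x / 2" using x1 by (simp add: powr_diff field_simps)
      then have Dx: "D \<le> x / 2" using True by simp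
      then have yx: "x / 2 \<le> y" "y \<le> 2 * x" using x1 by (auto simp: D_def abs_if split: if_splits)
      have ye: "exp 1 \<le> y" using yx xe by linarith
      obtain t where t: "min x y \<le> t" "t \<le> max x y" and
        eq: "powln g b y - powln g b x - powln1 g b x * (y - x) - powln2 g b x * (y - x)\<^sup>2 / 2
          = powln3 g b t / 6 * (y - x) ^ 3"
        using powln_taylor[OF xe1 ye] by blast
      have "R = powln3 g b t / 6 * (y - x) ^ 3" using eq ye by (simp add: R_def max_def)
      then have "\<bar>R\<bar> = \<bar>powln3 g b t / 6 * (y - x) ^ 3\<bar>" by (rule arg_cong)
      also have "\<dots> = \<bar>powln3 g b t\<bar> / 6 * D ^ 3" by (simp add: D_def abs_mult power_abs)
      also have "\<dots> \<le> (K3 * t powr (g - 3 + nu)) * D ^ 3"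
      proof (intro mult_right_mono)
        have "exp 1 \<le> t" using t xe1 ye by (auto simp: min_def split: if_splits)
        then show "\<bar>powln3 g b t\<bar> / 6 \<le> K3 * t powr (g - 3 + nu)" using K3(2)[of t] by linarith
      qed (simp add: D_def)
      also have "\<dots> \<le> (K3 * (2 powr \<bar>g - 3 + nu\<bar> * x powr (g - 3 + nu))) * D ^ 3"
        using K3(1) t yx x1 by (intro mult_right_mono mult_left_mono powr_le_of_comparable) (auto simp: D_def)
      also have "\<dots> = C3 * x powr (g - 3 + nu) * D\<^sup>2 * D" by (simp add: C3_def power3_eq_cube power2_eq_square)
      also have "\<dots> \<le> C3 * x powr (g - 3 + nu) * D\<^sup>2 * x powr (1 - z)"
        using True C3 by (intro mult_left_mono) auto
      also have "\<dots> = C3 * (x powr (g - 2 - nu) * D\<^sup>2)"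
        by (simp add: mult_ac z_def flip: powr_add) (simp add: algebra_simps)
      also have "\<dots> \<le> K * (x powr (g - 2 - nu) * D\<^sup>2)"
        using C3 C0 K0 K1 K2 by (intro mult_right_mono) (auto simp: K_def)
      also have "\<dots> \<le> K * (x powr (g - 2 - nu) * D\<^sup>2 + x powr (g - p + \<delta> - nu) * D powr p)"
        using Kp by (intro mult_left_mono) auto
      finally show ?thesis .
    next
      case False
      then have D: "x powr (1 - z) \<le> D" by simp
      have D0: "0 < D" using D x1 by (smt (verit) powr_gt_zero)
      define Q where "Q = x powr (g + nu - p + z * p) * D powr p"
      have Q: "x powr (g + nu - j) * D powr j \<le> Q" if "0 \<le> j" "j \<le> p" for j
        unfolding Q_def by (rule large_jump_powr_le[OF x1 D that]) (use z in auto)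
      have Q0: "0 \<le> Q" by (simp add: Q_def)
      have a0: "\<bar>powln g b x\<bar> \<le> K0 * Q"
      proof -
        have "\<bar>powln g b x\<bar> \<le> K0 * x powr (g + nu)" by (rule K0(2)[OF xe1])
        also have "\<dots> \<le> K0 * Q" using Q[of 0] K0(1) p D0 by (intro mult_left_mono) auto
        finally show ?thesis .
      qed
      have "\<bar>powln1 g b x\<bar> * D \<le> K1 * x powr (g - 1 + nu) * D"
        using K1(2)[OF xe1] D0 by (intro mult_right_mono) auto
      also have "\<dots> = K1 * (x powr (g + nu - 1) * D powr 1)" using D0 by (simp add: algebra_simps)
      also have "\<dots> \<le> K1 * Q" using K1(1) p by (intro mult_left_mono Q) auto
      finally have a1: "\<bar>powln1 g b x\<bar> * D \<le> K1 * Q" .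
      have "\<bar>powln2 g b x\<bar> * D\<^sup>2 \<le> K2 * x powr (g - 2 + nu) * D\<^sup>2"
        using K2(2)[OF xe1] D0 by (intro mult_right_mono) auto
      also have "\<dots> = K2 * (x powr (g + nu - 2) * D powr 2)" using D0 by (simp add: algebra_simps)
      also have "\<dots> \<le> K2 * Q" using K2(1) p by (intro mult_left_mono Q) auto
      finally have a2: "\<bar>powln2 g b x\<bar> * D\<^sup>2 \<le> K2 * Q" .
      have a3: "\<bar>powln g b (max y (exp 1))\<bar> \<le> C0 * Q"
      proof (cases "y \<le> 2 * x")
        case True
        have "\<bar>powln g b (max y (exp 1))\<bar> \<le> K0 * (max y (exp 1)) powr (g + nu)" by (rule K0) simp
        also have "\<dots> \<le> K0 * (2 * x) powr (g + nu)"
          using K0 True xe xe1 x1 g nu by (intro mult_left_mono powr_mono2) (auto intro: order_trans[of 0 "exp 1"])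
        also have "\<dots> = C0 * x powr (g + nu)" using x1 by (simp add: C0_def powr_mult)
        also have "\<dots> \<le> C0 * Q" using Q[of 0] p C0 D0 by (intro mult_left_mono) auto
        finally show ?thesis .
      next
        case False
        then have yD: "y \<le> 2 * D" "x \<le> D" using x1 by (auto simp: D_def)
        have ye: "exp 1 \<le> y" using False xe1 x1 by linarith
        have "\<bar>powln g b (max y (exp 1))\<bar> \<le> K0 * y powr (g + nu)" using K0(2)[OF ye] ye by (simp add: max_def)
        also have "\<dots> \<le> K0 * (2 * D) powr (g + nu)"
          using K0 yD y g nu by (intro mult_left_mono powr_mono2) auto
        also have "\<dots> = C0 * D powr (g + nu)" using D0 by (simp add: C0_def powr_mult)
        also have "\<dots> = C0 * (x powr (g + nu - (g + nu)) * D powr (g + nu))" using x1 by simp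
        also have "\<dots> \<le> C0 * Q" using C0 g nu by (intro mult_left_mono Q) auto
        finally show ?thesis .
      qed
      have b1: "\<bar>powln1 g b x * (y - x)\<bar> = \<bar>powln1 g b x\<bar> * D" by (simp add: D_def abs_mult)
      have b2: "\<bar>powln2 g b x * (y - x)\<^sup>2\<bar> = \<bar>powln2 g b x\<bar> * D\<^sup>2" by (simp add: D_def abs_mult)
      have "\<bar>R\<bar> \<le> \<bar>powln g b (max y (exp 1))\<bar> + \<bar>powln g b x\<bar> + \<bar>powln1 g b x * (y - x)\<bar> + \<bar>powln2 g b x * (y - x)\<^sup>2\<bar>"
        unfolding R_def by linarith
      also have "\<dots> \<le> (C0 + K0 + K1 + K2) * Q" using a0 a1 a2 a3 unfolding b1 b2 by (simp add: algebra_simps)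
      also have "\<dots> \<le> K * Q" using C3 Q0 by (intro mult_right_mono) (auto simp: K_def)
      also have "\<dots> \<le> K * (x powr (g - p + \<delta> - nu) * D powr p)"
        unfolding Q_def using Kp x1 nud by (intro mult_left_mono mult_right_mono powr_mono) auto
      also have "\<dots> \<le> K * (x powr (g - 2 - nu) * D\<^sup>2 + x powr (g - p + \<delta> - nu) * D powr p)"
        using Kp by (intro mult_left_mono) auto
      finally show ?thesis .
    qed
    then show "\<bar>powln g b (max y (exp 1)) - powln g b x - powln1 g b x * (y - x) - powln2 g b x * (y - x)\<^sup>2 / 2\<bar>
      \<le> K * (x powr (g - 2 - nu) * (y - x)\<^sup>2 + x powr (g - p + \<delta> - nu) * \<bar>y - x\<bar> powr p)"
      unfolding R_def D2 by (simp add: D_def)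
  qed
qed

text \<open>The value of \<open>c\<close> cancels the leading terms of the drift and leaves one of relative order \<open>1 / ln x\<close>;
  this is why the moment hypotheses are needed to precision \<open>o(1 / ln x)\<close>.\<close>

lemma powln_drift_estimate:
  fixes g b p \<delta> c s2 C K \<theta> \<epsilon> :: real
  assumes g: "0 < g" and s2: "0 < s2" and c: "c = - (g - 1) * s2 / 2"
    and pos: "0 < C" "0 < K" "0 < \<theta>" "0 < \<epsilon>"
  obtains e x0 where "0 < e" "exp 1 \<le> x0"
    "\<And>x e1 e2 ep ef. x0 \<le> x \<Longrightarrow> \<bar>e1 - c / x\<bar> \<le> e / (x * ln x) \<Longrightarrow> \<bar>e2 - s2\<bar> \<le> e / ln x \<Longrightarrow>
      ep \<le> C * (1 + x) powr (p - 2 - \<delta>) \<Longrightarrow>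
      \<bar>ef - powln1 g b x * e1 - powln2 g b x * e2 / 2\<bar>
        \<le> K * (x powr (g - 2 - \<theta>) * e2 + x powr (g - p + \<delta> - \<theta>) * ep) \<Longrightarrow>
      \<bar>ef - s2 / 2 * g * b * powln (g - 2) (b - 1) x\<bar> \<le> \<epsilon> * powln (g - 2) (b - 1) x"
proof -
  define A where "A = (g + \<bar>b\<bar>) + (\<bar>g * (g - 1)\<bar> + \<bar>(2 * g - 1) * b\<bar> + \<bar>b * (b - 1)\<bar>)"
  have A: "0 < A" using g by (auto simp: A_def)
  define e where "e = min 1 (\<epsilon> / (4 * A))"
  have e: "0 < e" "e \<le> 1" "e * A \<le> \<epsilon> / 4"
    using A pos by (auto simp: e_def min_def field_simps)
  define K' where "K' = K * (s2 + 1 + C * 2 powr \<bar>p - 2 - \<delta>\<bar>)"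
  have K': "0 < K'" using pos s2 by (auto simp: K'_def intro!: mult_pos_pos add_pos_pos)
  obtain J where J: "0 < J" "\<And>u. exp 1 \<le> u \<Longrightarrow> powln (- \<theta>) (1 - b) u \<le> J * u powr (- \<theta> + \<theta> / 2)"
    using powln_le_powr[of "\<theta> / 2" "- \<theta>" "1 - b"] pos by auto
  have "((\<lambda>u. K' * (J * u powr (- \<theta> + \<theta> / 2))) \<longlongrightarrow> K' * (J * 0)) at_top"
    using pos by (intro tendsto_mult tendsto_const tendsto_neg_powr) (auto simp: filterlim_ident)
  then have "eventually (\<lambda>u. K' * (J * u powr (- \<theta> + \<theta> / 2)) < \<epsilon> / 4) at_top"
    using pos by (intro order_tendstoD(2)[where y = "K' * (J * 0)"]) auto
  then obtain x2 where x2: "\<And>x. x2 \<le> x \<Longrightarrow> K' * (J * x powr (- \<theta> + \<theta> / 2)) < \<epsilon> / 4"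
    by (auto simp: eventually_at_top_linorder)
  define x3 where "x3 = exp (4 * (s2 / 2 * \<bar>b * (b - 1)\<bar>) / \<epsilon>)"
  define x0 where "x0 = max (exp 1) (max x2 x3)"
  show thesis
  proof (rule that[of e x0])
    show "0 < e" by (fact e(1))
    show "exp 1 \<le> x0" by (simp add: x0_def)
    fix x e1 e2 ep ef :: real
    assume x: "x0 \<le> x" and e1: "\<bar>e1 - c / x\<bar> \<le> e / (x * ln x)" and e2: "\<bar>e2 - s2\<bar> \<le> e / ln x"
      and ep: "ep \<le> C * (1 + x) powr (p - 2 - \<delta>)"
      and ef: "\<bar>ef - powln1 g b x * e1 - powln2 g b x * e2 / 2\<bar>
        \<le> K * (x powr (g - 2 - \<theta>) * e2 + x powr (g - p + \<delta> - \<theta>) * ep)"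
    have xe: "exp 1 \<le> x" and "x2 \<le> x" and x3: "x3 \<le> x" using x by (auto simp: x0_def)
    have x0: "0 < x" using xe exp_gt_zero[of "1::real"] by linarith
    have x1: "1 \<le> x" using xe exp_ge_add_one_self[of "1::real"] by linarith
    define L where "L = ln x"
    have L: "1 \<le> L" using xe x0 by (metis L_def ln_exp ln_le_cancel_iff exp_gt_zero)
    have x3L: "4 * (s2 / 2 * \<bar>b * (b - 1)\<bar>) / \<epsilon> \<le> L"
      using x3 x0 unfolding x3_def L_def by (metis exp_gt_zero ln_exp ln_le_cancel_iff)
    define q where "q = powln (g - 2) (b - 1) x"
    have q: "0 < q" using L x0 unfolding q_def powln_def L_def[symmetric] by simp
    have h1: "powln (g - 1) b x = q * x * L" "powln (g - 1) (b - 1) x = q * x"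
      "powln (g - 1 - 1) b x = q * L" "powln (g - 1 - 1) (b - 1) x = q" "powln (g - 1 - 1) (b - 1 - 1) x = q / L"
      unfolding q_def powln_def L_def[symmetric] using L x0
      by (auto simp: powr_diff power2_eq_square field_simps)
    have f1: "powln1 g b x = q * x * (g * L + b)" unfolding powln1_def h1 by (simp add: algebra_simps)
    have f2: "powln2 g b x = q * (g * (g - 1) * L + (2 * g - 1) * b + b * (b - 1) / L)"
      unfolding powln2_def powln1_def h1 by (simp add: algebra_simps)
    have main: "powln1 g b x * (c / x) + powln2 g b x * s2 / 2 = q * (s2 / 2) * (g * b + b * (b - 1) / L)"
      unfolding f1 f2 c using x0 L by (simp add: field_simps)
    have "\<bar>powln1 g b x * (e1 - c / x)\<bar> \<le> \<bar>powln1 g b x\<bar> * (e / (x * L))"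
      unfolding abs_mult L_def using e1 by (intro mult_left_mono) auto
    also have "\<dots> = q * e * (\<bar>g * L + b\<bar> / L)" using q x0 L unfolding f1 abs_mult by simp
    also have "\<dots> \<le> q * e * (g + \<bar>b\<bar>)"
    proof (intro mult_left_mono)
      have "\<bar>g * L + b\<bar> \<le> g * L + \<bar>b\<bar> * 1" using g L by (simp add: abs_if)
      also have "\<dots> \<le> (g + \<bar>b\<bar>) * L" unfolding distrib_right using L g by (intro add_mono mult_left_mono) auto
      finally show "\<bar>g * L + b\<bar> / L \<le> g + \<bar>b\<bar>" using L by (simp add: field_simps)
    qed (use q e in auto)
    finally have er1: "\<bar>powln1 g b x * (e1 - c / x)\<bar> \<le> q * e * (g + \<bar>b\<bar>)" .
    have "\<bar>powln2 g b x * (e2 - s2) / 2\<bar> \<le> \<bar>powln2 g b x\<bar> * (e / L)"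
    proof -
      have "\<bar>powln2 g b x * (e2 - s2) / 2\<bar> \<le> \<bar>powln2 g b x\<bar> * \<bar>e2 - s2\<bar>" by (simp add: abs_mult)
      also have "\<dots> \<le> \<bar>powln2 g b x\<bar> * (e / L)" using e2 by (intro mult_left_mono) (auto simp: L_def)
      finally show ?thesis .
    qed
    also have "\<dots> = q * e * (\<bar>g * (g - 1) * L + (2 * g - 1) * b + b * (b - 1) / L\<bar> / L)"
      using q L unfolding f2 by (simp add: abs_mult)
    also have "\<dots> \<le> q * e * (\<bar>g * (g - 1)\<bar> + \<bar>(2 * g - 1) * b\<bar> + \<bar>b * (b - 1)\<bar>)"
    proof (intro mult_left_mono)
      have "\<bar>b * (b - 1)\<bar> / L \<le> \<bar>b * (b - 1)\<bar> * L"
      proof -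
        have "\<bar>b * (b - 1)\<bar> * 1 \<le> \<bar>b * (b - 1)\<bar> * (L * L)"
          using L by (intro mult_left_mono) (auto intro: mult_ge1_I)
        then show ?thesis using L by (simp add: field_simps)
      qed
      moreover have "\<bar>(2 * g - 1) * b\<bar> \<le> \<bar>(2 * g - 1) * b\<bar> * L" using L by (simp add: mult_le_cancel_left1)
      moreover have "\<bar>g * (g - 1) * L + (2 * g - 1) * b + b * (b - 1) / L\<bar>
          \<le> \<bar>g * (g - 1)\<bar> * L + \<bar>(2 * g - 1) * b\<bar> + \<bar>b * (b - 1)\<bar> / L"
      proof -
        have "\<bar>g * (g - 1) * L\<bar> = \<bar>g * (g - 1)\<bar> * L" "\<bar>b * (b - 1) / L\<bar> = \<bar>b * (b - 1)\<bar> / L"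
          using L by (auto simp: abs_mult abs_divide)
        then show ?thesis by linarith
      qed
      ultimately have "\<bar>g * (g - 1) * L + (2 * g - 1) * b + b * (b - 1) / L\<bar>
         \<le> (\<bar>g * (g - 1)\<bar> + \<bar>(2 * g - 1) * b\<bar> + \<bar>b * (b - 1)\<bar>) * L" by (simp add: distrib_right)
      then show "\<bar>g * (g - 1) * L + (2 * g - 1) * b + b * (b - 1) / L\<bar> / L
         \<le> \<bar>g * (g - 1)\<bar> + \<bar>(2 * g - 1) * b\<bar> + \<bar>b * (b - 1)\<bar>" using L by (simp add: pos_divide_le_eq)
    qed (use q e in auto)
    finally have er2: "\<bar>powln2 g b x * (e2 - s2) / 2\<bar> \<le> q * e * (\<bar>g * (g - 1)\<bar> + \<bar>(2 * g - 1) * b\<bar> + \<bar>b * (b - 1)\<bar>)" .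
    have er12: "\<bar>powln1 g b x * (e1 - c / x)\<bar> + \<bar>powln2 g b x * (e2 - s2) / 2\<bar> \<le> q * (\<epsilon> / 4)"
    proof -
      have "\<bar>powln1 g b x * (e1 - c / x)\<bar> + \<bar>powln2 g b x * (e2 - s2) / 2\<bar> \<le> q * (e * A)"
        using er1 er2 unfolding A_def by (simp add: algebra_simps)
      also have "\<dots> \<le> q * (\<epsilon> / 4)" using q e by (intro mult_left_mono) auto
      finally show ?thesis .
    qed
    have er3: "\<bar>q * (s2 / 2) * (b * (b - 1) / L)\<bar> \<le> q * (\<epsilon> / 4)"
    proof -
      have "s2 / 2 * \<bar>b * (b - 1)\<bar> / L \<le> \<epsilon> / 4" using x3L L pos by (simp add: field_simps)
      then have "q * (s2 / 2 * \<bar>b * (b - 1)\<bar> / L) \<le> q * (\<epsilon> / 4)" using q by (intro mult_left_mono) auto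
      then show ?thesis using q s2 L by (simp add: abs_mult)
    qed
    have "e / L \<le> 1" using e L by (simp add: field_simps)
    then have e2b: "e2 \<le> s2 + 1" using e2 unfolding L_def by linarith
    have "K * (x powr (g - 2 - \<theta>) * e2 + x powr (g - p + \<delta> - \<theta>) * ep)
       \<le> K * (x powr (g - 2 - \<theta>) * (s2 + 1) + x powr (g - p + \<delta> - \<theta>) * (C * (2 powr \<bar>p - 2 - \<delta>\<bar> * x powr (p - 2 - \<delta>))))"
    proof (intro mult_left_mono add_mono)
      have "C * (1 + x) powr (p - 2 - \<delta>) \<le> C * (2 powr \<bar>p - 2 - \<delta>\<bar> * x powr (p - 2 - \<delta>))"
        using pos x1 by (intro mult_left_mono powr_le_of_comparable) auto
      then show "ep \<le> C * (2 powr \<bar>p - 2 - \<delta>\<bar> * x powr (p - 2 - \<delta>))" using ep by linarith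
    qed (use e2b pos in auto)
    also have "\<dots> = K' * x powr (g - 2 - \<theta>)"
    proof -
      have "x powr (g - p + \<delta> - \<theta>) * x powr (p - 2 - \<delta>) = x powr (g - 2 - \<theta>)"
        by (simp flip: powr_add) (simp add: algebra_simps)
      then show ?thesis unfolding K'_def by (simp add: algebra_simps)
    qed
    also have "\<dots> = q * (K' * powln (- \<theta>) (1 - b) x)"
    proof -
      have "x powr (g - 2 - \<theta>) = q * powln (- \<theta>) (1 - b) x"
      proof -
        have "q * powln (- \<theta>) (1 - b) x = (x powr (g - 2) * x powr (- \<theta>)) * (L powr (b - 1) * L powr (1 - b))"
          unfolding q_def powln_def L_def by simp
        also have "\<dots> = x powr (g - 2 - \<theta>)" using L by (simp flip: powr_add)
        finally show ?thesis ..
      qed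
      then show ?thesis by simp
    qed
    also have "\<dots> \<le> q * (\<epsilon> / 4)"
    proof (intro mult_left_mono)
      have "K' * powln (- \<theta>) (1 - b) x \<le> K' * (J * x powr (- \<theta> + \<theta> / 2))"
        using J(2)[OF xe] K' by (intro mult_left_mono) auto
      also have "\<dots> \<le> \<epsilon> / 4" using x2[OF \<open>x2 \<le> x\<close>] by simp
      finally show "K' * powln (- \<theta>) (1 - b) x \<le> \<epsilon> / 4" .
    qed (use q in auto)
    finally have er4: "\<bar>ef - powln1 g b x * e1 - powln2 g b x * e2 / 2\<bar> \<le> q * (\<epsilon> / 4)" using ef by linarith
    have "ef - s2 / 2 * g * b * q = (ef - powln1 g b x * e1 - powln2 g b x * e2 / 2)
       + powln1 g b x * (e1 - c / x) + powln2 g b x * (e2 - s2) / 2 + q * (s2 / 2) * (b * (b - 1) / L)"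
    proof -
      have "powln1 g b x * (e1 - c / x) + powln2 g b x * (e2 - s2) / 2
        = powln1 g b x * e1 + powln2 g b x * e2 / 2 - (powln1 g b x * (c / x) + powln2 g b x * s2 / 2)"
        by (simp add: right_diff_distrib diff_divide_distrib)
      moreover have "q * (s2 / 2) * (g * b + b * (b - 1) / L) = s2 / 2 * g * b * q + q * (s2 / 2) * (b * (b - 1) / L)"
        by (simp only: distrib_left mult_ac)
      ultimately show ?thesis unfolding main by linarith
    qed
    then have "\<bar>ef - s2 / 2 * g * b * q\<bar> \<le> q * (\<epsilon> / 4) + q * (\<epsilon> / 4) + q * (\<epsilon> / 4)"
      using er12 er3 er4 by linarith
    also have "\<dots> \<le> \<epsilon> * q" using q pos by (simp add: field_simps)
    finally show "\<bar>ef - s2 / 2 * g * b * powln (g - 2) (b - 1) x\<bar> \<le> \<epsilon> * powln (g - 2) (b - 1) x"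
      unfolding q_def .
  qed
qed

section \<open>The strong law of large numbers\<close>

lemma (in prob_space) indep_vars_Suc:
  assumes "indep_vars (\<lambda>_. N) Y {Suc 0..}"
  shows "indep_vars (\<lambda>_. N) (\<lambda>k. Y (Suc k)) UNIV"
proof -
  define E where "E = (\<lambda>i. {Y i -` A \<inter> space M |A. A \<in> sets N})"
  have rv: "\<And>i. 1 \<le> i \<Longrightarrow> random_variable N (Y i)" and ind: "indep_sets E {Suc 0..}"
    using assms unfolding indep_vars_def2 E_def by auto
  have "indep_sets (\<lambda>i. E (Suc i)) UNIV"
  proof (rule indep_setsI)
    fix i show "E (Suc i) \<subseteq> events" using ind unfolding indep_sets_def by auto
  next
    fix A J assume J: "J \<noteq> {}" "J \<subseteq> UNIV" "finite J" "\<forall>j\<in>J. A j \<in> E (Suc j)"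
    have "prob (\<Inter>j\<in>Suc ` J. A (j - 1)) = (\<Prod>j\<in>Suc ` J. prob (A (j - 1)))"
      using J by (intro indep_setsD[OF ind]) auto
    then show "prob (\<Inter>j\<in>J. A j) = (\<Prod>j\<in>J. prob (A j))"
      by (simp add: prod.reindex)
  qed
  then show ?thesis unfolding indep_vars_def2 using rv by (auto simp: E_def)
qed

lemma (in prob_space) indep_vars_shift:
  assumes "indep_vars (\<lambda>_. N) Y (UNIV :: nat set)"
  shows "indep_vars (\<lambda>_. N) (\<lambda>k. Y (Suc k)) UNIV"
  by (rule indep_vars_Suc, rule indep_vars_subset[OF assms]) auto

lemma sum_lessThan_add:
  fixes f :: "nat \<Rightarrow> real"
  shows "(\<Sum>k<m + n. f k) = (\<Sum>k<m. f k) + (\<Sum>k<n. f (m + k))"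
  by (induction n) (auto simp: algebra_simps)

fun max_sum :: "nat \<Rightarrow> (nat \<Rightarrow> real) \<Rightarrow> real" where
  "max_sum 0 y = 0"
| "max_sum (Suc n) y = max 0 (y 0 + max_sum n (\<lambda>k. y (Suc k)))"

lemma max_sum_nonneg: "0 \<le> max_sum n y"
  by (cases n) auto

lemma sum_le_max_sum: "j \<le> n \<Longrightarrow> (\<Sum>k<j. y k) \<le> max_sum n y"
proof (induction n arbitrary: j y)
  case (Suc n)
  show ?case
  proof (cases j)
    case 0 then show ?thesis by simp
  next
    case (Suc i)
    then have "(\<Sum>k<i. y (Suc k)) \<le> max_sum n (\<lambda>k. y (Suc k))" using Suc.IH Suc.prems by simp
    then show ?thesis using Suc by (simp add: sum.lessThan_Suc_shift del: sum.lessThan_Suc)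
  qed
qed simp

lemma max_sum_le: "max_sum n y \<le> (\<Sum>k<n. \<bar>y k\<bar>)"
proof (induction n arbitrary: y)
  case (Suc n)
  have "max_sum (Suc n) y \<le> \<bar>y 0\<bar> + max_sum n (\<lambda>k. y (Suc k))"
    using max_sum_nonneg[of n "\<lambda>k. y (Suc k)"] by auto
  also have "\<dots> \<le> (\<Sum>k<Suc n. \<bar>y k\<bar>)"
    using Suc.IH[of "\<lambda>k. y (Suc k)"] by (simp add: sum.lessThan_Suc_shift del: sum.lessThan_Suc)
  finally show ?case .
qed simp

lemma max_sum_measurable: "max_sum n \<in> borel_measurable (Pi\<^sub>M UNIV (\<lambda>_. borel))"
proof (induction n)
  case 0 show ?case by simp
next
  case (Suc n)
  have sh: "(\<lambda>y k. y (Suc k)) \<in> measurable (Pi\<^sub>M UNIV (\<lambda>_. borel)) (Pi\<^sub>M UNIV (\<lambda>_. borel :: real measure))"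
    by (rule measurable_PiM_single') (auto simp: space_PiM)
  have "(\<lambda>y. max 0 (y 0 + max_sum n (\<lambda>k. y (Suc k)))) \<in> borel_measurable (Pi\<^sub>M UNIV (\<lambda>_. borel))"
    by (intro borel_measurable_max borel_measurable_add measurable_const measurable_component_singleton
        measurable_compose[OF sh Suc.IH]) simp_all
  moreover have "max_sum (Suc n) = (\<lambda>y. max 0 (y 0 + max_sum n (\<lambda>k. y (Suc k))))" by (rule ext) simp
  ultimately show ?case by (simp only:)
qed

lemma (in prob_space) iid_sequence_distr:
  fixes Y :: "nat \<Rightarrow> 'a \<Rightarrow> real"
  assumes ind: "indep_vars (\<lambda>_. borel) Y UNIV" and id: "\<And>n. distr M borel (Y n) = D"
  shows "distr M (Pi\<^sub>M UNIV (\<lambda>_. borel)) (\<lambda>\<omega> k. Y k \<omega>) = Pi\<^sub>M UNIV (\<lambda>_. D)"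
proof -
  have "\<And>i. random_variable borel (Y i)" using ind unfolding indep_vars_def2 by auto
  then show ?thesis
    using indep_vars_iff_distr_eq_PiM[where I = UNIV and M' = "\<lambda>_. borel" and X = Y] ind by (simp add: id restrict_UNIV)
qed

text \<open>If the partial sums \<open>S\<^sub>n\<close> were almost surely unbounded above, so would be their running maxima
  \<open>M\<^sub>n\<close>; but \<open>M\<^sub>n\<^sub>+\<^sub>1 = max 0 (Y\<^sub>0 + M'\<^sub>n)\<close> with \<open>M'\<^sub>n\<close> distributed as \<open>M\<^sub>n\<close>, so
  \<open>0 \<le> E[M\<^sub>n\<^sub>+\<^sub>1] - E[M\<^sub>n] = E[max (-M'\<^sub>n) Y\<^sub>0]\<close>, which tends to \<open>E[Y\<^sub>0]\<close>.\<close>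

lemma (in prob_space) iid_negative_mean_sums_bounded:
  fixes Y :: "nat \<Rightarrow> 'a \<Rightarrow> real"
  assumes ind: "indep_vars (\<lambda>_. borel) Y UNIV" and id: "\<And>n. distr M borel (Y n) = distr M borel (Y 0)"
    and int: "integrable M (Y 0)" and neg: "expectation (Y 0) < 0"
  shows "AE \<omega> in M. \<exists>C. \<forall>n. (\<Sum>k<n. Y k \<omega>) \<le> C"
proof -
  have rv [measurable]: "\<And>i. Y i \<in> borel_measurable M" using ind unfolding indep_vars_def2 by auto
  have inti: "integrable M (Y i)" for i
  proof -
    have "integrable (distr M borel (Y 0)) (\<lambda>x. x)" using int by (subst integrable_distr_eq) auto
    then have "integrable (distr M borel (Y i)) (\<lambda>x. x)" by (simp add: id[of i])
    then show ?thesis by (subst (asm) integrable_distr_eq) auto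
  qed
  define U where "U = {\<omega> \<in> space M. \<forall>C::nat. \<exists>n. real C < (\<Sum>k<n. Y k \<omega>)}"
  have Uset [measurable]: "U \<in> sets M" unfolding U_def by measurable
  have shift: "U = {\<omega> \<in> space M. \<forall>C::nat. \<exists>n. real C < (\<Sum>k<n. Y (m + k) \<omega>)}" for m
  proof -
    have "(\<forall>C::nat. \<exists>n. real C < (\<Sum>k<n. Y k \<omega>)) \<longleftrightarrow> (\<forall>C::nat. \<exists>n. real C < (\<Sum>k<n. Y (m + k) \<omega>))" for \<omega>
    proof (intro iffI allI)
      fix C :: nat
      assume a: "\<forall>C::nat. \<exists>n. real C < (\<Sum>k<n. Y k \<omega>)"
      define B where "B = (\<Sum>k<m. \<bar>Y k \<omega>\<bar>)"
      obtain C' :: nat where C': "real C + B < real C'" using reals_Archimedean2 by blast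
      from a obtain n where n: "real C' < (\<Sum>k<n. Y k \<omega>)" by blast
      have le: "(\<Sum>k<j. Y k \<omega>) \<le> B" if "j \<le> m" for j
      proof -
        have "(\<Sum>k<j. Y k \<omega>) \<le> (\<Sum>k<j. \<bar>Y k \<omega>\<bar>)" by (rule sum_mono) auto
        also have "\<dots> \<le> B" unfolding B_def using that by (intro sum_mono2) auto
        finally show ?thesis .
      qed
      have "\<not> n \<le> m" using le[of n] n C' by linarith
      then have "m + (n - m) = n" by simp
      then have "(\<Sum>k<n. Y k \<omega>) = (\<Sum>k<m. Y k \<omega>) + (\<Sum>k<n-m. Y (m + k) \<omega>)"
        using sum_lessThan_add[of "\<lambda>k. Y k \<omega>" m "n - m"] by simp
      then show "\<exists>n. real C < (\<Sum>k<n. Y (m + k) \<omega>)" using le[of m] n C' by (intro exI[of _ "n - m"]) auto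
    next
      fix C :: nat
      assume a: "\<forall>C::nat. \<exists>n. real C < (\<Sum>k<n. Y (m + k) \<omega>)"
      define B where "B = \<bar>\<Sum>k<m. Y k \<omega>\<bar>"
      obtain C' :: nat where C': "real C + B < real C'" using reals_Archimedean2 by blast
      from a obtain n where n: "real C' < (\<Sum>k<n. Y (m + k) \<omega>)" by blast
      have "real C < (\<Sum>k<m + n. Y k \<omega>)" using sum_lessThan_add[of "\<lambda>k. Y k \<omega>" m n] n C' unfolding B_def by linarith
      then show "\<exists>n. real C < (\<Sum>k<n. Y k \<omega>)" by blast
    qed
    then show ?thesis unfolding U_def by (intro Collect_cong conj_cong refl)
  qed
  define A where "A = (\<lambda>i. sigma_sets (space M) {Y i -` B \<inter> space M |B. B \<in> sets borel})"
  have tail: "U \<in> tail_events A"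
    unfolding tail_events_def
  proof
    fix m :: nat
    define N where "N = sigma (space M) (\<Union> (A ` {m..}))"
    have sub: "\<Union> (A ` {m..}) \<subseteq> Pow (space M)"
    proof (intro UN_least subsetI PowI)
      fix i B x assume "B \<in> A i" "x \<in> B"
      from this(1) have "B \<subseteq> space M" unfolding A_def by (rule sigma_sets_into_sp[rotated]) auto
      then show "x \<in> space M" using \<open>x \<in> B\<close> by blast
    qed
    have [measurable]: "Y (m + k) \<in> borel_measurable N" for k
    proof (rule measurableI)
      fix B :: "real set" assume "B \<in> sets borel"
      then have "Y (m + k) -` B \<inter> space M \<in> A (m + k)" unfolding A_def by (auto intro!: sigma_sets.Basic)
      moreover have "A (m + k) \<subseteq> \<Union> (A ` {m..})" by (rule UN_upper) simp
      ultimately have "Y (m + k) -` B \<inter> space M \<in> sigma_sets (space M) (\<Union> (A ` {m..}))"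
        by (intro sigma_sets.Basic) (rule subsetD)
      then show "Y (m + k) -` B \<inter> space N \<in> sets N" unfolding N_def using sub
        by (simp add: space_measure_of sets_measure_of)
    qed simp
    have "{\<omega> \<in> space N. \<forall>C::nat. \<exists>n. real C < (\<Sum>k<n. Y (m + k) \<omega>)} \<in> sets N" by measurable
    then show "U \<in> sigma_sets (space M) (\<Union> (A ` {m..}))"
      using sub unfolding shift[of m] by (simp add: N_def space_measure_of sets_measure_of)
  qed
  have "prob U = 0 \<or> prob U = 1"
  proof (rule kolmogorov_0_1_law[OF _ _ tail])
    show "indep_sets A UNIV" using ind unfolding indep_vars_def A_def by auto
    show "sigma_algebra (space M) (A i)" for i
      unfolding A_def by (rule sigma_algebra_sigma_sets) auto
  qed
  moreover have "prob U \<noteq> 1"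
  proof
    assume U1: "prob U = 1"
    let ?M = "\<lambda>n \<omega>. max_sum n (\<lambda>k. Y k \<omega>)"
    let ?M' = "\<lambda>n \<omega>. max_sum n (\<lambda>k. Y (Suc k) \<omega>)"
    let ?P = "Pi\<^sub>M UNIV (\<lambda>_. borel :: real measure)"
    have meq [measurable]: "(\<lambda>\<omega> k. Y k \<omega>) \<in> measurable M ?P" "(\<lambda>\<omega> k. Y (Suc k) \<omega>) \<in> measurable M ?P"
      by (rule measurable_PiM_single'; auto simp: space_PiM)+
    have mM: "?M n \<in> borel_measurable M" "?M' n \<in> borel_measurable M" for n
      by (rule measurable_compose[OF meq(1) max_sum_measurable] measurable_compose[OF meq(2) max_sum_measurable])+
    have deq: "distr M ?P (\<lambda>\<omega> k. Y k \<omega>) = distr M ?P (\<lambda>\<omega> k. Y (Suc k) \<omega>)"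
      using iid_sequence_distr[OF ind id] iid_sequence_distr[OF indep_vars_shift[OF ind] id] by simp
    have Eeq: "expectation (?M n) = expectation (?M' n)" for n
      using integral_distr[OF meq(1) max_sum_measurable[of n]] integral_distr[OF meq(2) max_sum_measurable[of n]] unfolding deq by (rule trans[OF sym])
    have intM: "integrable M (?M n)" "integrable M (?M' n)" for n
    proof -
      have "integrable M (\<lambda>\<omega>. max_sum n (\<lambda>k. Y (h k) \<omega>))"
        if m: "(\<lambda>\<omega>. max_sum n (\<lambda>k. Y (h k) \<omega>)) \<in> borel_measurable M" for h
      proof (rule Bochner_Integration.integrable_bound[of M "\<lambda>\<omega>. \<Sum>k<n. \<bar>Y (h k) \<omega>\<bar>"])
        show "integrable M (\<lambda>\<omega>. \<Sum>k<n. \<bar>Y (h k) \<omega>\<bar>)"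
          by (intro Bochner_Integration.integrable_sum integrable_abs inti)
        show "AE \<omega> in M. norm (max_sum n (\<lambda>k. Y (h k) \<omega>)) \<le> norm (\<Sum>k<n. \<bar>Y (h k) \<omega>\<bar>)"
          using max_sum_le max_sum_nonneg by (intro AE_I2) (simp add: sum_nonneg)
      qed (fact m)
      from this[OF mM(1)] this[OF mM(2)] show "integrable M (?M n)" "integrable M (?M' n)" .
    qed
    have inc: "?M n \<omega> \<le> ?M (Suc n) \<omega>" for n \<omega>
    proof -
      have "max_sum n y \<le> max_sum (Suc n) y" for y
      proof (induction n arbitrary: y)
        case (Suc n)
        from Suc.IH[of "\<lambda>k. y (Suc k)"] show ?case by (simp only: max_sum.simps(2)[of "Suc n"] max_sum.simps(2)[of n y])
      qed simp
      then show ?thesis .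
    qed
    have nonneg: "0 \<le> expectation (\<lambda>\<omega>. max (- ?M' n \<omega>) (Y 0 \<omega>))" for n
    proof -
      have "(\<lambda>\<omega>. max (- ?M' n \<omega>) (Y 0 \<omega>)) = (\<lambda>\<omega>. ?M (Suc n) \<omega> - ?M' n \<omega>)" by (auto simp: fun_eq_iff)
      then have "expectation (\<lambda>\<omega>. max (- ?M' n \<omega>) (Y 0 \<omega>)) = expectation (?M (Suc n)) - expectation (?M' n)"
        using intM by (simp only: Bochner_Integration.integral_diff)
      also have "\<dots> = expectation (?M (Suc n)) - expectation (?M n)" by (simp only: Eeq)
      also have "\<dots> \<ge> 0" using integral_mono[OF intM(1)[of n] intM(1)[of "Suc n"] inc] by simp
      finally show ?thesis .
    qed
    have "(\<lambda>n. expectation (\<lambda>\<omega>. max (- ?M' n \<omega>) (Y 0 \<omega>))) \<longlonglongrightarrow> expectation (Y 0)"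
    proof (rule integral_dominated_convergence[where w = "\<lambda>\<omega>. \<bar>Y 0 \<omega>\<bar>"])
      show "integrable M (\<lambda>\<omega>. \<bar>Y 0 \<omega>\<bar>)" using int by simp
      show "AE \<omega> in M. norm (max (- ?M' n \<omega>) (Y 0 \<omega>)) \<le> \<bar>Y 0 \<omega>\<bar>" for n
      proof (intro AE_I2)
        fix \<omega>
        have "\<bar>max (- m) y\<bar> \<le> \<bar>y\<bar>" if "0 \<le> m" for m y :: real using that by linarith
        then show "norm (max (- ?M' n \<omega>) (Y 0 \<omega>)) \<le> \<bar>Y 0 \<omega>\<bar>" using max_sum_nonneg by simp
      qed
      have "AE \<omega> in M. \<omega> \<in> U" using U1 by (intro AE_prob_1)
      then show "AE \<omega> in M. (\<lambda>n. max (- ?M' n \<omega>) (Y 0 \<omega>)) \<longlonglongrightarrow> Y 0 \<omega>"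
      proof eventually_elim
        case (elim \<omega>)
        obtain C :: nat where C: "- Y 0 \<omega> < real C" using reals_Archimedean2 by blast
        from elim obtain n0 where "real C < (\<Sum>k<n0. Y (1 + k) \<omega>)" unfolding shift[of 1] by blast
        then have n0: "real C < (\<Sum>k<n0. Y (Suc k) \<omega>)" by simp
        have "max (- ?M' n \<omega>) (Y 0 \<omega>) = Y 0 \<omega>" if "n0 \<le> n" for n
          using sum_le_max_sum[OF that, of "\<lambda>k. Y (Suc k) \<omega>"] C n0 by linarith
        then have "eventually (\<lambda>n. max (- ?M' n \<omega>) (Y 0 \<omega>) = Y 0 \<omega>) sequentially"
          by (rule eventually_sequentiallyI)
        then show ?case by (rule tendsto_eventually)
      qed
      show "Y 0 \<in> borel_measurable M" by (rule rv)
      show "(\<lambda>\<omega>. max (- ?M' n \<omega>) (Y 0 \<omega>)) \<in> borel_measurable M" for n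
        by (intro borel_measurable_max borel_measurable_uminus mM rv)
    qed
    then have "0 \<le> expectation (Y 0)" by (rule LIMSEQ_le_const) (use nonneg in auto)
    then show False using neg by simp
  qed
  ultimately have "prob U = 0" by simp
  then have "AE \<omega> in M. \<omega> \<notin> U" by (intro AE_I[of _ _ U]) (auto simp: emeasure_eq_measure)
  then show ?thesis
    using AE_space by eventually_elim (auto simp: U_def not_less)
qed

lemma (in prob_space) slln_upper:
  fixes Y :: "nat \<Rightarrow> 'a \<Rightarrow> real"
  assumes ind: "indep_vars (\<lambda>_. borel) Y UNIV" and id: "\<And>n. distr M borel (Y n) = distr M borel (Y 0)"
    and int: "integrable M (Y 0)" and e: "0 < e"
  shows "AE \<omega> in M. eventually (\<lambda>n. (\<Sum>k<n. Y k \<omega>) / real n \<le> expectation (Y 0) + e) sequentially"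
proof -
  define a where "a = expectation (Y 0) + e / 2"
  have rv [measurable]: "\<And>i. Y i \<in> borel_measurable M" using ind unfolding indep_vars_def2 by auto
  have "AE \<omega> in M. \<exists>C. \<forall>n. (\<Sum>k<n. Y k \<omega> - a) \<le> C"
  proof (rule iid_negative_mean_sums_bounded)
    show "indep_vars (\<lambda>_. borel) (\<lambda>k \<omega>. Y k \<omega> - a) UNIV"
      by (rule indep_vars_compose2[OF ind]) auto
    have *: "distr M borel (\<lambda>\<omega>. Y n \<omega> - a) = distr (distr M borel (Y n)) borel (\<lambda>x. x - a)" for n
      by (subst distr_distr) (auto simp: comp_def)
    show "distr M borel (\<lambda>\<omega>. Y n \<omega> - a) = distr M borel (\<lambda>\<omega>. Y 0 \<omega> - a)" for n
      unfolding *[of n] *[of 0] id[of n] ..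
    show "integrable M (\<lambda>\<omega>. Y 0 \<omega> - a)" using int by simp
    show "expectation (\<lambda>\<omega>. Y 0 \<omega> - a) < 0" using int e by (simp add: a_def prob_space)
  qed
  then show ?thesis
  proof eventually_elim
    case (elim \<omega>)
    then obtain C where C: "\<And>n. (\<Sum>k<n. Y k \<omega> - a) \<le> C" by blast
    obtain n0 :: nat where n0: "2 * \<bar>C\<bar> / e < real n0" using reals_Archimedean2 by blast
    show ?case
    proof (rule eventually_sequentiallyI[of "Suc n0"])
      fix n assume n: "Suc n0 \<le> n"
      then have "2 * \<bar>C\<bar> / e < real n" using n0 by simp
      then have "\<bar>C\<bar> \<le> real n * (e / 2)" using e by (simp add: field_simps)
      moreover have "(\<Sum>k<n. Y k \<omega>) \<le> C + real n * a" using C[of n] by (simp add: sum_subtractf)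
      ultimately have "(\<Sum>k<n. Y k \<omega>) \<le> real n * (expectation (Y 0) + e)"
        unfolding a_def by (simp add: algebra_simps)
      then show "(\<Sum>k<n. Y k \<omega>) / real n \<le> expectation (Y 0) + e" using n by (simp add: field_simps)
    qed
  qed
qed

theorem (in prob_space) strong_law_of_large_numbers:
  fixes Y :: "nat \<Rightarrow> 'a \<Rightarrow> real"
  assumes ind: "indep_vars (\<lambda>_. borel) Y UNIV" and id: "\<And>n. distr M borel (Y n) = distr M borel (Y 0)"
    and int: "integrable M (Y 0)"
  shows "AE \<omega> in M. (\<lambda>n. (\<Sum>k<n. Y k \<omega>) / real n) \<longlonglongrightarrow> expectation (Y 0)"
proof -
  have rv [measurable]: "\<And>i. Y i \<in> borel_measurable M" using ind unfolding indep_vars_def2 by auto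
  have "AE \<omega> in M. eventually (\<lambda>n. (\<Sum>k<n. Y k \<omega>) / real n \<le> expectation (Y 0) + 1 / Suc m) sequentially" for m
    by (rule slln_upper[OF assms]) auto
  then have up: "AE \<omega> in M. \<forall>m. eventually (\<lambda>n. (\<Sum>k<n. Y k \<omega>) / real n \<le> expectation (Y 0) + 1 / Suc m) sequentially"
    by (simp add: AE_all_countable)
  have "AE \<omega> in M. eventually (\<lambda>n. (\<Sum>k<n. - Y k \<omega>) / real n \<le> expectation (\<lambda>\<omega>. - Y 0 \<omega>) + 1 / Suc m) sequentially" for m
  proof (rule slln_upper)
    show "indep_vars (\<lambda>_. borel) (\<lambda>k \<omega>. - Y k \<omega>) UNIV" by (rule indep_vars_compose2[OF ind]) auto
    have *: "distr M borel (\<lambda>\<omega>. - Y n \<omega>) = distr (distr M borel (Y n)) borel (\<lambda>x. - x)" for n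
      by (subst distr_distr) (auto simp: comp_def)
    show "distr M borel (\<lambda>\<omega>. - Y n \<omega>) = distr M borel (\<lambda>\<omega>. - Y 0 \<omega>)" for n
      unfolding *[of n] *[of 0] id[of n] ..
  qed (use int in auto)
  then have lo: "AE \<omega> in M. \<forall>m. eventually (\<lambda>n. (\<Sum>k<n. - Y k \<omega>) / real n \<le> expectation (\<lambda>\<omega>. - Y 0 \<omega>) + 1 / Suc m) sequentially"
    by (simp add: AE_all_countable)
  from up lo show ?thesis
  proof eventually_elim
    case (elim \<omega>)
    show ?case
    proof (rule tendstoI)
      fix e :: real assume "0 < e"
      then obtain m where m: "1 / real (Suc m) < e" by (rule nat_approx_posE)
      from elim(1)[rule_format, of m] elim(2)[rule_format, of m]
      show "eventually (\<lambda>n. dist ((\<Sum>k<n. Y k \<omega>) / real n) (expectation (Y 0)) < e) sequentially"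
      proof eventually_elim
        case (elim n)
        have "(\<Sum>k<n. - Y k \<omega>) / real n = - ((\<Sum>k<n. Y k \<omega>) / real n)" by (simp add: sum_negf)
        then show ?case using elim m unfolding dist_real_def by (simp only: integral_minus)
      qed
    qed
  qed
qed

section \<open>Local increments and Lyapunov functions\<close>

locale lamperti = prob_space M for M :: "'a measure" +
  fixes F :: "nat \<Rightarrow> 'a measure" and X :: "nat \<Rightarrow> 'a \<Rightarrow> real" and S :: "real set"
    and c s2 r :: real and m :: "real \<Rightarrow> real \<Rightarrow> nat" and \<phi> :: "real \<Rightarrow> real \<Rightarrow> real" and p \<delta> C :: real
  assumes filt: "filtration (space M) F"
    and subalg: "\<And>t. t \<ge> 1 \<Longrightarrow> subalgebra M (F t)"
    and S_lf: "locally_finite_set S"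
    and S_unbdd: "\<not> bounded S"
    and S_nonneg: "S \<subseteq> {0..}"
    and S_zero: "0 \<in> S"
    and X_adapted: "\<And>t. t \<ge> 1 \<Longrightarrow> X t \<in> borel_measurable (F t)"
    and X_in_S: "\<And>t \<omega>. t \<ge> 1 \<Longrightarrow> \<omega> \<in> space M \<Longrightarrow> X t \<omega> \<in> S"
    and X1: "prob {\<omega> \<in> space M. X 1 \<omega> = 0} = 1"
    and m_pos: "\<And>x y. x \<in> S \<Longrightarrow> y \<in> S \<Longrightarrow> m x y \<ge> 1"
    and \<phi>_pos: "\<And>x y. x \<in> S \<Longrightarrow> y \<in> S \<Longrightarrow> \<phi> x y > 0"
    and A1: "\<And>y t. y \<in> S \<Longrightarrow> t \<ge> 1 \<Longrightarrow> AE \<omega> in M.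
          real_cond_exp M (F t) (indicator {\<omega>' \<in> space M. X (t + m (X t \<omega>') y) \<omega>' = y}) \<omega> \<ge> \<phi> (X t \<omega>) y"
    and s2_pos: "s2 > 0"
    and A2_mean: "\<And>\<epsilon>. \<epsilon> > 0 \<Longrightarrow> \<exists>x0. \<forall>t\<ge>1. AE \<omega> in M. X t \<omega> \<ge> x0 \<longrightarrow>
                    \<bar>real_cond_exp M (F t) (\<lambda>\<omega>'. X (t + 1) \<omega>' - X t \<omega>') \<omega> - c / X t \<omega>\<bar>
                    \<le> \<epsilon> / (X t \<omega> * ln (X t \<omega>))"
    and A2_var: "\<And>\<epsilon>. \<epsilon> > 0 \<Longrightarrow> \<exists>x0. \<forall>t\<ge>1. AE \<omega> in M. X t \<omega> \<ge> x0 \<longrightarrow>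
                    \<bar>real_cond_exp M (F t) (\<lambda>\<omega>'. (X (t + 1) \<omega>' - X t \<omega>') ^ 2) \<omega> - s2\<bar>
                    \<le> \<epsilon> / ln (X t \<omega>)"
    and r_def: "r = - 2 * c / s2"
    and A3a: "prob {\<omega> \<in> space M. Nexc X \<omega> = \<infinity>} > 0 \<Longrightarrow>
              (let M' = uniform_measure M {\<omega> \<in> space M. Nexc X \<omega> = \<infinity>} in
                 prob_space.indep_vars M' (\<lambda>_. count_space UNIV) (\<lambda>n. excursion X n) {1..} \<and>
                 (\<forall>n\<ge>1. distr M' (count_space UNIV) (excursion X n)
                          = distr M' (count_space UNIV) (excursion X 1)))"
    and A3b: "\<And>n. prob {\<omega> \<in> space M. tau X n \<omega> < \<infinity>} > 0 \<Longrightarrow>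
              cond_prob M (\<lambda>\<omega>. eta X (Suc n) \<omega> < \<infinity>) (\<lambda>\<omega>. tau X n \<omega> < \<infinity>)
              = prob {\<omega> \<in> space M. eta X 1 \<omega> < \<infinity>}"
    and r_gt: "r > -1"
    and p_gt: "2 < p" "1 + r < p" and \<delta>_pos: "0 < \<delta>" and \<delta>_less: "\<delta> < p - 1 - r" and C_pos: "0 < C"
    and Mp: "\<And>t. t \<ge> 1 \<Longrightarrow> AE \<omega> in M.
               nn_cond_exp M (F t) (\<lambda>\<omega>'. ennreal (\<bar>X (t + 1) \<omega>' - X t \<omega>'\<bar> powr p)) \<omega>
               \<le> ennreal (C * (1 + X t \<omega>) powr (p - 2 - \<delta>))"
begin

lemma F_mono: "s \<le> t \<Longrightarrow> sets (F s) \<subseteq> sets (F t)" and space_F [simp]: "space (F t) = space M"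
  using filt unfolding filtration_def by auto

lemma sets_F_M: "1 \<le> t \<Longrightarrow> A \<in> sets (F t) \<Longrightarrow> A \<in> sets M"
  using subalg unfolding subalgebra_def by auto

lemma X_measurable_F: "1 \<le> s \<Longrightarrow> s \<le> t \<Longrightarrow> X s \<in> borel_measurable (F t)"
  using F_mono[of s t] by (intro measurable_mono[THEN subsetD, OF _ _ _ _ X_adapted[of s]]) auto

lemma X_measurable [measurable (raw)]: "1 \<le> t \<Longrightarrow> X t \<in> borel_measurable M"
  using measurable_from_subalg[OF subalg X_adapted] .

lemma sigma_finite_F: "1 \<le> t \<Longrightarrow> sigma_finite_subalgebra M (F t)"
  by (rule finite_measure_subalgebra_is_sigma_finite)
    (simp add: finite_measure_subalgebra_def finite_measure_subalgebra_axioms_def subalg finite_measure_axioms)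

lemma finite_S_below: "finite {x \<in> S. x < a}"
proof -
  have "finite ({0..\<bar>a\<bar>} \<inter> S)" using S_lf unfolding locally_finite_set_def by (metis bounded_closed_interval)
  moreover have "{x \<in> S. x < a} \<subseteq> {0..\<bar>a\<bar>} \<inter> S" using S_nonneg by auto
  ultimately show ?thesis by (rule finite_subset[rotated])
qed

lemma countable_S: "countable S"
proof -
  have "S \<subseteq> (\<Union>n::nat. {x \<in> S. x < real n})"
  proof
    fix x assume x: "x \<in> S"
    obtain n :: nat where "x < real n" using reals_Archimedean2 by blast
    with x show "x \<in> (\<Union>n::nat. {x \<in> S. x < real n})" by blast
  qed
  moreover have "countable (\<Union>n::nat. {x \<in> S. x < real n})" by (rule countable_UN) (auto intro: countable_finite finite_S_below)
  ultimately show ?thesis by (rule countable_subset)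
qed

lemma X_nonneg: "1 \<le> t \<Longrightarrow> \<omega> \<in> space M \<Longrightarrow> 0 \<le> X t \<omega>"
  using X_in_S S_nonneg by (meson atLeast_iff subsetD)

text \<open>Since \<open>S\<close> is countable, conditional moments are used only through integrals over events of \<open>F t\<close> on
  which \<open>X t\<close> is constant, so that no integrability of \<open>X t\<close> itself is needed.\<close>

lemma cond_exp_local_bounds:
  assumes t: "1 \<le> t" and B: "B \<in> sets (F t)" and g: "g \<in> borel_measurable M"
    and int: "integrable M (\<lambda>\<omega>. indicator B \<omega> * g \<omega>)"
    and AE: "AE \<omega> in M. \<omega> \<in> B \<longrightarrow> \<bar>real_cond_exp M (F t) g \<omega> - a\<bar> \<le> e"
  shows "\<bar>(\<integral>\<omega>. indicator B \<omega> * g \<omega> \<partial>M) - a * prob B\<bar> \<le> e * prob B"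
proof -
  interpret sf: sigma_finite_subalgebra M "F t" by (rule sigma_finite_F[OF t])
  have BM: "B \<in> sets M" using sets_F_M[OF t B] .
  have ind: "indicator B \<in> borel_measurable (F t)" using B by simp
  note I = sf.real_cond_exp_intg[OF int ind g]
  have intB: "integrable M (\<lambda>\<omega>. indicator B \<omega> * k)" for k :: real
    using BM by (intro integrable_mult_indicator[where 'b = real, simplified] ) auto
  have iB: "(\<integral>\<omega>. indicator B \<omega> * k \<partial>M) = k * prob B" for k :: real
    using BM by (simp add: mult.commute)
  have "(\<integral>\<omega>. indicator B \<omega> * g \<omega> \<partial>M) - a * prob B = (\<integral>\<omega>. indicator B \<omega> * real_cond_exp M (F t) g \<omega> \<partial>M) - (\<integral>\<omega>. indicator B \<omega> * a \<partial>M)"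
    by (simp only: I(2) iB)
  also have "\<dots> = (\<integral>\<omega>. indicator B \<omega> * real_cond_exp M (F t) g \<omega> - indicator B \<omega> * a \<partial>M)"
    by (rule Bochner_Integration.integral_diff[symmetric]) (rule I(1), rule intB)
  finally have eq: "(\<integral>\<omega>. indicator B \<omega> * g \<omega> \<partial>M) - a * prob B = (\<integral>\<omega>. indicator B \<omega> * real_cond_exp M (F t) g \<omega> - indicator B \<omega> * a \<partial>M)" .
  have "\<bar>\<integral>\<omega>. indicator B \<omega> * real_cond_exp M (F t) g \<omega> - indicator B \<omega> * a \<partial>M\<bar> \<le> (\<integral>\<omega>. indicator B \<omega> * e \<partial>M)"
  proof (rule integral_abs_bound[THEN order_trans], rule integral_mono_AE)
    show "integrable M (\<lambda>\<omega>. \<bar>indicator B \<omega> * real_cond_exp M (F t) g \<omega> - indicator B \<omega> * a\<bar>)"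
      using I(1) intB[of a] by simp
    show "AE \<omega> in M. \<bar>indicator B \<omega> * real_cond_exp M (F t) g \<omega> - indicator B \<omega> * a\<bar> \<le> indicator B \<omega> * e"
      using AE by eventually_elim (auto simp: indicator_def)
  qed (rule intB)
  then show ?thesis unfolding eq iB .
qed

lemma jump_moment:
  assumes t: "1 \<le> t" and B: "B \<in> sets (F t)" "B \<subseteq> {\<omega> \<in> space M. X t \<omega> = x}"
  shows "integrable M (\<lambda>\<omega>. indicator B \<omega> * \<bar>X (t + 1) \<omega> - X t \<omega>\<bar> powr p)"
    and "(\<integral>\<omega>. indicator B \<omega> * \<bar>X (t + 1) \<omega> - X t \<omega>\<bar> powr p \<partial>M) \<le> C * (1 + x) powr (p - 2 - \<delta>) * prob B"
proof -
  interpret sf: sigma_finite_subalgebra M "F t" by (rule sigma_finite_F[OF t])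
  have BM [measurable]: "B \<in> sets M" using sets_F_M[OF t B(1)] .
  have [measurable]: "X t \<in> borel_measurable M" "X (t + 1) \<in> borel_measurable M" using t by auto
  let ?g = "\<lambda>\<omega>. \<bar>X (t + 1) \<omega> - X t \<omega>\<bar> powr p"
  have ind: "(\<lambda>\<omega>. indicator B \<omega> :: ennreal) \<in> borel_measurable (F t)" using B by simp
  have "(\<integral>\<^sup>+\<omega>. ennreal (indicator B \<omega> * ?g \<omega>) \<partial>M) = (\<integral>\<^sup>+\<omega>. indicator B \<omega> * ennreal (?g \<omega>) \<partial>M)"
    by (intro nn_integral_cong) (auto simp: indicator_def)
  also have "\<dots> = (\<integral>\<^sup>+\<omega>. indicator B \<omega> * nn_cond_exp M (F t) (\<lambda>\<omega>. ennreal (?g \<omega>)) \<omega> \<partial>M)"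
    by (rule sf.nn_cond_exp_intg[OF ind, symmetric]) measurable
  also have "\<dots> \<le> (\<integral>\<^sup>+\<omega>. ennreal (C * (1 + x) powr (p - 2 - \<delta>)) * indicator B \<omega> \<partial>M)"
  proof (rule nn_integral_mono_AE)
    show "AE \<omega> in M. indicator B \<omega> * nn_cond_exp M (F t) (\<lambda>\<omega>. ennreal (?g \<omega>)) \<omega> \<le> ennreal (C * (1 + x) powr (p - 2 - \<delta>)) * indicator B \<omega>"
      using Mp[OF t] by eventually_elim (use B(2) in \<open>auto simp: indicator_def\<close>)
  qed
  also have "\<dots> = ennreal (C * (1 + x) powr (p - 2 - \<delta>)) * ennreal (prob B)"
    using BM by (subst nn_integral_cmult_indicator) (auto simp: emeasure_eq_measure)
  also have "\<dots> = ennreal (C * (1 + x) powr (p - 2 - \<delta>) * prob B)"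
    using C_pos by (simp add: ennreal_mult)
  finally have le: "(\<integral>\<^sup>+\<omega>. ennreal (indicator B \<omega> * ?g \<omega>) \<partial>M) \<le> ennreal (C * (1 + x) powr (p - 2 - \<delta>) * prob B)" .
  show int: "integrable M (\<lambda>\<omega>. indicator B \<omega> * ?g \<omega>)"
  proof (rule integrableI_bounded)
    show "(\<lambda>\<omega>. indicator B \<omega> * ?g \<omega>) \<in> borel_measurable M" by measurable
    have "(\<integral>\<^sup>+\<omega>. ennreal (norm (indicator B \<omega> * ?g \<omega>)) \<partial>M) = (\<integral>\<^sup>+\<omega>. ennreal (indicator B \<omega> * ?g \<omega>) \<partial>M)" by simp
    also have "\<dots> < \<infinity>" using le by (rule le_less_trans) simp
    finally show "(\<integral>\<^sup>+\<omega>. ennreal (norm (indicator B \<omega> * ?g \<omega>)) \<partial>M) < \<infinity>" .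
  qed
  have "ennreal (\<integral>\<omega>. indicator B \<omega> * ?g \<omega> \<partial>M) = (\<integral>\<^sup>+\<omega>. ennreal (indicator B \<omega> * ?g \<omega>) \<partial>M)"
    by (rule nn_integral_eq_integral[OF int, symmetric]) auto
  with le have "ennreal (\<integral>\<omega>. indicator B \<omega> * ?g \<omega> \<partial>M) \<le> ennreal (C * (1 + x) powr (p - 2 - \<delta>) * prob B)"
    by (simp only:)
  then show "(\<integral>\<omega>. indicator B \<omega> * ?g \<omega> \<partial>M) \<le> C * (1 + x) powr (p - 2 - \<delta>) * prob B"
    by (subst (asm) ennreal_le_iff) (use C_pos in auto)
qed

lemma local_integrable:
  assumes t: "1 \<le> t" and B: "B \<in> sets (F t)" "B \<subseteq> {\<omega> \<in> space M. X t \<omega> = x}"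
    and g: "g \<in> borel_measurable borel" and bd: "\<And>y. 0 \<le> y \<Longrightarrow> \<bar>g y\<bar> \<le> A + K * \<bar>y - x\<bar> powr p"
  shows "integrable M (\<lambda>\<omega>. indicator B \<omega> * (g (X (t + 1) \<omega>) :: real))"
proof (rule Bochner_Integration.integrable_bound)
  have BM [measurable]: "B \<in> sets M" using sets_F_M[OF t B(1)] .
  have [measurable]: "X (t + 1) \<in> borel_measurable M" "g \<in> borel_measurable borel" using t g by auto
  show "integrable M (\<lambda>\<omega>. A * indicator B \<omega> + K * (indicator B \<omega> * \<bar>X (t + 1) \<omega> - X t \<omega>\<bar> powr p))"
    by (intro Bochner_Integration.integrable_add integrable_mult_right jump_moment(1)[OF t B]
        integrable_real_indicator) (auto simp: emeasure_eq_measure)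
  show "(\<lambda>\<omega>. indicator B \<omega> * g (X (t + 1) \<omega>)) \<in> borel_measurable M" by measurable
  show "AE \<omega> in M. norm (indicator B \<omega> * g (X (t + 1) \<omega>)) \<le> norm (A * indicator B \<omega> + K * (indicator B \<omega> * \<bar>X (t + 1) \<omega> - X t \<omega>\<bar> powr p))"
  proof (rule AE_I2)
    fix \<omega> assume \<omega>: "\<omega> \<in> space M"
    show "norm (indicator B \<omega> * g (X (t + 1) \<omega>)) \<le> norm (A * indicator B \<omega> + K * (indicator B \<omega> * \<bar>X (t + 1) \<omega> - X t \<omega>\<bar> powr p))"
    proof (cases "\<omega> \<in> B")
      case True
      then have "X t \<omega> = x" using B(2) by auto
      then show ?thesis using bd[of "X (t + 1) \<omega>"] X_nonneg[of "t + 1" \<omega>] \<omega> True by simp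
    qed simp
  qed
qed

lemma abs_le_one_plus_powr: "\<bar>d\<bar> \<le> 1 + \<bar>d\<bar> powr p" and sq_le_one_plus_powr: "d\<^sup>2 \<le> 1 + \<bar>d\<bar> powr p"
proof -
  have "\<bar>d\<bar> powr q \<le> 1 + \<bar>d\<bar> powr p" if "0 \<le> q" "q \<le> p" for q
  proof (cases "\<bar>d\<bar> \<le> 1")
    case True
    have "\<bar>d\<bar> powr q \<le> 1 powr q" using True that by (intro powr_mono2) auto
    then show ?thesis by (simp add: add_increasing2)
  next
    case False
    then have "\<bar>d\<bar> powr q \<le> \<bar>d\<bar> powr p" using that by (intro powr_mono) auto
    then show ?thesis by simp
  qed
  from this[of 1] this[of 2] show "\<bar>d\<bar> \<le> 1 + \<bar>d\<bar> powr p" "d\<^sup>2 \<le> 1 + \<bar>d\<bar> powr p" using p_gt by auto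
qed

lemma local_jump_integrable:
  assumes t: "1 \<le> t" and B: "B \<in> sets (F t)" "B \<subseteq> {\<omega> \<in> space M. X t \<omega> = x}"
  shows "integrable M (\<lambda>\<omega>. indicator B \<omega> * (X (t + 1) \<omega> - X t \<omega>))"
    and "integrable M (\<lambda>\<omega>. indicator B \<omega> * (X (t + 1) \<omega> - X t \<omega>)\<^sup>2)"
proof -
  have eq: "(\<lambda>\<omega>. indicator B \<omega> * (X (t + 1) \<omega> - X t \<omega>)) = (\<lambda>\<omega>. indicator B \<omega> * (X (t + 1) \<omega> - x))"
    "(\<lambda>\<omega>. indicator B \<omega> * (X (t + 1) \<omega> - X t \<omega>)\<^sup>2) = (\<lambda>\<omega>. indicator B \<omega> * (X (t + 1) \<omega> - x)\<^sup>2)"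
    using B(2) by (auto simp: fun_eq_iff indicator_def)
  show "integrable M (\<lambda>\<omega>. indicator B \<omega> * (X (t + 1) \<omega> - X t \<omega>))"
    unfolding eq by (rule local_integrable[OF t B, where A = 1 and K = 1]) (auto simp: abs_le_one_plus_powr)
  show "integrable M (\<lambda>\<omega>. indicator B \<omega> * (X (t + 1) \<omega> - X t \<omega>)\<^sup>2)"
    unfolding eq by (rule local_integrable[OF t B, where A = 1 and K = 1]) (auto simp: sq_le_one_plus_powr)
qed

lemma local_mean:
  assumes e: "0 < e"
  obtains x0 where "\<And>t x B. x0 \<le> x \<Longrightarrow> 1 \<le> t \<Longrightarrow> B \<in> sets (F t) \<Longrightarrow> B \<subseteq> {\<omega> \<in> space M. X t \<omega> = x} \<Longrightarrow>
      \<bar>(\<integral>\<omega>. indicator B \<omega> * (X (t + 1) \<omega> - X t \<omega>) \<partial>M) - c / x * prob B\<bar> \<le> e / (x * ln x) * prob B"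
proof -
  obtain x0 where x0: "\<And>t. 1 \<le> t \<Longrightarrow> AE \<omega> in M. X t \<omega> \<ge> x0 \<longrightarrow>
      \<bar>real_cond_exp M (F t) (\<lambda>\<omega>'. X (t + 1) \<omega>' - X t \<omega>') \<omega> - c / X t \<omega>\<bar> \<le> e / (X t \<omega> * ln (X t \<omega>))"
    using A2_mean[OF e] by blast
  show thesis
  proof (rule that[of x0])
    fix t x B assume x: "x0 \<le> x" and t: "1 \<le> t" and B: "B \<in> sets (F t)" "B \<subseteq> {\<omega> \<in> space M. X t \<omega> = x}"
    show "\<bar>(\<integral>\<omega>. indicator B \<omega> * (X (t + 1) \<omega> - X t \<omega>) \<partial>M) - c / x * prob B\<bar> \<le> e / (x * ln x) * prob B"
    proof (rule cond_exp_local_bounds[OF t B(1) _ local_jump_integrable(1)[OF t B]])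
      show "(\<lambda>\<omega>. X (t + 1) \<omega> - X t \<omega>) \<in> borel_measurable M"
        using t by (intro borel_measurable_diff X_measurable) auto
      show "AE \<omega> in M. \<omega> \<in> B \<longrightarrow> \<bar>real_cond_exp M (F t) (\<lambda>\<omega>. X (t + 1) \<omega> - X t \<omega>) \<omega> - c / x\<bar> \<le> e / (x * ln x)"
        using x0[OF t] by eventually_elim (use B(2) x in auto)
    qed
  qed
qed

lemma local_var:
  assumes e: "0 < e"
  obtains x0 where "\<And>t x B. x0 \<le> x \<Longrightarrow> 1 \<le> t \<Longrightarrow> B \<in> sets (F t) \<Longrightarrow> B \<subseteq> {\<omega> \<in> space M. X t \<omega> = x} \<Longrightarrow>
      \<bar>(\<integral>\<omega>. indicator B \<omega> * (X (t + 1) \<omega> - X t \<omega>)\<^sup>2 \<partial>M) - s2 * prob B\<bar> \<le> e / ln x * prob B"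
proof -
  obtain x0 where x0: "\<And>t. 1 \<le> t \<Longrightarrow> AE \<omega> in M. X t \<omega> \<ge> x0 \<longrightarrow>
      \<bar>real_cond_exp M (F t) (\<lambda>\<omega>'. (X (t + 1) \<omega>' - X t \<omega>')\<^sup>2) \<omega> - s2\<bar> \<le> e / ln (X t \<omega>)"
    using A2_var[OF e] by blast
  show thesis
  proof (rule that[of x0])
    fix t x B assume x: "x0 \<le> x" and t: "1 \<le> t" and B: "B \<in> sets (F t)" "B \<subseteq> {\<omega> \<in> space M. X t \<omega> = x}"
    show "\<bar>(\<integral>\<omega>. indicator B \<omega> * (X (t + 1) \<omega> - X t \<omega>)\<^sup>2 \<partial>M) - s2 * prob B\<bar> \<le> e / ln x * prob B"
    proof (rule cond_exp_local_bounds[OF t B(1) _ local_jump_integrable(2)[OF t B]])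
      show "(\<lambda>\<omega>. (X (t + 1) \<omega> - X t \<omega>)\<^sup>2) \<in> borel_measurable M"
        using t by (intro borel_measurable_power borel_measurable_diff X_measurable) auto
      show "AE \<omega> in M. \<omega> \<in> B \<longrightarrow> \<bar>real_cond_exp M (F t) (\<lambda>\<omega>. (X (t + 1) \<omega> - X t \<omega>)\<^sup>2) \<omega> - s2\<bar> \<le> e / ln x"
        using x0[OF t] by eventually_elim (use B(2) x in auto)
    qed
  qed
qed

text \<open>Replacing \<open>x\<close> by \<open>max x e\<close> keeps the logarithm at least 1 and makes \<open>lyap b\<close> monotone for \<open>b \<ge> -(1 + r)\<close>.\<close>

definition lyap :: "real \<Rightarrow> real \<Rightarrow> real" where "lyap b x = powln (1 + r) b (max x (exp 1))"
definition lyap_rate :: "real \<Rightarrow> real \<Rightarrow> real" where "lyap_rate b x = powln (r - 1) (b - 1) (max x (exp 1))"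

lemma max_e_gt_1: "1 < max x (exp (1::real))"
  using exp_gt_one[of "1::real"] by linarith

lemma lyap_pos: "0 < lyap b x" and lyap_rate_pos: "0 < lyap_rate b x"
  unfolding lyap_def lyap_rate_def by (intro powln_pos max_e_gt_1)+

lemma lyap_measurable [measurable]: "lyap b \<in> borel_measurable borel" and lyap_rate_measurable [measurable]: "lyap_rate b \<in> borel_measurable borel"
  unfolding lyap_def[abs_def] lyap_rate_def[abs_def] powln_def[abs_def] by measurable

lemma lyap_mono: "0 \<le> 1 + r + b \<Longrightarrow> x \<le> y \<Longrightarrow> lyap b x \<le> lyap b y"
  unfolding lyap_def using r_gt by (intro powln_mono) auto

lemma lyap_growth: obtains A where "0 < A" "\<And>y. 0 \<le> y \<Longrightarrow> lyap b y \<le> A * (1 + y powr p)"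
proof -
  obtain K where K: "0 < K" "\<And>u. exp 1 \<le> u \<Longrightarrow> powln (1 + r) b u \<le> K * u powr (1 + r + (p - 1 - r))"
    using powln_le_powr[of "p - 1 - r" "1 + r" b] p_gt by auto
  have "lyap b y \<le> K * exp 1 powr p * (1 + y powr p)" if "0 \<le> y" for y
  proof -
    have "lyap b y \<le> K * (max y (exp 1)) powr p" unfolding lyap_def using K(2)[of "max y (exp 1)"] by simp
    also have "(max y (exp 1)) powr p \<le> exp 1 powr p * (1 + y powr p)"
    proof (cases "y \<le> exp 1")
      case True then show ?thesis by (simp add: max_def distrib_left)
    next
      case False
      have "y powr p * 1 \<le> y powr p * exp 1 powr p" by (intro mult_left_mono) (use p_gt in \<open>auto simp: ge_one_powr_ge_zero\<close>)
      then show ?thesis using False by (simp add: max_def distrib_left mult.commute add_increasing)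
    qed
    then have "K * (max y (exp 1)) powr p \<le> K * (exp 1 powr p * (1 + y powr p))" using K(1) by (intro mult_left_mono) auto
    finally show ?thesis by (simp add: mult.assoc)
  qed
  then show thesis using K that[of "K * exp 1 powr p"] by simp
qed

lemma lyap_local_bound: obtains A K where "0 < A" "0 < K" "\<And>y. 0 \<le> y \<Longrightarrow> \<bar>lyap b y\<bar> \<le> A + K * \<bar>y - x\<bar> powr p"
proof -
  obtain A where A: "0 < A" "\<And>y. 0 \<le> y \<Longrightarrow> lyap b y \<le> A * (1 + y powr p)" by (rule lyap_growth[of b]) auto
  have "\<bar>lyap b y\<bar> \<le> A * (1 + (2 * \<bar>x\<bar>) powr p) + A * 2 powr p * \<bar>y - x\<bar> powr p" if y: "0 \<le> y" for y
  proof -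
    have "y powr p \<le> (2 * \<bar>x\<bar>) powr p + 2 powr p * \<bar>y - x\<bar> powr p"
    proof (cases "\<bar>x\<bar> \<ge> \<bar>y - x\<bar>")
      case True
      then have "y powr p \<le> (2 * \<bar>x\<bar>) powr p" using y p_gt by (intro powr_mono2) auto
      then show ?thesis by (simp add: add_increasing2)
    next
      case False
      then have "y powr p \<le> (2 * \<bar>y - x\<bar>) powr p" using y p_gt by (intro powr_mono2) auto
      then show ?thesis by (simp add: powr_mult add_increasing)
    qed
    then have "A * (1 + y powr p) \<le> A * (1 + ((2 * \<bar>x\<bar>) powr p + 2 powr p * \<bar>y - x\<bar> powr p))" using A(1) by simp
    moreover have "\<bar>lyap b y\<bar> \<le> A * (1 + y powr p)" using A(2)[OF y] lyap_pos[of b y] by simp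
    ultimately show ?thesis by (simp add: algebra_simps)
  qed
  then show thesis using A by (intro that[of "A * (1 + (2 * \<bar>x\<bar>) powr p)" "A * 2 powr p"]) (auto intro!: mult_pos_pos add_pos_nonneg)
qed

lemma lyap_local_integrable:
  assumes t: "1 \<le> t" and B: "B \<in> sets (F t)" "B \<subseteq> {\<omega> \<in> space M. X t \<omega> = x}"
  shows "integrable M (\<lambda>\<omega>. indicator B \<omega> * lyap b (X (t + 1) \<omega>))"
proof -
  obtain A K where "\<And>y. 0 \<le> y \<Longrightarrow> \<bar>lyap b y\<bar> \<le> A + K * \<bar>y - x\<bar> powr p" by (rule lyap_local_bound[of b x]) auto
  then show ?thesis by (intro local_integrable[OF t B, where A = A and K = K]) auto
qed

lemma lyap_drift:
  assumes e: "0 < e"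
  shows "\<exists>x0\<ge>exp 1. \<forall>t x B. x0 \<le> x \<longrightarrow> 1 \<le> t \<longrightarrow> B \<in> sets (F t) \<longrightarrow> B \<subseteq> {\<omega> \<in> space M. X t \<omega> = x} \<longrightarrow>
      \<bar>(\<integral>\<omega>. indicator B \<omega> * lyap b (X (t + 1) \<omega>) \<partial>M) - lyap b x * prob B - s2 / 2 * (1 + r) * b * lyap_rate b x * prob B\<bar>
        \<le> e * lyap_rate b x * prob B"
proof -
  let ?g = "1 + r"
  have g: "0 < ?g" "?g < p" using r_gt p_gt by auto
  obtain K \<theta> x1 where K: "0 < K" "0 < \<theta>" "exp 1 \<le> x1"
    and tay: "\<And>x y. x1 \<le> x \<Longrightarrow> 0 \<le> y \<Longrightarrow>
      \<bar>powln ?g b (max y (exp 1)) - powln ?g b x - powln1 ?g b x * (y - x) - powln2 ?g b x * (y - x)\<^sup>2 / 2\<bar>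
      \<le> K * (x powr (?g - 2 - \<theta>) * (y - x)\<^sup>2 + x powr (?g - p + \<delta> - \<theta>) * \<bar>y - x\<bar> powr p)"
    by (rule powln_taylor_bound[OF g p_gt(1) \<delta>_pos, of b]) blast
  have cc: "c = - (?g - 1) * s2 / 2" using r_def s2_pos by (simp add: field_simps)
  obtain e' x2 where e': "0 < e'" "exp 1 \<le> x2" and est:
    "\<And>x e1 e2 ep ef. x2 \<le> x \<Longrightarrow> \<bar>e1 - c / x\<bar> \<le> e' / (x * ln x) \<Longrightarrow> \<bar>e2 - s2\<bar> \<le> e' / ln x \<Longrightarrow>
      ep \<le> C * (1 + x) powr (p - 2 - \<delta>) \<Longrightarrow>
      \<bar>ef - powln1 ?g b x * e1 - powln2 ?g b x * e2 / 2\<bar>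
        \<le> K * (x powr (?g - 2 - \<theta>) * e2 + x powr (?g - p + \<delta> - \<theta>) * ep) \<Longrightarrow>
      \<bar>ef - s2 / 2 * ?g * b * powln (?g - 2) (b - 1) x\<bar> \<le> e * powln (?g - 2) (b - 1) x"
    by (rule powln_drift_estimate[OF g(1) s2_pos cc C_pos K(1,2) e, of p \<delta> b]) blast
  obtain x3 where x3: "\<And>t x B. x3 \<le> x \<Longrightarrow> 1 \<le> t \<Longrightarrow> B \<in> sets (F t) \<Longrightarrow> B \<subseteq> {\<omega> \<in> space M. X t \<omega> = x} \<Longrightarrow>
      \<bar>(\<integral>\<omega>. indicator B \<omega> * (X (t + 1) \<omega> - X t \<omega>) \<partial>M) - c / x * prob B\<bar> \<le> e' / (x * ln x) * prob B"
    using local_mean[OF e'(1)] by blast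
  obtain x4 where x4: "\<And>t x B. x4 \<le> x \<Longrightarrow> 1 \<le> t \<Longrightarrow> B \<in> sets (F t) \<Longrightarrow> B \<subseteq> {\<omega> \<in> space M. X t \<omega> = x} \<Longrightarrow>
      \<bar>(\<integral>\<omega>. indicator B \<omega> * (X (t + 1) \<omega> - X t \<omega>)\<^sup>2 \<partial>M) - s2 * prob B\<bar> \<le> e' / ln x * prob B"
    using local_var[OF e'(1)] by blast
  show ?thesis
  proof (rule exI[of _ "max (max x1 x2) (max x3 x4)"], intro conjI allI impI)
    show "exp 1 \<le> max (max x1 x2) (max x3 x4)" using K(3) by linarith
    fix t x B assume xx: "max (max x1 x2) (max x3 x4) \<le> x" and t: "1 \<le> t"
      and B: "B \<in> sets (F t)" "B \<subseteq> {\<omega> \<in> space M. X t \<omega> = x}"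
    have x: "x1 \<le> x" "x2 \<le> x" "x3 \<le> x" "x4 \<le> x" using xx by auto
    have xe: "exp 1 \<le> x" using x K(3) by linarith
    have BM: "B \<in> sets M" using sets_F_M[OF t B(1)] .
    define I1 where "I1 = (\<integral>\<omega>. indicator B \<omega> * (X (t + 1) \<omega> - X t \<omega>) \<partial>M)"
    define I2 where "I2 = (\<integral>\<omega>. indicator B \<omega> * (X (t + 1) \<omega> - X t \<omega>)\<^sup>2 \<partial>M)"
    define Ip where "Ip = (\<integral>\<omega>. indicator B \<omega> * \<bar>X (t + 1) \<omega> - X t \<omega>\<bar> powr p \<partial>M)"
    define If where "If = (\<integral>\<omega>. indicator B \<omega> * lyap b (X (t + 1) \<omega>) \<partial>M)"
    note int1 = local_jump_integrable(1)[OF t B]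
    note int2 = local_jump_integrable(2)[OF t B]
    note intp = jump_moment(1)[OF t B]
    note intf = lyap_local_integrable[OF t B, of b]
    have intB: "integrable M (\<lambda>\<omega>. indicator B \<omega> * k)" for k :: real
      using BM by (intro integrable_mult_indicator[where 'b = real, simplified]) auto
    have iB: "(\<integral>\<omega>. indicator B \<omega> * k \<partial>M) = k * prob B" for k :: real
      using BM by (simp add: mult.commute)
    have lfx: "lyap b x = powln ?g b x" and lwx: "lyap_rate b x = powln (?g - 2) (b - 1) x"
      using xe by (auto simp: lyap_def lyap_rate_def max_def)
    define A1 where "A1 = powln1 ?g b x"
    define A2 where "A2 = powln2 ?g b x / 2"
    define q2 where "q2 = x powr (?g - 2 - \<theta>)"
    define qp where "qp = x powr (?g - p + \<delta> - \<theta>)"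
    have "\<bar>If - lyap b x * prob B - A1 * I1 - A2 * I2\<bar>
       = \<bar>\<integral>\<omega>. indicator B \<omega> * lyap b (X (t + 1) \<omega>) - indicator B \<omega> * lyap b x - A1 * (indicator B \<omega> * (X (t + 1) \<omega> - X t \<omega>))
           - A2 * (indicator B \<omega> * (X (t + 1) \<omega> - X t \<omega>)\<^sup>2) \<partial>M\<bar>"
      using int1 int2 intf intB[of "lyap b x"] unfolding If_def I1_def I2_def iB[symmetric] by simp
    also have "\<dots> \<le> (\<integral>\<omega>. K * (q2 * (indicator B \<omega> * (X (t + 1) \<omega> - X t \<omega>)\<^sup>2) + qp * (indicator B \<omega> * \<bar>X (t + 1) \<omega> - X t \<omega>\<bar> powr p)) \<partial>M)"
    proof (rule integral_abs_bound[THEN order_trans], rule integral_mono)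
      show "integrable M (\<lambda>\<omega>. \<bar>indicator B \<omega> * lyap b (X (t + 1) \<omega>) - indicator B \<omega> * lyap b x - A1 * (indicator B \<omega> * (X (t + 1) \<omega> - X t \<omega>))
           - A2 * (indicator B \<omega> * (X (t + 1) \<omega> - X t \<omega>)\<^sup>2)\<bar>)"
        by (intro integrable_abs Bochner_Integration.integrable_diff integrable_mult_right int1 int2 intf intB)
      show "integrable M (\<lambda>\<omega>. K * (q2 * (indicator B \<omega> * (X (t + 1) \<omega> - X t \<omega>)\<^sup>2) + qp * (indicator B \<omega> * \<bar>X (t + 1) \<omega> - X t \<omega>\<bar> powr p)))"
        by (intro Bochner_Integration.integrable_add integrable_mult_right int2 intp)
      fix \<omega> assume \<omega>: "\<omega> \<in> space M"
      show "\<bar>indicator B \<omega> * lyap b (X (t + 1) \<omega>) - indicator B \<omega> * lyap b x - A1 * (indicator B \<omega> * (X (t + 1) \<omega> - X t \<omega>))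
           - A2 * (indicator B \<omega> * (X (t + 1) \<omega> - X t \<omega>)\<^sup>2)\<bar>
         \<le> K * (q2 * (indicator B \<omega> * (X (t + 1) \<omega> - X t \<omega>)\<^sup>2) + qp * (indicator B \<omega> * \<bar>X (t + 1) \<omega> - X t \<omega>\<bar> powr p))"
      proof (cases "\<omega> \<in> B")
        case True
        then have Xt: "X t \<omega> = x" using B(2) by auto
        have "0 \<le> X (t + 1) \<omega>" using X_nonneg[of "t + 1"] \<omega> by simp
        from tay[OF x(1) this] show ?thesis
          using True unfolding Xt lfx A1_def A2_def q2_def qp_def by (simp add: lyap_def[of b "X (Suc t) \<omega>"])
      qed simp
    qed
    also have "\<dots> = K * (q2 * I2 + qp * Ip)"
      using int2 intp unfolding I2_def Ip_def by simp
    finally have main: "\<bar>If - lyap b x * prob B - A1 * I1 - A2 * I2\<bar> \<le> K * (q2 * I2 + qp * Ip)" .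
    show "\<bar>(\<integral>\<omega>. indicator B \<omega> * lyap b (X (t + 1) \<omega>) \<partial>M) - lyap b x * prob B - s2 / 2 * (1 + r) * b * lyap_rate b x * prob B\<bar>
        \<le> e * lyap_rate b x * prob B"
    proof (cases "prob B = 0")
      case True
      then have "emeasure M B = 0" by (simp add: emeasure_eq_measure)
      then have "AE \<omega> in M. \<omega> \<notin> B" using BM by (intro AE_not_in) (auto simp: null_sets_def)
      then have "(\<integral>\<omega>. indicator B \<omega> * lyap b (X (t + 1) \<omega>) \<partial>M) = (\<integral>\<omega>. 0 \<partial>M)"
        using intf by (intro integral_cong_AE) (auto intro: borel_measurable_integrable simp: indicator_def)
      then show ?thesis using True by simp
    next
      case False
      define P where "P = prob B"
      have P: "0 < P" using False by (simp add: P_def zero_less_measure_iff)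
      have sc: "\<bar>u / P - v\<bar> \<le> w" if "\<bar>u - v * P\<bar> \<le> w * P" for u v w :: real
      proof -
        have "u / P - v = (u - v * P) / P" using P by (simp add: field_simps)
        then have "\<bar>u / P - v\<bar> = \<bar>u - v * P\<bar> / P" using P by (simp only: abs_divide abs_of_pos)
        then show ?thesis using that P by (simp only: pos_divide_le_eq)
      qed
      have a1: "\<bar>I1 / P - c / x\<bar> \<le> e' / (x * ln x)"
        using x3[OF x(3) t B] unfolding I1_def P_def[symmetric] by (rule sc)
      have a2: "\<bar>I2 / P - s2\<bar> \<le> e' / ln x"
        using x4[OF x(4) t B] unfolding I2_def P_def[symmetric] by (rule sc)
      have ap: "Ip / P \<le> C * (1 + x) powr (p - 2 - \<delta>)"
        using jump_moment(2)[OF t B] P unfolding Ip_def P_def by (simp add: field_simps)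
      have "\<bar>(If / P - lyap b x) - A1 * (I1 / P) - powln2 ?g b x * (I2 / P) / 2\<bar> = \<bar>If - lyap b x * P - A1 * I1 - A2 * I2\<bar> / P"
      proof -
        have "(If / P - lyap b x) - A1 * (I1 / P) - powln2 ?g b x * (I2 / P) / 2 = (If - lyap b x * P - A1 * I1 - A2 * I2) / P"
          using P unfolding A2_def by (simp add: field_simps)
        then show ?thesis using P by (simp add: abs_divide)
      qed
      also have "\<dots> \<le> K * (q2 * I2 + qp * Ip) / P" using main P unfolding P_def by (intro divide_right_mono) auto
      also have "\<dots> = K * (q2 * (I2 / P) + qp * (Ip / P))" using P by (simp add: field_simps)
      finally have "\<bar>(If / P - lyap b x) - s2 / 2 * ?g * b * powln (?g - 2) (b - 1) x\<bar> \<le> e * powln (?g - 2) (b - 1) x"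
        unfolding A1_def q2_def qp_def by (rule est[OF x(2) a1 a2 ap])
      then have "\<bar>(If / P - lyap b x) - s2 / 2 * ?g * b * lyap_rate b x\<bar> * P \<le> e * lyap_rate b x * P"
        unfolding lwx using P by (intro mult_right_mono) auto
      also have "\<bar>(If / P - lyap b x) - s2 / 2 * ?g * b * lyap_rate b x\<bar> * P = \<bar>If - lyap b x * P - s2 / 2 * ?g * b * lyap_rate b x * P\<bar>"
      proof -
        have "If - lyap b x * P - s2 / 2 * ?g * b * lyap_rate b x * P = ((If / P - lyap b x) - s2 / 2 * ?g * b * lyap_rate b x) * P"
          using P by (simp add: field_simps)
        then show ?thesis using P by (simp add: abs_mult)
      qed
      finally show ?thesis unfolding If_def P_def .
    qed
  qed
qed

section \<open>The first excursion: upper bounds\<close>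

text \<open>For \<open>t \<ge> 1\<close>, \<open>alive t\<close> is the event that \<open>t < \<tau>\<^sub>1\<close>.\<close>

definition alive :: "nat \<Rightarrow> 'a set" where
  "alive t = {\<omega> \<in> space M. \<forall>s\<in>{2..t}. X s \<omega> \<noteq> 0}"

definition below :: "real \<Rightarrow> nat \<Rightarrow> 'a set" where
  "below n t = {\<omega> \<in> alive t. \<forall>s\<in>{1..t}. X s \<omega> < n}"

lemma pred_F_bounded_all:
  assumes "\<And>s. s \<in> I \<Longrightarrow> {\<omega> \<in> space M. P s \<omega>} \<in> sets (F t)" "finite I"
  shows "{\<omega> \<in> space M. \<forall>s\<in>I. P s \<omega>} \<in> sets (F t)"
  using sets.sets_Collect_finite_All[of I "F t" P] assms by simp

lemma X_preimage_F:
  assumes "1 \<le> s" "s \<le> t" "A \<in> sets borel" shows "{\<omega> \<in> space M. X s \<omega> \<in> A} \<in> sets (F t)"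
  using measurable_sets[OF X_measurable_F[OF assms(1,2)] assms(3)] by (simp add: vimage_def Int_def conj_commute)

lemma X_eq_F: "1 \<le> s \<Longrightarrow> s \<le> t \<Longrightarrow> {\<omega> \<in> space M. X s \<omega> = x} \<in> sets (F t)"
  and X_less_F: "1 \<le> s \<Longrightarrow> s \<le> t \<Longrightarrow> {\<omega> \<in> space M. X s \<omega> < x} \<in> sets (F t)"
  and X_ge_F: "1 \<le> s \<Longrightarrow> s \<le> t \<Longrightarrow> {\<omega> \<in> space M. x \<le> X s \<omega>} \<in> sets (F t)"
  and X_neq_F: "1 \<le> s \<Longrightarrow> s \<le> t \<Longrightarrow> {\<omega> \<in> space M. X s \<omega> \<noteq> x} \<in> sets (F t)"
  using X_preimage_F[of s t "{x}"] X_preimage_F[of s t "{..<x}"] X_preimage_F[of s t "{x..}"] X_preimage_F[of s t "- {x}"]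
  by auto

lemma alive_F: "s \<le> t \<Longrightarrow> alive s \<in> sets (F t)"
  unfolding alive_def by (intro pred_F_bounded_all X_neq_F) auto

lemma alive_M: "alive t \<in> sets M"
  using sets_F_M[OF _ alive_F[of t "Suc t"]] by simp

lemma below_F: "below n t \<in> sets (F t)"
proof -
  have "below n t = alive t \<inter> {\<omega> \<in> space M. \<forall>s\<in>{1..t}. X s \<omega> < n}"
    unfolding below_def alive_def by auto
  moreover have "{\<omega> \<in> space M. \<forall>s\<in>{1..t}. X s \<omega> < n} \<in> sets (F t)"
    by (intro pred_F_bounded_all X_less_F) auto
  ultimately show ?thesis using alive_F[of t t] by simp
qed

lemma alive_antimono: "s \<le> t \<Longrightarrow> alive t \<subseteq> alive s"
  unfolding alive_def by auto

lemma local_to_global_le: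
  assumes t: "1 \<le> t" and B: "B \<in> sets (F t)" "B \<subseteq> {\<omega> \<in> space M. X t \<omega> < n}"
    and li: "\<And>x. x \<in> S \<Longrightarrow> x < n \<Longrightarrow> integrable M (\<lambda>\<omega>. indicator (B \<inter> {\<omega> \<in> space M. X t \<omega> = x}) \<omega> * (g \<omega> :: real))"
    and ll: "\<And>x. x \<in> S \<Longrightarrow> x < n \<Longrightarrow> (\<integral>\<omega>. indicator (B \<inter> {\<omega> \<in> space M. X t \<omega> = x}) \<omega> * g \<omega> \<partial>M)
               \<le> h x * prob (B \<inter> {\<omega> \<in> space M. X t \<omega> = x})"
  shows "integrable M (\<lambda>\<omega>. indicator B \<omega> * g \<omega>)" (is ?i1)
    and "integrable M (\<lambda>\<omega>. indicator B \<omega> * h (X t \<omega>))" (is ?i2)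
    and "(\<integral>\<omega>. indicator B \<omega> * g \<omega> \<partial>M) \<le> (\<integral>\<omega>. indicator B \<omega> * h (X t \<omega>) \<partial>M)" (is ?le)
proof -
  define Q where "Q = {x \<in> S. x < n}"
  define E where "E = (\<lambda>x. B \<inter> {\<omega> \<in> space M. X t \<omega> = x})"
  have fQ: "finite Q" unfolding Q_def by (rule finite_S_below)
  have EM: "E x \<in> sets M" for x
    unfolding E_def using sets_F_M[OF t sets.Int[OF B(1) X_eq_F[OF t order_refl]]] .
  have ind: "indicator B \<omega> = (\<Sum>x\<in>Q. indicator (E x) \<omega> :: real)" if "\<omega> \<in> space M" for \<omega>
  proof (cases "\<omega> \<in> B")
    case True
    then have "X t \<omega> \<in> Q" using B(2) X_in_S[OF t that] by (auto simp: Q_def)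
    then have "(\<Sum>x\<in>Q. indicator (E x) \<omega> :: real) = (\<Sum>x\<in>Q. if x = X t \<omega> then 1 else 0)"
      using True that by (intro sum.cong) (auto simp: E_def indicator_def)
    then show ?thesis using True \<open>X t \<omega> \<in> Q\<close> fQ by simp
  next
    case False
    then show ?thesis by (auto simp: E_def intro!: sum.neutral[symmetric])
  qed
  have e1: "indicator B \<omega> * g \<omega> = (\<Sum>x\<in>Q. indicator (E x) \<omega> * g \<omega>)" if "\<omega> \<in> space M" for \<omega>
    unfolding ind[OF that] by (simp add: sum_distrib_right)
  have e2: "indicator B \<omega> * h (X t \<omega>) = (\<Sum>x\<in>Q. indicator (E x) \<omega> * h x)" if "\<omega> \<in> space M" for \<omega>
    unfolding ind[OF that] sum_distrib_right by (intro sum.cong) (auto simp: E_def indicator_def)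
  have i1: "integrable M (\<lambda>\<omega>. indicator (E x) \<omega> * g \<omega>)" if "x \<in> Q" for x
    using li that by (auto simp: E_def Q_def)
  have i2: "integrable M (\<lambda>\<omega>. indicator (E x) \<omega> * h x)" for x
    using EM by (intro integrable_mult_left integrable_real_indicator) (auto simp: emeasure_eq_measure)
  show ?i1 using i1 by (subst Bochner_Integration.integrable_cong[OF refl e1]) auto
  show ?i2 using i2 by (subst Bochner_Integration.integrable_cong[OF refl e2]) auto
  have "(\<integral>\<omega>. indicator B \<omega> * g \<omega> \<partial>M) = (\<Sum>x\<in>Q. \<integral>\<omega>. indicator (E x) \<omega> * g \<omega> \<partial>M)"
    using i1 by (subst Bochner_Integration.integral_cong[OF refl e1]) (auto intro!: Bochner_Integration.integral_sum)
  also have "\<dots> \<le> (\<Sum>x\<in>Q. h x * prob (E x))"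
    using ll by (intro sum_mono) (auto simp: Q_def E_def)
  also have "\<dots> = (\<Sum>x\<in>Q. \<integral>\<omega>. indicator (E x) \<omega> * h x \<partial>M)"
    using EM by (intro sum.cong) (auto simp: mult.commute)
  also have "\<dots> = (\<integral>\<omega>. indicator B \<omega> * h (X t \<omega>) \<partial>M)"
    using i2 by (subst Bochner_Integration.integral_cong[OF refl e2]) (auto intro!: Bochner_Integration.integral_sum[symmetric])
  finally show ?le .
qed

lemma A1_local:
  assumes x: "x \<in> S" and y: "y \<in> S" and t: "1 \<le> t" and B: "B \<in> sets (F t)" "B \<subseteq> {\<omega> \<in> space M. X t \<omega> = x}"
  shows "\<phi> x y * prob B \<le> prob (B \<inter> {\<omega> \<in> space M. X (t + m x y) \<omega> = y})"
proof -
  interpret sf: sigma_finite_subalgebra M "F t" by (rule sigma_finite_F[OF t])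
  define G where "G = {\<omega> \<in> space M. X (t + m (X t \<omega>) y) \<omega> = y}"
  have BM: "B \<in> sets M" using sets_F_M[OF t B(1)] .
  have XM: "{\<omega> \<in> space M. X s \<omega> = z} \<in> sets M" if "1 \<le> s" for s z
    using sets_F_M[OF that X_eq_F[OF that order_refl]] .
  have "G = (\<Union>z\<in>S. {\<omega> \<in> space M. X t \<omega> = z} \<inter> {\<omega> \<in> space M. X (t + m z y) \<omega> = y})"
    unfolding G_def using X_in_S[OF t] by auto
  then have GM: "G \<in> sets M" using t by (auto intro!: sets.countable_UN' countable_S sets.Int XM)
  have int: "integrable M (\<lambda>\<omega>. indicator B \<omega> * (indicator G \<omega> :: real))"
    using BM GM by (intro integrable_real_mult_indicator integrable_real_indicator) (auto simp: emeasure_eq_measure)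
  note I = sf.real_cond_exp_intg[OF int _ borel_measurable_indicator[OF GM]]
  have indF: "(indicator B :: 'a \<Rightarrow> real) \<in> borel_measurable (F t)" using B by simp
  have "\<phi> x y * prob B = (\<integral>\<omega>. indicator B \<omega> * \<phi> x y \<partial>M)" using BM by (simp add: mult.commute)
  also have "\<dots> \<le> (\<integral>\<omega>. indicator B \<omega> * real_cond_exp M (F t) (indicator G) \<omega> \<partial>M)"
  proof (rule integral_mono_AE)
    show "integrable M (\<lambda>\<omega>. indicator B \<omega> * \<phi> x y)"
      using BM by (intro integrable_mult_left integrable_real_indicator) (auto simp: emeasure_eq_measure)
    show "integrable M (\<lambda>\<omega>. indicator B \<omega> * real_cond_exp M (F t) (indicator G) \<omega>)" by (rule I(1)[OF indF])
    show "AE \<omega> in M. indicator B \<omega> * \<phi> x y \<le> indicator B \<omega> * real_cond_exp M (F t) (indicator G) \<omega>"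
      using A1[OF y t] by eventually_elim (use B(2) in \<open>auto simp: indicator_def G_def\<close>)
  qed
  also have "\<dots> = (\<integral>\<omega>. indicator B \<omega> * indicator G \<omega> \<partial>M)" by (rule I(2)[OF indF])
  also have "\<dots> = (\<integral>\<omega>. indicator (B \<inter> G) \<omega> \<partial>M)" by (simp add: indicator_inter_arith)
  also have "\<dots> = prob (B \<inter> G)" using BM GM sets.sets_into_space[OF BM] by (simp add: Int_absorb2 le_infI1)
  also have "B \<inter> G = B \<inter> {\<omega> \<in> space M. X (t + m x y) \<omega> = y}" using B(2) by (auto simp: G_def)
  finally show ?thesis .
qed

text \<open>A visit to \<open>x\<close> at time \<open>t\<close> leads to the event \<open>t < \<tau>\<^sub>1 \<le> t + m x 0\<close> with conditional probability at least
  \<open>\<phi> x 0\<close>, and for given \<open>\<tau>\<^sub>1\<close> there are only \<open>m x 0\<close> such times \<open>t\<close>.\<close>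

lemma visits_bound_point:
  assumes x: "x \<in> S"
  shows "(\<Sum>t=1..T. prob (alive t \<inter> {\<omega> \<in> space M. X t \<omega> = x})) \<le> real (m x 0) / \<phi> x 0"
proof -
  define k where "k = m x 0"
  have k: "1 \<le> k" using m_pos[OF x S_zero] by (simp add: k_def)
  have ph: "0 < \<phi> x 0" using \<phi>_pos[OF x S_zero] .
  have "\<phi> x 0 * prob (alive t \<inter> {\<omega> \<in> space M. X t \<omega> = x}) \<le> prob (alive t) - prob (alive (t + k))" if t: "1 \<le> t" for t
  proof -
    let ?B = "alive t \<inter> {\<omega> \<in> space M. X t \<omega> = x}"
    have "\<phi> x 0 * prob ?B \<le> prob (?B \<inter> {\<omega> \<in> space M. X (t + k) \<omega> = 0})"
      unfolding k_def by (rule A1_local[OF x S_zero t]) (auto intro!: sets.Int alive_F X_eq_F t)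
    also have "\<dots> \<le> prob (alive t - alive (t + k))"
    proof (rule finite_measure_mono)
      show "?B \<inter> {\<omega> \<in> space M. X (t + k) \<omega> = 0} \<subseteq> alive t - alive (t + k)"
        using t k by (auto simp: alive_def)
    qed (use alive_M in auto)
    also have "\<dots> = prob (alive t) - prob (alive (t + k))"
      using alive_antimono[of t "t + k"] alive_M by (intro finite_measure_Diff) auto
    finally show ?thesis .
  qed
  then have "\<phi> x 0 * (\<Sum>t=1..T. prob (alive t \<inter> {\<omega> \<in> space M. X t \<omega> = x})) \<le> (\<Sum>t=1..T. prob (alive t) - prob (alive (t + k)))"
    unfolding sum_distrib_left by (intro sum_mono) auto
  also have "\<dots> \<le> real k"
  proof -
    have "(\<Sum>t=1..T. a t - a (t + k)) \<le> (\<Sum>j<k. 1)" if a: "\<And>t. 0 \<le> a t" "\<And>t. a t \<le> 1" for a :: "nat \<Rightarrow> real"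
    proof -
      have "(\<Sum>t=1..T. a t - a (t + k)) = (\<Sum>j<k. a (1 + j) - a (T + 1 + j))"
      proof (induction k)
        case (Suc k)
        have "(\<Sum>t=1..T. a t - a (t + Suc k)) = (\<Sum>t=1..T. a t - a (t + k)) + (\<Sum>t=1..T. a (t + k) - a (t + Suc k))"
          by (simp flip: sum.distrib)
        also have "(\<Sum>t=1..T. a (t + k) - a (t + Suc k)) = a (1 + k) - a (T + 1 + k)"
          by (induction T) auto
        finally show ?case using Suc by simp
      qed simp
      also have "\<dots> \<le> (\<Sum>j<k. 1)"
      proof (rule sum_mono)
        fix j show "a (1 + j) - a (T + 1 + j) \<le> 1" using a(1)[of "T + 1 + j"] a(2)[of "1 + j"] by linarith
      qed
      finally show ?thesis .
    qed
    from this[of "\<lambda>t. prob (alive t)"] show ?thesis by simp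
  qed
  finally show ?thesis using ph unfolding k_def by (simp add: field_simps)
qed

lemma visits_bound:
  obtains V where "0 \<le> V" "\<And>T. (\<Sum>t=1..T. prob (alive t \<inter> {\<omega> \<in> space M. X t \<omega> < a})) \<le> V"
proof -
  define Q where "Q = {x \<in> S. x < a}"
  have fQ: "finite Q" unfolding Q_def by (rule finite_S_below)
  have le: "prob (alive t \<inter> {\<omega> \<in> space M. X t \<omega> < a}) \<le> (\<Sum>x\<in>Q. prob (alive t \<inter> {\<omega> \<in> space M. X t \<omega> = x}))"
    if t: "1 \<le> t" for t
  proof -
    have eq: "alive t \<inter> {\<omega> \<in> space M. X t \<omega> < a} = (\<Union>x\<in>Q. alive t \<inter> {\<omega> \<in> space M. X t \<omega> = x})"
      using X_in_S[OF t] by (auto simp: Q_def)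
    show ?thesis unfolding eq
      by (rule measure_UNION_le[OF fQ], rule sets_F_M[OF t], intro sets.Int alive_F X_eq_F t order_refl)
  qed
  have "(\<Sum>t=1..T. prob (alive t \<inter> {\<omega> \<in> space M. X t \<omega> < a})) \<le> (\<Sum>x\<in>Q. real (m x 0) / \<phi> x 0)" for T
  proof -
    have "(\<Sum>t=1..T. prob (alive t \<inter> {\<omega> \<in> space M. X t \<omega> < a})) \<le> (\<Sum>t=1..T. \<Sum>x\<in>Q. prob (alive t \<inter> {\<omega> \<in> space M. X t \<omega> = x}))"
      by (rule sum_mono) (rule le, simp)
    also have "\<dots> = (\<Sum>x\<in>Q. \<Sum>t=1..T. prob (alive t \<inter> {\<omega> \<in> space M. X t \<omega> = x}))" by (rule sum.swap)
    also have "\<dots> \<le> (\<Sum>x\<in>Q. real (m x 0) / \<phi> x 0)" by (rule sum_mono) (rule visits_bound_point, simp add: Q_def)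
    finally show ?thesis .
  qed
  moreover from this[of 0] have "0 \<le> (\<Sum>x\<in>Q. real (m x 0) / \<phi> x 0)" by simp
  ultimately show thesis using that by blast
qed

lemma lyap_upper_local:
  obtains H where "0 \<le> H" "\<And>t B. 1 \<le> t \<Longrightarrow> B \<in> sets (F t) \<Longrightarrow> B \<subseteq> {\<omega> \<in> space M. X t \<omega> = x} \<Longrightarrow>
      (\<integral>\<omega>. indicator B \<omega> * lyap b (X (t + 1) \<omega>) \<partial>M) \<le> H * prob B"
proof -
  obtain A K where AK: "0 < A" "0 < K" "\<And>y. 0 \<le> y \<Longrightarrow> \<bar>lyap b y\<bar> \<le> A + K * \<bar>y - x\<bar> powr p"
    by (rule lyap_local_bound[of b x]) auto
  define H where "H = A + K * (C * (1 + x) powr (p - 2 - \<delta>))"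
  show thesis
  proof (rule that[of H])
    show "0 \<le> H" using AK C_pos by (simp add: H_def)
    fix t B assume t: "1 \<le> t" and B: "B \<in> sets (F t)" "B \<subseteq> {\<omega> \<in> space M. X t \<omega> = x}"
    have BM: "B \<in> sets M" using sets_F_M[OF t B(1)] .
    have iA: "integrable M (\<lambda>\<omega>. A * indicator B \<omega>)"
      using BM by (intro integrable_mult_right integrable_real_indicator) (auto simp: emeasure_eq_measure)
    note ip = jump_moment(1)[OF t B]
    have "(\<integral>\<omega>. indicator B \<omega> * lyap b (X (t + 1) \<omega>) \<partial>M) \<le> (\<integral>\<omega>. A * indicator B \<omega> + K * (indicator B \<omega> * \<bar>X (t + 1) \<omega> - X t \<omega>\<bar> powr p) \<partial>M)"
    proof (rule integral_mono)
      show "integrable M (\<lambda>\<omega>. indicator B \<omega> * lyap b (X (t + 1) \<omega>))" by (rule lyap_local_integrable[OF t B])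
      show "integrable M (\<lambda>\<omega>. A * indicator B \<omega> + K * (indicator B \<omega> * \<bar>X (t + 1) \<omega> - X t \<omega>\<bar> powr p))"
        by (intro Bochner_Integration.integrable_add iA integrable_mult_right ip)
      fix \<omega> assume \<omega>: "\<omega> \<in> space M"
      show "indicator B \<omega> * lyap b (X (t + 1) \<omega>) \<le> A * indicator B \<omega> + K * (indicator B \<omega> * \<bar>X (t + 1) \<omega> - X t \<omega>\<bar> powr p)"
      proof (cases "\<omega> \<in> B")
        case True
        then have "X t \<omega> = x" using B(2) by auto
        then show ?thesis using True AK(3)[of "X (t + 1) \<omega>"] X_nonneg[of "t + 1" \<omega>] \<omega> by simp
      qed simp
    qed
    also have "\<dots> = A * prob B + K * (\<integral>\<omega>. indicator B \<omega> * \<bar>X (t + 1) \<omega> - X t \<omega>\<bar> powr p \<partial>M)"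
      using BM by (subst Bochner_Integration.integral_add[OF iA integrable_mult_right[OF ip]]) auto
    also have "\<dots> \<le> A * prob B + K * (C * (1 + x) powr (p - 2 - \<delta>) * prob B)"
      using AK jump_moment(2)[OF t B] by (intro add_left_mono mult_left_mono) auto
    also have "\<dots> = H * prob B" by (simp add: H_def algebra_simps)
    finally show "(\<integral>\<omega>. indicator B \<omega> * lyap b (X (t + 1) \<omega>) \<partial>M) \<le> H * prob B" .
  qed
qed

lemma lyap_supermartingale:
  assumes a: "0 < a"
  shows "\<exists>\<kappa>>0. \<exists>H\<ge>0. \<exists>x0. \<forall>t x B. x \<in> S \<longrightarrow> 1 \<le> t \<longrightarrow> B \<in> sets (F t) \<longrightarrow> B \<subseteq> {\<omega> \<in> space M. X t \<omega> = x} \<longrightarrow>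
      (\<integral>\<omega>. indicator B \<omega> * lyap (- a) (X (t + 1) \<omega>) \<partial>M)
        \<le> (lyap (- a) x - \<kappa> * lyap_rate (- a) x + H * indicator {..<x0} x) * prob B"
proof -
  define \<kappa> where "\<kappa> = s2 / 4 * (1 + r) * a"
  have \<kappa>: "0 < \<kappa>" using s2_pos r_gt a by (simp add: \<kappa>_def)
  obtain x0 where "exp 1 \<le> x0" and x0': "\<forall>t x B. x0 \<le> x \<longrightarrow> 1 \<le> t \<longrightarrow> B \<in> sets (F t) \<longrightarrow> B \<subseteq> {\<omega> \<in> space M. X t \<omega> = x} \<longrightarrow>
      \<bar>(\<integral>\<omega>. indicator B \<omega> * lyap (- a) (X (t + 1) \<omega>) \<partial>M) - lyap (- a) x * prob B - s2 / 2 * (1 + r) * (- a) * lyap_rate (- a) x * prob B\<bar>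
        \<le> \<kappa> * lyap_rate (- a) x * prob B"
    using lyap_drift[OF \<kappa>, of "- a"] by (elim exE conjE)
  note x0 = x0'[rule_format]
  define Q where "Q = {x \<in> S. x < x0}"
  have fQ: "finite Q" unfolding Q_def by (rule finite_S_below)
  define P where "P = (\<lambda>x H. 0 \<le> H \<and> (\<forall>t B. 1 \<le> t \<longrightarrow> B \<in> sets (F t) \<longrightarrow> B \<subseteq> {\<omega> \<in> space M. X t \<omega> = x} \<longrightarrow>
      (\<integral>\<omega>. indicator B \<omega> * lyap (- a) (X (t + 1) \<omega>) \<partial>M) \<le> H * prob B))"
  have "\<exists>H. P x H" for x
    unfolding P_def by (rule lyap_upper_local[of x "- a"]) blast
  then obtain H where "\<And>x. P x (H x)" by metis
  then have H: "\<And>x. 0 \<le> H x" "\<And>x t B. 1 \<le> t \<Longrightarrow> B \<in> sets (F t) \<Longrightarrow> B \<subseteq> {\<omega> \<in> space M. X t \<omega> = x} \<Longrightarrow>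
      (\<integral>\<omega>. indicator B \<omega> * lyap (- a) (X (t + 1) \<omega>) \<partial>M) \<le> H x * prob B"
    unfolding P_def by simp_all
  define H' where "H' = (\<Sum>x\<in>Q. H x + \<kappa> * lyap_rate (- a) x)"
  have H'0: "0 \<le> H'" unfolding H'_def using H(1) \<kappa> lyap_rate_pos[of "- a"] by (intro sum_nonneg add_nonneg_nonneg) (auto simp: less_imp_le)
  show ?thesis
  proof (rule exI[of _ \<kappa>], rule conjI[OF \<kappa>], rule exI[of _ H'], rule conjI[OF H'0], rule exI[of _ x0], intro allI impI)
    fix t x B assume x: "x \<in> S" and t: "1 \<le> t" and B: "B \<in> sets (F t)" "B \<subseteq> {\<omega> \<in> space M. X t \<omega> = x}"
    show "(\<integral>\<omega>. indicator B \<omega> * lyap (- a) (X (t + 1) \<omega>) \<partial>M)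
        \<le> (lyap (- a) x - \<kappa> * lyap_rate (- a) x + H' * indicator {..<x0} x) * prob B"
    proof (cases "x < x0")
      case True
      have "H x + \<kappa> * lyap_rate (- a) x \<le> H'"
        unfolding H'_def using fQ True x H(1) \<kappa> lyap_rate_pos[of "- a"]
        by (intro member_le_sum) (auto simp: Q_def less_imp_le intro!: add_nonneg_nonneg)
      then have "H x \<le> lyap (- a) x - \<kappa> * lyap_rate (- a) x + H'" using lyap_pos[of "- a" x] by linarith
      then have "H x * prob B \<le> (lyap (- a) x - \<kappa> * lyap_rate (- a) x + H') * prob B" by (intro mult_right_mono) auto
      then show ?thesis using H(2)[OF t B] True by simp
    next
      case False
      have "(\<integral>\<omega>. indicator B \<omega> * lyap (- a) (X (t + 1) \<omega>) \<partial>M) \<le> lyap (- a) x * prob B + s2 / 2 * (1 + r) * (- a) * lyap_rate (- a) x * prob B + \<kappa> * lyap_rate (- a) x * prob B"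
      proof -
        have "x0 \<le> x" using False by simp
        from x0[OF this t B] show ?thesis by linarith
      qed
      also have "\<dots> = (lyap (- a) x - \<kappa> * lyap_rate (- a) x) * prob B"
      proof -
        have "s2 / 2 * (1 + r) * (- a) = - 2 * \<kappa>" by (simp add: \<kappa>_def)
        then show ?thesis by (simp only:) (simp add: algebra_simps)
      qed
      finally show ?thesis using False by simp
    qed
  qed
qed

end

lemma powln_ge_powr:
  assumes "0 < nu"
  obtains K where "0 < K" "\<And>u. exp 1 \<le> u \<Longrightarrow> K * u powr (g - nu) \<le> powln g b u"
proof -
  obtain K where K: "0 < K" "\<And>u. exp 1 \<le> u \<Longrightarrow> powln (- g) (- b) u \<le> K * u powr (- g + nu)"
    using powln_le_powr[OF assms, of "- g" "- b"] by auto
  have "1 / K * u powr (g - nu) \<le> powln g b u" if u: "exp 1 \<le> u" for u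
  proof -
    have u1: "1 < u" using u exp_gt_one[of "1::real"] by linarith
    have inv: "powln (- g) (- b) u * powln g b u = 1"
      using u1 unfolding powln_def by (simp add: powr_minus field_simps)
    have "u powr (g - nu) = u powr (g - nu) * (powln (- g) (- b) u * powln g b u)" by (simp add: inv)
    also have "\<dots> \<le> u powr (g - nu) * (K * u powr (- g + nu) * powln g b u)"
      using K(2)[OF u] powln_pos[OF u1, of g b] by (intro mult_left_mono mult_right_mono) auto
    also have "\<dots> = K * powln g b u * (u powr (g - nu) * u powr (- g + nu))" by (simp add: mult_ac)
    also have "\<dots> = K * powln g b u" using u1 by (simp flip: powr_add)
    finally show ?thesis using K(1) by (simp add: field_simps)
  qed
  then show thesis using K(1) that[of "1 / K"] by simp
qed

lemma powr_filterlim_at_top: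
  assumes "0 < e" shows "filterlim (\<lambda>u::real. u powr e) at_top at_top"
proof -
  have "filterlim (\<lambda>u::real. exp (e * ln u)) at_top at_top"
    by (intro filterlim_compose[OF exp_at_top] filterlim_tendsto_pos_mult_at_top[OF tendsto_const assms] ln_at_top)
  moreover have "eventually (\<lambda>u::real. exp (e * ln u) \<le> u powr e) at_top"
    using eventually_gt_at_top[of 0] by eventually_elim (simp add: powr_def)
  ultimately show ?thesis by (rule filterlim_at_top_mono)
qed

context lamperti begin

lemma lyap_at_top: "filterlim (lyap b) at_top at_top"
proof -
  obtain K where K: "0 < K" "\<And>u. exp 1 \<le> u \<Longrightarrow> K * u powr (1 + r - (1 + r) / 2) \<le> powln (1 + r) b u"
    using powln_ge_powr[of "(1 + r) / 2" "1 + r" b] r_gt by auto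
  have "filterlim (\<lambda>u. K * u powr (1 + r - (1 + r) / 2)) at_top at_top"
    using K(1) r_gt by (intro filterlim_tendsto_pos_mult_at_top[OF tendsto_const] powr_filterlim_at_top) auto
  moreover have "eventually (\<lambda>u. K * u powr (1 + r - (1 + r) / 2) \<le> lyap b u) at_top"
    using eventually_ge_at_top[of "exp 1"] by eventually_elim (use K(2) in \<open>simp add: lyap_def max_def\<close>)
  ultimately show ?thesis by (rule filterlim_at_top_mono)
qed

lemma local_fun_integrable:
  assumes t: "1 \<le> t" and B: "B \<in> sets (F t)" "B \<subseteq> {\<omega> \<in> space M. X t \<omega> < n}"
  shows "integrable M (\<lambda>\<omega>. indicator B \<omega> * (h (X t \<omega>) :: real))"
proof (rule local_to_global_le(2)[OF t B, where g = "\<lambda>\<omega>. h (X t \<omega>)"])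
  fix x
  have BM: "B \<inter> {\<omega> \<in> space M. X t \<omega> = x} \<in> sets M"
    using sets_F_M[OF t sets.Int[OF B(1) X_eq_F[OF t order_refl]]] .
  have eq: "(\<lambda>\<omega>. indicator (B \<inter> {\<omega> \<in> space M. X t \<omega> = x}) \<omega> * h (X t \<omega>))
      = (\<lambda>\<omega>. indicator (B \<inter> {\<omega> \<in> space M. X t \<omega> = x}) \<omega> * h x)"
    by (auto simp: fun_eq_iff indicator_def)
  show "integrable M (\<lambda>\<omega>. indicator (B \<inter> {\<omega> \<in> space M. X t \<omega> = x}) \<omega> * h (X t \<omega>))"
    unfolding eq using BM by (intro integrable_mult_left integrable_real_indicator) (auto simp: emeasure_eq_measure)
  show "(\<integral>\<omega>. indicator (B \<inter> {\<omega> \<in> space M. X t \<omega> = x}) \<omega> * h (X t \<omega>) \<partial>M) \<le> h x * prob (B \<inter> {\<omega> \<in> space M. X t \<omega> = x})"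
    unfolding eq using BM by (simp add: mult.commute)
qed

lemma below_less: "1 \<le> t \<Longrightarrow> below n t \<subseteq> {\<omega> \<in> space M. X t \<omega> < n}"
  unfolding below_def alive_def by auto

lemma below_Suc: "below n (Suc t) \<subseteq> below n t"
  unfolding below_def alive_def by auto

definition up_exit :: "real \<Rightarrow> nat \<Rightarrow> 'a set" where
  "up_exit n t = below n t \<inter> {\<omega> \<in> space M. n \<le> X (t + 1) \<omega>}"

lemma up_exit_F: "1 \<le> t \<Longrightarrow> up_exit n t \<in> sets (F (t + 1))"
  unfolding up_exit_def using below_F[of n t] F_mono[of t "t + 1"] by (intro sets.Int X_ge_F) auto

lemma AE_X1: "AE \<omega> in M. X 1 \<omega> = 0"
  using AE_prob_1[OF X1] by eventually_elim auto

text \<open>Telescoping the expected Lyapunov function up to the first return to 0 or the first exit above \<open>n\<close>: the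
  exits and the accumulated negative drift are paid for by \<open>lyap (- a) 0\<close> and by the drift at the finitely
  many small states, whose expected number of visits is bounded.\<close>

lemma excursion_budget:
  assumes a: "0 < a" "a \<le> 1 + r"
  shows "\<exists>Q>0. \<exists>\<kappa>>0. \<forall>n T. lyap (- a) n * (\<Sum>t=1..T. prob (up_exit n t))
     + \<kappa> * (\<Sum>t=1..T. \<integral>\<omega>. indicator (below n t) \<omega> * lyap_rate (- a) (X t \<omega>) \<partial>M) \<le> Q"
proof -
  obtain \<kappa> H x0 where \<kappa>: "0 < \<kappa>" and H: "0 \<le> H"
    and drift': "\<forall>t x B. x \<in> S \<longrightarrow> 1 \<le> t \<longrightarrow> B \<in> sets (F t) \<longrightarrow> B \<subseteq> {\<omega> \<in> space M. X t \<omega> = x} \<longrightarrow>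
      (\<integral>\<omega>. indicator B \<omega> * lyap (- a) (X (t + 1) \<omega>) \<partial>M)
        \<le> (lyap (- a) x - \<kappa> * lyap_rate (- a) x + H * indicator {..<x0} x) * prob B"
    using lyap_supermartingale[OF a(1)] by (elim exE conjE)
  note drift = drift'[rule_format]
  obtain V where V: "0 \<le> V" "\<And>T. (\<Sum>t=1..T. prob (alive t \<inter> {\<omega> \<in> space M. X t \<omega> < x0})) \<le> V"
    using visits_bound[of x0] by blast
  define Q where "Q = lyap (- a) 0 + H * V"
  have Q: "0 < Q" using lyap_pos[of "- a" 0] H V(1) by (simp add: Q_def add_pos_nonneg)
  have "lyap (- a) n * (\<Sum>t=1..T. prob (up_exit n t))
     + \<kappa> * (\<Sum>t=1..T. \<integral>\<omega>. indicator (below n t) \<omega> * lyap_rate (- a) (X t \<omega>) \<partial>M) \<le> Q" for n T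
  proof -
    define Ph where "Ph = (\<lambda>t. \<integral>\<omega>. indicator (below n t) \<omega> * lyap (- a) (X t \<omega>) \<partial>M)"
    define W where "W = (\<lambda>t. \<integral>\<omega>. indicator (below n t) \<omega> * lyap_rate (- a) (X t \<omega>) \<partial>M)"
    define v where "v = (\<lambda>t. prob (alive t \<inter> {\<omega> \<in> space M. X t \<omega> < x0}))"
    have Ph0: "0 \<le> Ph t" for t
      unfolding Ph_def using lyap_pos[of "- a"] by (intro integral_nonneg_AE AE_I2) (simp add: less_imp_le)
    have step: "Ph (Suc t) + lyap (- a) n * prob (up_exit n t) + \<kappa> * W t \<le> Ph t + H * v t" if t: "1 \<le> t" for t
    proof -
      let ?B = "below n t"
      note BF = below_F[of n t] and Bl = below_less[OF t, of n]
      have Bx: "?B \<inter> {\<omega> \<in> space M. X t \<omega> = x} \<in> sets (F t)" "?B \<inter> {\<omega> \<in> space M. X t \<omega> = x} \<subseteq> {\<omega> \<in> space M. X t \<omega> = x}" for x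
        using BF X_eq_F[OF t order_refl] by auto
      let ?h = "\<lambda>x. lyap (- a) x - \<kappa> * lyap_rate (- a) x + H * indicator {..<x0} x"
      have gl: "integrable M (\<lambda>\<omega>. indicator ?B \<omega> * lyap (- a) (X (t + 1) \<omega>))"
        "(\<integral>\<omega>. indicator ?B \<omega> * lyap (- a) (X (t + 1) \<omega>) \<partial>M) \<le> (\<integral>\<omega>. indicator ?B \<omega> * ?h (X t \<omega>) \<partial>M)"
        by (rule local_to_global_le(1)[OF t BF Bl, where h = ?h] local_to_global_le(3)[OF t BF Bl, where h = ?h];
            (rule lyap_local_integrable[OF t Bx] drift[OF _ t Bx], assumption?))+
      have i1: "integrable M (\<lambda>\<omega>. indicator ?B \<omega> * lyap (- a) (X t \<omega>))" by (rule local_fun_integrable[OF t BF Bl])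
      have i2: "integrable M (\<lambda>\<omega>. indicator ?B \<omega> * lyap_rate (- a) (X t \<omega>))" by (rule local_fun_integrable[OF t BF Bl])
      have i3: "integrable M (\<lambda>\<omega>. indicator ?B \<omega> * (indicator {..<x0} (X t \<omega>) :: real))" by (rule local_fun_integrable[OF t BF Bl])
      have UM: "up_exit n t \<in> sets M" using sets_F_M[OF _ up_exit_F[OF t]] by simp
      have i4: "integrable M (\<lambda>\<omega>. indicator (below n (Suc t)) \<omega> * lyap (- a) (X (Suc t) \<omega>))"
        by (rule local_fun_integrable[OF _ below_F below_less]) auto
      have i5: "integrable M (\<lambda>\<omega>. lyap (- a) n * indicator (up_exit n t) \<omega>)"
        using UM by (intro integrable_mult_right integrable_real_indicator) (auto simp: emeasure_eq_measure)
      have "Ph (Suc t) + lyap (- a) n * prob (up_exit n t)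
          = (\<integral>\<omega>. indicator (below n (Suc t)) \<omega> * lyap (- a) (X (Suc t) \<omega>) + lyap (- a) n * indicator (up_exit n t) \<omega> \<partial>M)"
        unfolding Ph_def Bochner_Integration.integral_add[OF i4 i5] using UM by simp
      also have "\<dots> \<le> (\<integral>\<omega>. indicator ?B \<omega> * lyap (- a) (X (t + 1) \<omega>) \<partial>M)"
      proof (rule integral_mono[OF Bochner_Integration.integrable_add[OF i4 i5] gl(1)])
        fix \<omega> assume "\<omega> \<in> space M"
        have l0: "0 \<le> lyap (- a) (X (Suc t) \<omega>)" using lyap_pos less_imp_le by blast
        show "indicator (below n (Suc t)) \<omega> * lyap (- a) (X (Suc t) \<omega>) + lyap (- a) n * indicator (up_exit n t) \<omega>
           \<le> indicator ?B \<omega> * lyap (- a) (X (t + 1) \<omega>)"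
        proof (cases "\<omega> \<in> up_exit n t")
          case True
          then have "\<omega> \<in> ?B" and nX: "n \<le> X (Suc t) \<omega>" by (auto simp: up_exit_def)
          have "\<omega> \<notin> below n (Suc t)" using below_less[of "Suc t" n] nX by auto
          moreover have "lyap (- a) n \<le> lyap (- a) (X (Suc t) \<omega>)" using a nX by (intro lyap_mono) auto
          ultimately show ?thesis using True \<open>\<omega> \<in> ?B\<close> by simp
        next
          case False
          show ?thesis
          proof (cases "\<omega> \<in> below n (Suc t)")
            case True
            then have "\<omega> \<in> ?B" using below_Suc by blast
            then show ?thesis using True False by simp
          next
            case F2: False
            then show ?thesis using False l0 by (simp add: indicator_def)
          qed
        qed
      qed
      also have "\<dots> \<le> (\<integral>\<omega>. indicator ?B \<omega> * ?h (X t \<omega>) \<partial>M)" by (rule gl(2))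
      also have "\<dots> = (\<integral>\<omega>. indicator ?B \<omega> * lyap (- a) (X t \<omega>) - \<kappa> * (indicator ?B \<omega> * lyap_rate (- a) (X t \<omega>))
            + H * (indicator ?B \<omega> * indicator {..<x0} (X t \<omega>)) \<partial>M)"
        by (rule Bochner_Integration.integral_cong) (auto simp: algebra_simps)
      also have "\<dots> = Ph t - \<kappa> * W t + H * (\<integral>\<omega>. indicator ?B \<omega> * indicator {..<x0} (X t \<omega>) \<partial>M)"
        unfolding Ph_def W_def using i1 i2 i3 by simp
      also have "\<dots> \<le> Ph t - \<kappa> * W t + H * v t"
      proof -
        have AM: "alive t \<inter> {\<omega> \<in> space M. X t \<omega> < x0} \<in> sets M"
          using sets_F_M[OF t sets.Int[OF alive_F[OF order_refl] X_less_F[OF t order_refl]]] .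
        have "(\<integral>\<omega>. indicator ?B \<omega> * (indicator {..<x0} (X t \<omega>) :: real) \<partial>M) \<le> (\<integral>\<omega>. (indicator (alive t \<inter> {\<omega> \<in> space M. X t \<omega> < x0}) \<omega> :: real) \<partial>M)"
          using AM by (intro integral_mono i3 integrable_real_indicator)
            (auto simp: emeasure_eq_measure indicator_def below_def)
        also have "\<dots> = v t" using AM sets.sets_into_space[OF AM] unfolding v_def by (simp add: Int_absorb2)
        finally show ?thesis using H by (intro add_left_mono mult_left_mono) auto
      qed
      finally show ?thesis by simp
    qed
    have "Ph (Suc T) + lyap (- a) n * (\<Sum>t=1..T. prob (up_exit n t)) + \<kappa> * (\<Sum>t=1..T. W t) \<le> Ph 1 + H * (\<Sum>t=1..T. v t)"
    proof (induction T)
      case (Suc T)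
      from step[of "Suc T"] Suc show ?case by (simp add: algebra_simps)
    qed simp
    also have "\<dots> \<le> lyap (- a) 0 + H * V"
    proof (intro add_mono mult_left_mono)
      have "Ph 1 \<le> (\<integral>\<omega>. lyap (- a) 0 \<partial>M)" unfolding Ph_def
      proof (rule integral_mono_AE)
        show "integrable M (\<lambda>\<omega>. indicator (below n 1) \<omega> * lyap (- a) (X 1 \<omega>))"
          by (rule local_fun_integrable[OF _ below_F below_less]) auto
        show "AE \<omega> in M. indicator (below n 1) \<omega> * lyap (- a) (X 1 \<omega>) \<le> lyap (- a) 0"
          using AE_X1 by eventually_elim (use lyap_pos[of "- a" 0] in \<open>simp add: indicator_def less_imp_le\<close>)
      qed simp
      then show "Ph 1 \<le> lyap (- a) 0" by (simp add: prob_space)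
      show "(\<Sum>t=1..T. v t) \<le> V" unfolding v_def by (rule V(2))
    qed (rule H)
    finally show ?thesis using Ph0[of "Suc T"] unfolding Q_def W_def by linarith
  qed
  then show ?thesis using Q \<kappa> by blast
qed

lemma excursion_weight_finite:
  assumes a: "0 < a" "a \<le> 1 + r"
  shows "\<exists>K>0. (\<integral>\<^sup>+\<omega>. (\<Sum>t. ennreal (indicator (alive (Suc t)) \<omega> * lyap_rate (- a) (X (Suc t) \<omega>))) \<partial>M) \<le> ennreal K"
proof -
  obtain Q \<kappa> where Q: "0 < Q" "0 < \<kappa>" and bud: "\<forall>n T. lyap (- a) n * (\<Sum>t=1..T. prob (up_exit n t))
     + \<kappa> * (\<Sum>t=1..T. \<integral>\<omega>. indicator (below n t) \<omega> * lyap_rate (- a) (X t \<omega>) \<partial>M) \<le> Q"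
    using excursion_budget[OF a] by (elim exE conjE)
  define K where "K = Q / \<kappa>"
  have K: "0 < K" using Q by (simp add: K_def)
  have le: "(\<Sum>t=1..T. \<integral>\<omega>. indicator (below n t) \<omega> * lyap_rate (- a) (X t \<omega>) \<partial>M) \<le> K" for n T
  proof -
    have "0 \<le> lyap (- a) n * (\<Sum>t=1..T. prob (up_exit n t))"
      using lyap_pos[of "- a" n] by (intro mult_nonneg_nonneg sum_nonneg) auto
    then have "\<kappa> * (\<Sum>t=1..T. \<integral>\<omega>. indicator (below n t) \<omega> * lyap_rate (- a) (X t \<omega>) \<partial>M) \<le> Q" using bud[rule_format, of n T] by linarith
    then show ?thesis using Q by (simp add: K_def field_simps)
  qed
  define g where "g = (\<lambda>t \<omega>. ennreal (indicator (alive (Suc t)) \<omega> * lyap_rate (- a) (X (Suc t) \<omega>)))"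
  define gn where "gn = (\<lambda>(n::nat) t \<omega>. ennreal (indicator (below (real n) (Suc t)) \<omega> * lyap_rate (- a) (X (Suc t) \<omega>)))"
  have belM [measurable]: "below n t \<in> sets M" for n t
    using below_F[of n t] F_mono[of t "Suc t"] sets_F_M[of "Suc t"] by auto
  have [measurable]: "alive t \<in> sets M" for t by (rule alive_M)
  have gM [measurable]: "g t \<in> borel_measurable M" for t
    unfolding g_def by measurable
  have gnM [measurable]: "gn n t \<in> borel_measurable M" for n t
    unfolding gn_def by measurable
  have partial: "(\<Sum>t<T. \<integral>\<^sup>+\<omega>. g t \<omega> \<partial>M) \<le> ennreal K" for T
  proof -
    have lim: "(\<lambda>n. \<integral>\<^sup>+\<omega>. (\<Sum>t<T. gn n t \<omega>) \<partial>M) \<longlonglongrightarrow> (\<integral>\<^sup>+\<omega>. (\<Sum>t<T. g t \<omega>) \<partial>M)"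
    proof (rule nn_integral_LIMSEQ)
      show "incseq (\<lambda>n \<omega>. \<Sum>t<T. gn n t \<omega>)"
        unfolding incseq_def le_fun_def gn_def below_def
        using lyap_rate_pos[of "- a"] by (intro allI impI sum_mono ennreal_leI mult_right_mono) (auto simp: indicator_def less_imp_le)
      fix \<omega>
      obtain n0 :: nat where n0: "(\<Sum>s\<in>{1..Suc T}. \<bar>X s \<omega>\<bar>) < real n0" using reals_Archimedean2 by blast
      have "gn n t \<omega> = g t \<omega>" if "n0 \<le> n" "t < T" for n t
      proof -
        have "X s \<omega> < real n" if s: "s \<in> {1..Suc t}" for s
        proof -
          have "X s \<omega> \<le> \<bar>X s \<omega>\<bar>" by simp
          also have "\<dots> \<le> (\<Sum>s\<in>{1..Suc T}. \<bar>X s \<omega>\<bar>)" using s \<open>t < T\<close> by (intro member_le_sum) auto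
          finally show ?thesis using n0 \<open>n0 \<le> n\<close> by linarith
        qed
        then have "\<omega> \<in> below (real n) (Suc t) \<longleftrightarrow> \<omega> \<in> alive (Suc t)" unfolding below_def by simp
        then show ?thesis unfolding gn_def g_def by (simp add: indicator_def)
      qed
      then have "eventually (\<lambda>n. (\<Sum>t<T. gn n t \<omega>) = (\<Sum>t<T. g t \<omega>)) sequentially"
        by (intro eventually_sequentiallyI[of n0] sum.cong) auto
      then show "(\<lambda>n. \<Sum>t<T. gn n t \<omega>) \<longlonglongrightarrow> (\<Sum>t<T. g t \<omega>)" by (rule tendsto_eventually)
    qed measurable
    have bd: "(\<integral>\<^sup>+\<omega>. (\<Sum>t<T. gn n t \<omega>) \<partial>M) \<le> ennreal K" for n
    proof -
      have "(\<integral>\<^sup>+\<omega>. (\<Sum>t<T. gn n t \<omega>) \<partial>M) = (\<Sum>t<T. \<integral>\<^sup>+\<omega>. gn n t \<omega> \<partial>M)" by (rule nn_integral_sum) measurable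
      also have "\<dots> = (\<Sum>t<T. ennreal (\<integral>\<omega>. indicator (below (real n) (Suc t)) \<omega> * lyap_rate (- a) (X (Suc t) \<omega>) \<partial>M))"
        unfolding gn_def using lyap_rate_pos[of "- a"]
        by (intro sum.cong refl nn_integral_eq_integral local_fun_integrable[OF _ below_F below_less]) (auto simp: less_imp_le)
      also have "\<dots> = ennreal (\<Sum>t<T. \<integral>\<omega>. indicator (below (real n) (Suc t)) \<omega> * lyap_rate (- a) (X (Suc t) \<omega>) \<partial>M)"
        using lyap_rate_pos[of "- a"] by (intro sum_ennreal integral_nonneg_AE AE_I2) (simp add: less_imp_le)
      also have "(\<Sum>t<T. \<integral>\<omega>. indicator (below (real n) (Suc t)) \<omega> * lyap_rate (- a) (X (Suc t) \<omega>) \<partial>M)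
          = (\<Sum>t=1..T. \<integral>\<omega>. indicator (below (real n) t) \<omega> * lyap_rate (- a) (X t \<omega>) \<partial>M)"
        by (rule sum.reindex_bij_witness[of _ "\<lambda>t. t - 1" Suc]) auto
      also have "ennreal \<dots> \<le> ennreal K" using le by (rule ennreal_leI)
      finally show ?thesis .
    qed
    have "(\<integral>\<^sup>+\<omega>. (\<Sum>t<T. g t \<omega>) \<partial>M) \<le> ennreal K" by (rule LIMSEQ_le_const2[OF lim]) (use bd in auto)
    moreover have "(\<integral>\<^sup>+\<omega>. (\<Sum>t<T. g t \<omega>) \<partial>M) = (\<Sum>t<T. \<integral>\<^sup>+\<omega>. g t \<omega> \<partial>M)" by (rule nn_integral_sum) measurable
    ultimately show ?thesis by simp
  qed
  have "(\<integral>\<^sup>+\<omega>. (\<Sum>t. g t \<omega>) \<partial>M) = (\<Sum>t. \<integral>\<^sup>+\<omega>. g t \<omega> \<partial>M)" by (rule nn_integral_suminf) measurable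
  also have "\<dots> \<le> ennreal K" unfolding suminf_eq_SUP by (rule SUP_least) (rule partial)
  finally show ?thesis using K unfolding g_def by blast
qed

lemma excursion_max_tail:
  assumes a: "0 < a" "a \<le> 1 + r"
  shows "\<exists>Q>0. \<forall>n>0. prob {\<omega> \<in> space M. \<exists>t\<ge>1. \<omega> \<in> alive t \<and> n \<le> X t \<omega>} \<le> Q / lyap (- a) n"
proof -
  obtain Q \<kappa> where Q: "0 < Q" "0 < \<kappa>" and bud: "\<forall>n T. lyap (- a) n * (\<Sum>t=1..T. prob (up_exit n t))
     + \<kappa> * (\<Sum>t=1..T. \<integral>\<omega>. indicator (below n t) \<omega> * lyap_rate (- a) (X t \<omega>) \<partial>M) \<le> Q"
    using excursion_budget[OF a] by (elim exE conjE)
  have "prob {\<omega> \<in> space M. \<exists>t\<ge>1. \<omega> \<in> alive t \<and> n \<le> X t \<omega>} \<le> Q / lyap (- a) n" if n: "0 < n" for n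
  proof -
    have UM: "up_exit n (Suc t) \<in> sets M" for t using sets_F_M[OF _ up_exit_F[of "Suc t"]] by simp
    have le: "(\<Sum>t<T. prob (up_exit n (Suc t))) \<le> Q / lyap (- a) n" for T
    proof -
      have "0 \<le> \<kappa> * (\<Sum>t=1..T. \<integral>\<omega>. indicator (below n t) \<omega> * lyap_rate (- a) (X t \<omega>) \<partial>M)"
        using lyap_rate_pos[of "- a"] Q by (intro mult_nonneg_nonneg sum_nonneg integral_nonneg_AE AE_I2) (auto simp: less_imp_le)
      then have "lyap (- a) n * (\<Sum>t=1..T. prob (up_exit n t)) \<le> Q" using bud[rule_format, of n T] by linarith
      moreover have "(\<Sum>t=1..T. prob (up_exit n t)) = (\<Sum>t<T. prob (up_exit n (Suc t)))"
        by (rule sum.reindex_bij_witness[of _ Suc "\<lambda>t. t - 1"]) auto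
      ultimately show ?thesis using lyap_pos[of "- a" n] by (simp add: field_simps)
    qed
    have sm: "summable (\<lambda>t. prob (up_exit n (Suc t)))" by (rule summableI_nonneg_bounded[OF _ le]) auto
    have "AE \<omega> in M. \<omega> \<in> {\<omega> \<in> space M. \<exists>t\<ge>1. \<omega> \<in> alive t \<and> n \<le> X t \<omega>} \<longrightarrow> \<omega> \<in> (\<Union>t. up_exit n (Suc t))"
      using AE_X1
    proof eventually_elim
      case (elim \<omega>)
      show ?case
      proof
        assume "\<omega> \<in> {\<omega> \<in> space M. \<exists>t\<ge>1. \<omega> \<in> alive t \<and> n \<le> X t \<omega>}"
        then have \<omega>: "\<omega> \<in> space M" and ex: "\<exists>t. 1 \<le> t \<and> \<omega> \<in> alive t \<and> n \<le> X t \<omega>" by auto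
        define t where "t = (LEAST t. 1 \<le> t \<and> \<omega> \<in> alive t \<and> n \<le> X t \<omega>)"
        have t: "1 \<le> t" "\<omega> \<in> alive t" "n \<le> X t \<omega>" using LeastI_ex[OF ex] unfolding t_def by auto
        have "t \<noteq> 1" using t(3) elim n by auto
        then obtain s where s: "t = Suc (Suc s)" using t(1) by (metis One_nat_def Suc_le_D not0_implies_Suc)
        have less: "X u \<omega> < n" if "1 \<le> u" "u \<le> Suc s" for u
        proof (rule ccontr)
          assume "\<not> X u \<omega> < n"
          then have "1 \<le> u \<and> \<omega> \<in> alive u \<and> n \<le> X u \<omega>" using that t(2) s alive_antimono[of u t] by auto
          then have "t \<le> u" unfolding t_def by (rule Least_le)
          then show False using that s by simp
        qed
        have "\<omega> \<in> below n (Suc s)" unfolding below_def using less t(2) s alive_antimono[of "Suc s" t] by auto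
        then have "\<omega> \<in> up_exit n (Suc s)" unfolding up_exit_def using t(3) s \<omega> by simp
        then show "\<omega> \<in> (\<Union>t. up_exit n (Suc t))" by blast
      qed
    qed
    then have "prob {\<omega> \<in> space M. \<exists>t\<ge>1. \<omega> \<in> alive t \<and> n \<le> X t \<omega>} \<le> prob (\<Union>t. up_exit n (Suc t))"
      by (rule finite_measure_mono_AE) (use UM in auto)
    also have "\<dots> \<le> (\<Sum>t. prob (up_exit n (Suc t)))"
      by (rule finite_measure_subadditive_countably) (use UM sm in auto)
    also have "\<dots> \<le> Q / lyap (- a) n" by (rule suminf_le_const[OF sm le])
    finally show ?thesis .
  qed
  then show ?thesis using Q by blast
qed

lemma alive_prob_null: "prob (\<Inter>t. alive t) = 0"
proof -
  define a where "a = (1 + r) / 2"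
  have a: "0 < a" "a \<le> 1 + r" using r_gt by (auto simp: a_def)
  obtain Q where Q: "0 < Q" "\<And>n. 0 < n \<Longrightarrow> prob {\<omega> \<in> space M. \<exists>t\<ge>1. \<omega> \<in> alive t \<and> n \<le> X t \<omega>} \<le> Q / lyap (- a) n"
    using excursion_max_tail[OF a] by blast
  have hitM: "{\<omega> \<in> space M. \<exists>t\<ge>1. \<omega> \<in> alive t \<and> n \<le> X t \<omega>} \<in> sets M" for n
  proof -
    have "{\<omega> \<in> space M. \<exists>t\<ge>1. \<omega> \<in> alive t \<and> n \<le> X t \<omega>} = (\<Union>t\<in>{1..}. alive t \<inter> {\<omega> \<in> space M. n \<le> X t \<omega>})"
      by (auto simp: alive_def)
    also have "\<dots> \<in> sets M"
      by (rule sets.countable_UN') (auto intro!: sets.Int alive_M sets_F_M[OF _ X_ge_F[OF _ order_refl]])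
    finally show ?thesis .
  qed
  have AM: "(\<Inter>t. alive t) \<in> sets M" using alive_M by (intro sets.countable_INT) auto
  have le: "prob (\<Inter>t. alive t) \<le> Q / lyap (- a) n" if n: "0 < n" for n
  proof -
    obtain V where V: "\<And>T. (\<Sum>t=1..T. prob (alive t \<inter> {\<omega> \<in> space M. X t \<omega> < n})) \<le> V"
      using visits_bound[of n] by blast
    have "summable (\<lambda>t. prob (alive (Suc t) \<inter> {\<omega> \<in> space M. X (Suc t) \<omega> < n}))"
    proof (rule summableI_nonneg_bounded)
      fix T
      have "(\<Sum>t<T. prob (alive (Suc t) \<inter> {\<omega> \<in> space M. X (Suc t) \<omega> < n})) = (\<Sum>t=1..T. prob (alive t \<inter> {\<omega> \<in> space M. X t \<omega> < n}))"
        by (rule sum.reindex_bij_witness[of _ "\<lambda>t. t - 1" Suc]) auto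
      then show "(\<Sum>t<T. prob (alive (Suc t) \<inter> {\<omega> \<in> space M. X (Suc t) \<omega> < n})) \<le> V" using V by simp
    qed simp
    then have lim: "(\<lambda>t. prob (alive (Suc t) \<inter> {\<omega> \<in> space M. X (Suc t) \<omega> < n})) \<longlonglongrightarrow> 0" by (rule summable_LIMSEQ_zero)
    have "prob (\<Inter>t. alive t) \<le> prob (alive (Suc t) \<inter> {\<omega> \<in> space M. X (Suc t) \<omega> < n}) + Q / lyap (- a) n" for t
    proof -
      let ?H = "{\<omega> \<in> space M. \<exists>t\<ge>1. \<omega> \<in> alive t \<and> n \<le> X t \<omega>}"
      let ?L = "alive (Suc t) \<inter> {\<omega> \<in> space M. X (Suc t) \<omega> < n}"
      have LM: "?L \<in> sets M" by (intro sets.Int alive_M sets_F_M[OF _ X_less_F[OF _ order_refl]]) auto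
      have "(\<Inter>t. alive t) \<subseteq> ?L \<union> ?H"
      proof
        fix \<omega> assume w: "\<omega> \<in> (\<Inter>t. alive t)"
        then have al: "\<omega> \<in> alive (Suc t)" by blast
        then have "\<omega> \<in> space M" by (simp add: alive_def)
        then show "\<omega> \<in> ?L \<union> ?H" using al by (cases "X (Suc t) \<omega> < n") (auto intro!: exI[of _ "Suc t"])
      qed
      then have "prob (\<Inter>t. alive t) \<le> prob (?L \<union> ?H)" by (rule finite_measure_mono) (rule sets.Un[OF LM hitM])
      also have "\<dots> \<le> prob ?L + prob ?H" by (rule measure_Un_le[OF LM hitM])
      also have "\<dots> \<le> prob ?L + Q / lyap (- a) n" using Q(2)[OF n] by simp
      finally show ?thesis .
    qed
    moreover have "(\<lambda>t. prob (alive (Suc t) \<inter> {\<omega> \<in> space M. X (Suc t) \<omega> < n}) + Q / lyap (- a) n) \<longlonglongrightarrow> 0 + Q / lyap (- a) n"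
      by (intro tendsto_add lim tendsto_const)
    ultimately have "prob (\<Inter>t. alive t) \<le> 0 + Q / lyap (- a) n" by (intro LIMSEQ_le_const[where X = "\<lambda>t. prob (alive (Suc t) \<inter> {\<omega> \<in> space M. X (Suc t) \<omega> < n}) + Q / lyap (- a) n"]) auto
    then show ?thesis by simp
  qed
  have "((\<lambda>n. Q / lyap (- a) n) \<longlongrightarrow> 0) at_top"
    by (rule tendsto_divide_0[OF tendsto_const filterlim_at_top_imp_at_infinity[OF lyap_at_top]])
  moreover have "eventually (\<lambda>n. prob (\<Inter>t. alive t) \<le> Q / lyap (- a) n) at_top"
    using eventually_gt_at_top[of 0] by eventually_elim (rule le)
  ultimately have "prob (\<Inter>t. alive t) \<le> 0"
    by (rule tendsto_lowerbound[OF _ _ trivial_limit_at_top_linorder])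
  then show ?thesis using measure_nonneg[of M "\<Inter>t. alive t"] by linarith
qed

lemma AE_return: "AE \<omega> in M. \<exists>t\<ge>2. X t \<omega> = 0"
proof -
  have "(\<Inter>t. alive t) \<in> null_sets M"
    using alive_prob_null alive_M by (auto simp: null_sets_def emeasure_eq_measure intro!: sets.countable_INT)
  then have "AE \<omega> in M. \<omega> \<notin> (\<Inter>t. alive t)" by (rule AE_not_in)
  then show ?thesis using AE_space
    by eventually_elim (auto simp: alive_def)
qed

lemma prob_alive_tendsto: "(\<lambda>t. prob (alive t)) \<longlonglongrightarrow> 0"
proof -
  have "(\<lambda>t. prob (alive t)) \<longlonglongrightarrow> prob (\<Inter>t. alive t)"
    using alive_M alive_antimono by (intro finite_Lim_measure_decseq) (auto simp: decseq_def)
  then show ?thesis by (simp add: alive_prob_null)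
qed

end

section \<open>Decomposition into excursions\<close>

lemma tau_Suc_eq:
  "tau X (Suc n) \<omega> = enat k \<longleftrightarrow>
    (\<exists>j<k. tau X n \<omega> = enat j \<and> X k \<omega> = 0 \<and> (\<forall>i. j < i \<and> i < k \<longrightarrow> X i \<omega> \<noteq> 0))"
proof (cases "tau X n \<omega>")
  case (enat j)
  show ?thesis
  proof (cases "\<exists>t>j. X t \<omega> = 0")
    case True
    define L where "L = (LEAST t. t > j \<and> X t \<omega> = 0)"
    have L: "j < L" "X L \<omega> = 0" using LeastI_ex[OF True] unfolding L_def by auto
    have Lm: "X i \<omega> \<noteq> 0" if "j < i" "i < L" for i using not_less_Least[of i "\<lambda>t. t > j \<and> X t \<omega> = 0"] that unfolding L_def by auto
    have "tau X (Suc n) \<omega> = enat L" using enat True by (simp add: L_def)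
    moreover have "k = L" if "j < k" "X k \<omega> = 0" "\<forall>i. j < i \<and> i < k \<longrightarrow> X i \<omega> \<noteq> 0"
      using that L Lm by (meson linorder_neqE_nat)
    ultimately show ?thesis using enat L Lm by auto
  next
    case False
    then show ?thesis using enat by auto
  qed
qed simp

lemma tau_ge: "tau X n \<omega> = enat k \<Longrightarrow> n < k"
proof (induction n arbitrary: k)
  case 0 then show ?case by (simp add: one_enat_def[symmetric] enat_1[symmetric])
next
  case (Suc n)
  then obtain j where "j < k" "tau X n \<omega> = enat j" unfolding tau_Suc_eq by blast
  then show ?case using Suc.IH[of j] by simp
qed

lemma Nexc_infinite_iff: "Nexc X \<omega> = \<infinity> \<longleftrightarrow> (\<forall>n. tau X n \<omega> \<noteq> \<infinity>)"
proof -
  have "(\<exists>n\<ge>1. tau X n \<omega> = \<infinity>) \<longleftrightarrow> (\<exists>n. tau X n \<omega> = \<infinity>)"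
    by (metis tau.simps(1) enat.distinct(2) le_less_linear less_one)
  then show ?thesis unfolding Nexc_def by auto
qed

definition return_time :: "(nat \<Rightarrow> 'a \<Rightarrow> real) \<Rightarrow> nat \<Rightarrow> 'a \<Rightarrow> nat" where
  "return_time X n \<omega> = the_enat (tau X n \<omega>)"

context
  fixes X :: "nat \<Rightarrow> 'a \<Rightarrow> real" and \<omega> :: 'a
  assumes fin: "\<And>n. tau X n \<omega> \<noteq> \<infinity>"
begin

lemma tau_return_time: "tau X n \<omega> = enat (return_time X n \<omega>)"
  unfolding return_time_def using fin[of n] by (cases "tau X n \<omega>") auto

lemma return_time_0: "return_time X 0 \<omega> = 1"
  by (simp add: return_time_def)

lemma return_time_Suc: "return_time X n \<omega> < return_time X (Suc n) \<omega>" "X (return_time X (Suc n) \<omega>) \<omega> = 0"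
  "\<And>i. return_time X n \<omega> < i \<Longrightarrow> i < return_time X (Suc n) \<omega> \<Longrightarrow> X i \<omega> \<noteq> 0"
  using tau_Suc_eq[THEN iffD1, OF tau_return_time[of "Suc n"]] tau_return_time[of n] by auto

lemma return_time_strict_mono: "strict_mono (\<lambda>n. return_time X n \<omega>)"
  by (rule strict_monoI_Suc) (rule return_time_Suc)

lemma return_time_gt: "n < return_time X n \<omega>"
  using tau_ge[OF tau_return_time] .

lemma excursion_Suc: "excursion X (Suc n) \<omega> = map (\<lambda>t. X t \<omega>) [return_time X n \<omega>..<return_time X (Suc n) \<omega>]"
  by (simp add: excursion_def return_time_def)

lemma sum_list_excursion:
  "sum_list (map g (excursion X (Suc n) \<omega>)) = (\<Sum>t=return_time X n \<omega>..<return_time X (Suc n) \<omega>. (g (X t \<omega>) :: real))"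
  unfolding excursion_Suc by (simp add: comp_def interv_sum_list_conv_sum_set_nat)

lemma sum_excursions:
  "(\<Sum>k<n. sum_list (map g (excursion X (Suc k) \<omega>))) = (\<Sum>t=1..<return_time X n \<omega>. (g (X t \<omega>) :: real))"
proof (induction n)
  case 0 then show ?case by (simp add: return_time_0)
next
  case (Suc n)
  have "1 \<le> return_time X n \<omega>" using return_time_gt[of n] by simp
  then have "(\<Sum>t=1..<return_time X n \<omega>. g (X t \<omega>)) + (\<Sum>t=return_time X n \<omega>..<return_time X (Suc n) \<omega>. g (X t \<omega>)) = (\<Sum>t=1..<return_time X (Suc n) \<omega>. g (X t \<omega>))"
    using return_time_Suc(1)[of n] by (intro sum.atLeastLessThan_concat) auto
  then show ?case using Suc by (simp add: sum_list_excursion)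
qed

lemma return_time_bracket:
  assumes "1 \<le> t" obtains n where "return_time X n \<omega> \<le> t" "t < return_time X (Suc n) \<omega>"
proof -
  define n where "n = (LEAST n. t < return_time X (Suc n) \<omega>)"
  have ex: "\<exists>n. t < return_time X (Suc n) \<omega>" using return_time_gt[of "Suc t"] by (intro exI[of _ t]) simp
  have n: "t < return_time X (Suc n) \<omega>" unfolding n_def by (rule LeastI_ex[OF ex])
  have "return_time X n \<omega> \<le> t"
  proof (cases n)
    case 0 then show ?thesis using assms by (simp add: return_time_0)
  next
    case (Suc k)
    then have "\<not> t < return_time X (Suc k) \<omega>" using not_less_Least[of k "\<lambda>n. t < return_time X (Suc n) \<omega>"] unfolding n_def by simp
    then show ?thesis using Suc by simp
  qed
  then show thesis using n that by blast
qed

end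

context lamperti begin

lemma tau_eq_sets: "{\<omega> \<in> space M. tau X n \<omega> = enat k} \<in> sets M"
proof (induction n arbitrary: k)
  case 0 then show ?case by (cases "k = 1") (auto simp: one_enat_def)
next
  case (Suc n)
  have XM: "{\<omega> \<in> space M. X i \<omega> = 0} \<in> sets M" "{\<omega> \<in> space M. X i \<omega> \<noteq> 0} \<in> sets M" if "1 \<le> i" for i
    using sets_F_M[OF that X_eq_F[OF that order_refl]] sets_F_M[OF that X_neq_F[OF that order_refl]] by auto
  have "{\<omega> \<in> space M. tau X (Suc n) \<omega> = enat k} = (\<Union>j\<in>{..<k}. {\<omega> \<in> space M. tau X n \<omega> = enat j} \<inter>
      ({\<omega> \<in> space M. X k \<omega> = 0} \<inter> {\<omega> \<in> space M. \<forall>i\<in>{j<..<k}. X i \<omega> \<noteq> 0}))"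
    unfolding tau_Suc_eq by auto
  also have "\<dots> \<in> sets M"
  proof (rule sets.finite_UN)
    fix j assume j: "j \<in> {..<k}"
    have "{\<omega> \<in> space M. \<forall>i\<in>{j<..<k}. X i \<omega> \<noteq> 0} \<in> sets M"
      by (intro sets.sets_Collect_finite_All XM) auto
    moreover have "1 \<le> k" using j by auto
    ultimately show "{\<omega> \<in> space M. tau X n \<omega> = enat j} \<inter>
      ({\<omega> \<in> space M. X k \<omega> = 0} \<inter> {\<omega> \<in> space M. \<forall>i\<in>{j<..<k}. X i \<omega> \<noteq> 0}) \<in> sets M"
      using Suc XM(1)[of k] by (intro sets.Int) auto
  qed simp
  finally show ?case .
qed

lemma tau_finite_sets: "{\<omega> \<in> space M. tau X n \<omega> < \<infinity>} \<in> sets M"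
proof -
  have "{\<omega> \<in> space M. tau X n \<omega> < \<infinity>} = (\<Union>k. {\<omega> \<in> space M. tau X n \<omega> = enat k})"
    by (auto simp: less_infinityE elim: less_infinityE)
  then show ?thesis using tau_eq_sets by auto
qed

lemma AE_tau_1: "AE \<omega> in M. tau X 1 \<omega> < \<infinity>"
  using AE_return
proof eventually_elim
  case (elim \<omega>)
  then have "\<exists>t>1. X t \<omega> = 0" by (auto simp: Suc_le_eq numeral_2_eq_2)
  then show ?case by simp
qed

lemma eta_finite_iff: "tau X n \<omega> < \<infinity> \<Longrightarrow> eta X (Suc n) \<omega> < \<infinity> \<longleftrightarrow> tau X (Suc n) \<omega> < \<infinity>"
  unfolding eta_def by (cases "tau X (Suc n) \<omega>"; cases "tau X n \<omega>") auto

lemma prob_tau_finite: "prob {\<omega> \<in> space M. tau X n \<omega> < \<infinity>} = 1"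
proof (induction n)
  case 0 then show ?case by (simp add: prob_space)
next
  case (Suc n)
  have "prob {\<omega> \<in> space M. eta X 1 \<omega> < \<infinity>} = prob {\<omega> \<in> space M. tau X 1 \<omega> < \<infinity>}"
    using eta_finite_iff[of 0] by simp
  also have "\<dots> = 1" using AE_tau_1 tau_finite_sets[of 1] by (simp add: prob_Collect_eq_1)
  finally have e1: "prob {\<omega> \<in> space M. eta X 1 \<omega> < \<infinity>} = 1" .
  have "cond_prob M (\<lambda>\<omega>. eta X (Suc n) \<omega> < \<infinity>) (\<lambda>\<omega>. tau X n \<omega> < \<infinity>) = 1"
    using A3b[of n] Suc e1 by simp
  then have "prob {\<omega> \<in> space M. eta X (Suc n) \<omega> < \<infinity> \<and> tau X n \<omega> < \<infinity>} = 1"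
    unfolding cond_prob_def Suc by simp
  moreover have "{\<omega> \<in> space M. eta X (Suc n) \<omega> < \<infinity> \<and> tau X n \<omega> < \<infinity>} \<subseteq> {\<omega> \<in> space M. tau X (Suc n) \<omega> < \<infinity>}"
    using eta_finite_iff[of n] by auto
  then have "prob {\<omega> \<in> space M. eta X (Suc n) \<omega> < \<infinity> \<and> tau X n \<omega> < \<infinity>} \<le> prob {\<omega> \<in> space M. tau X (Suc n) \<omega> < \<infinity>}"
    by (rule finite_measure_mono) (rule tau_finite_sets)
  ultimately show ?case using prob_le_1[of "{\<omega> \<in> space M. tau X (Suc n) \<omega> < \<infinity>}"] by linarith
qed

lemma AE_tau_finite: "AE \<omega> in M. \<forall>n. tau X n \<omega> \<noteq> \<infinity>"
proof -
  have "AE \<omega> in M. tau X n \<omega> \<noteq> \<infinity>" for n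
    using AE_prob_1[OF prob_tau_finite[of n]] by eventually_elim auto
  then show ?thesis by (simp add: AE_all_countable)
qed

lemma excursions_iid:
  "indep_vars (\<lambda>_. count_space UNIV) (\<lambda>n. excursion X (Suc n)) UNIV"
  "distr M (count_space UNIV) (excursion X (Suc n)) = distr M (count_space UNIV) (excursion X 1)"
proof -
  define G where "G = {\<omega> \<in> space M. Nexc X \<omega> = \<infinity>}"
  have "G = (\<Inter>n. {\<omega> \<in> space M. tau X n \<omega> < \<infinity>})" unfolding G_def Nexc_infinite_iff by (auto simp: less_top[symmetric])
  then have GM: "G \<in> sets M" using tau_finite_sets by (auto intro!: sets.countable_INT)
  have AEG: "AE \<omega> in M. \<omega> \<in> G" using AE_tau_finite AE_space by eventually_elim (simp add: G_def Nexc_infinite_iff)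
  then have pG: "prob G = 1" using GM by (simp add: prob_eq_1)
  have um: "uniform_measure M G = M"
  proof (rule measure_eqI)
    fix A assume "A \<in> sets (uniform_measure M G)"
    then have A: "A \<in> sets M" by simp
    have "emeasure M (G \<inter> A) = emeasure M A"
      using AEG A GM by (intro emeasure_eq_AE) auto
    then show "emeasure (uniform_measure M G) A = emeasure M A"
      using A GM pG by (simp add: emeasure_eq_measure divide_ennreal_def)
  qed simp
  have "0 < prob G" using pG by simp
  note A = A3a[folded G_def, OF this, unfolded Let_def um]
  show "indep_vars (\<lambda>_. count_space UNIV) (\<lambda>n. excursion X (Suc n)) UNIV"
    by (rule indep_vars_Suc) (use A[THEN conjunct1] in simp)
  show "distr M (count_space UNIV) (excursion X (Suc n)) = distr M (count_space UNIV) (excursion X 1)"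
    by (rule A[THEN conjunct2, rule_format]) simp
qed

lemma excursion_measurable: "excursion X (Suc n) \<in> measurable M (count_space UNIV)"
  using excursions_iid(1) unfolding indep_vars_def2 by simp

lemma excursion_pred_sets: "{\<omega> \<in> space M. P (excursion X (Suc n) \<omega>)} \<in> sets M"
  using measurable_sets[OF excursion_measurable[of n], of "{l. P l}"] by (simp add: vimage_def Int_def conj_commute)

lemma excursion_prob_eq:
  "prob {\<omega> \<in> space M. P (excursion X (Suc n) \<omega>)} = prob {\<omega> \<in> space M. P (excursion X 1 \<omega>)}"
proof -
  have "measure (distr M (count_space UNIV) (excursion X (Suc n))) {l. P l} = prob {\<omega> \<in> space M. P (excursion X (Suc n) \<omega>)}" for n
    by (subst measure_distr[OF excursion_measurable]) (auto simp: vimage_def Int_def conj_commute)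
  from this[of n] this[of 0] show ?thesis using excursions_iid(2)[of n] by simp
qed

definition esum :: "(real \<Rightarrow> real) \<Rightarrow> nat \<Rightarrow> 'a \<Rightarrow> real" where
  "esum g k \<omega> = sum_list (map g (excursion X (Suc k) \<omega>))"

lemma esum_indep: "indep_vars (\<lambda>_. borel) (esum g) UNIV"
proof -
  have "indep_vars (\<lambda>_. borel) (\<lambda>k \<omega>. sum_list (map g (excursion X (Suc k) \<omega>))) UNIV"
    by (rule indep_vars_compose2[OF excursions_iid(1)]) auto
  then show ?thesis unfolding esum_def[abs_def] .
qed

lemma esum_measurable [measurable]: "esum g k \<in> borel_measurable M"
  using esum_indep[of g] unfolding indep_vars_def2 by simp

lemma esum_distr: "distr M borel (esum g n) = distr M borel (esum g 0)"
proof -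
  have "distr M borel (esum g n) = distr (distr M (count_space UNIV) (excursion X (Suc n))) borel (\<lambda>l. sum_list (map g l))" for n
    by (subst distr_distr) (auto simp: comp_def esum_def[abs_def] excursion_measurable)
  then show ?thesis using excursions_iid(2)[of n] by simp
qed

lemma alive_iff:
  assumes "\<And>n. tau X n \<omega> \<noteq> \<infinity>" "\<omega> \<in> space M" "1 \<le> t"
  shows "\<omega> \<in> alive t \<longleftrightarrow> t < return_time X 1 \<omega>"
proof -
  note T = return_time_Suc[OF assms(1), of 0] return_time_0[OF assms(1)]
  show ?thesis
  proof
    assume "\<omega> \<in> alive t"
    then have "\<And>s. 2 \<le> s \<Longrightarrow> s \<le> t \<Longrightarrow> X s \<omega> \<noteq> 0" by (auto simp: alive_def)
    from this[of "return_time X 1 \<omega>"] T show "t < return_time X 1 \<omega>" by force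
  next
    assume "t < return_time X 1 \<omega>"
    then show "\<omega> \<in> alive t" using T assms(2) by (auto simp: alive_def)
  qed
qed

lemma suminf_alive_eq:
  assumes fin: "\<And>n. tau X n \<omega> \<noteq> \<infinity>" and \<omega>: "\<omega> \<in> space M" and g: "\<And>x. 0 \<le> g x"
  shows "(\<Sum>t. ennreal (indicator (alive (Suc t)) \<omega> * g (X (Suc t) \<omega>))) = ennreal (esum g 0 \<omega>)"
proof -
  have T0: "return_time X 0 \<omega> = 1" by (rule return_time_0[OF fin])
  have "(\<Sum>t. ennreal (indicator (alive (Suc t)) \<omega> * g (X (Suc t) \<omega>)))
      = (\<Sum>t<return_time X 1 \<omega> - 1. ennreal (indicator (alive (Suc t)) \<omega> * g (X (Suc t) \<omega>)))"
    using alive_iff[OF fin \<omega>] by (intro suminf_finite) (auto simp: indicator_def)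
  also have "\<dots> = (\<Sum>t<return_time X 1 \<omega> - 1. ennreal (g (X (Suc t) \<omega>)))"
    using alive_iff[OF fin \<omega>] by (intro sum.cong) (auto simp: indicator_def)
  also have "\<dots> = ennreal (\<Sum>t<return_time X 1 \<omega> - 1. g (X (Suc t) \<omega>))" using g by (intro sum_ennreal) auto
  also have "(\<Sum>t<return_time X 1 \<omega> - 1. g (X (Suc t) \<omega>)) = (\<Sum>t=1..<return_time X 1 \<omega>. g (X t \<omega>))"
    by (rule sum.reindex_bij_witness[of _ "\<lambda>t. t - 1" Suc]) auto
  also have "\<dots> = esum g 0 \<omega>" unfolding esum_def sum_list_excursion[OF fin] T0 by simp
  finally show ?thesis .
qed

lemma reach_positive:
  assumes y: "y \<in> S" obtains t where "1 \<le> t" "0 < prob (alive t \<inter> {\<omega> \<in> space M. X t \<omega> = y})"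
proof -
  have "\<exists>t\<ge>1. 0 < prob (alive t \<inter> {\<omega> \<in> space M. X t \<omega> = y})"
  proof (rule ccontr)
    assume neg: "\<not> (\<exists>t\<ge>1. 0 < prob (alive t \<inter> {\<omega> \<in> space M. X t \<omega> = y}))"
    have nul: "AE \<omega> in M. \<not> (\<omega> \<in> alive t \<and> X t \<omega> = y)" if t: "1 \<le> t" for t
    proof -
      have "prob (alive t \<inter> {\<omega> \<in> space M. X t \<omega> = y}) = 0"
      proof -
        have "\<not> 0 < prob (alive t \<inter> {\<omega> \<in> space M. X t \<omega> = y})" using neg t by blast
        then show ?thesis by (simp add: zero_less_measure_iff)
      qed
      moreover have "alive t \<inter> {\<omega> \<in> space M. X t \<omega> = y} \<in> sets M"
        using sets_F_M[OF t sets.Int[OF alive_F[OF order_refl] X_eq_F[OF t order_refl]]] .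
      ultimately have "alive t \<inter> {\<omega> \<in> space M. X t \<omega> = y} \<in> null_sets M"
        by (simp add: null_sets_def emeasure_eq_measure)
      then have "AE \<omega> in M. \<omega> \<notin> alive t \<inter> {\<omega> \<in> space M. X t \<omega> = y}" by (rule AE_not_in)
      then show ?thesis using AE_space by eventually_elim auto
    qed
    then have "AE \<omega> in M. \<forall>t. 1 \<le> t \<longrightarrow> \<not> (\<omega> \<in> alive t \<and> X t \<omega> = y)"
      by (simp add: AE_all_countable)
    then have "AE \<omega> in M. y \<notin> set (excursion X 1 \<omega>)"
      using AE_tau_finite AE_space
    proof eventually_elim
      case (elim \<omega>)
      then have fin: "\<And>n. tau X n \<omega> \<noteq> \<infinity>" by simp
      show ?case using elim(1) excursion_Suc[OF fin, of 0] return_time_0[OF fin] alive_iff[OF fin elim(3)] by force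
    qed
    then have "prob {\<omega> \<in> space M. y \<in> set (excursion X 1 \<omega>)} = 0"
      using excursion_pred_sets[of "\<lambda>l. y \<in> set l" 0] by (intro prob_eq_0_AE) auto
    then have "prob {\<omega> \<in> space M. y \<in> set (excursion X (Suc k) \<omega>)} = 0" for k
      using excursion_prob_eq[of "\<lambda>l. y \<in> set l" k] by simp
    then have "AE \<omega> in M. \<not> y \<in> set (excursion X (Suc k) \<omega>)" for k
      using excursion_pred_sets[of "\<lambda>l. y \<in> set l" k]
      by (intro AE_I[of _ _ "{\<omega> \<in> space M. y \<in> set (excursion X (Suc k) \<omega>)}"]) (auto simp: emeasure_eq_measure)
    then have "AE \<omega> in M. \<forall>k. y \<notin> set (excursion X (Suc k) \<omega>)" by (simp add: AE_all_countable)
    then have "AE \<omega> in M. X (1 + m 0 y) \<omega> \<noteq> y" using AE_tau_finite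
    proof eventually_elim
      case (elim \<omega>)
      then have fin: "\<And>n. tau X n \<omega> \<noteq> \<infinity>" by simp
      obtain n where n: "return_time X n \<omega> \<le> 1 + m 0 y" "1 + m 0 y < return_time X (Suc n) \<omega>"
        by (rule return_time_bracket[OF fin, of "1 + m 0 y"]) auto
      then have "X (1 + m 0 y) \<omega> \<in> set (excursion X (Suc n) \<omega>)" unfolding excursion_Suc[OF fin] by auto
      then show ?case using elim(1) by metis
    qed
    then have "AE \<omega> in M. \<omega> \<in> {\<omega> \<in> space M. X 1 \<omega> = 0} \<inter> {\<omega> \<in> space M. X (1 + m 0 y) \<omega> = y} \<longrightarrow> \<omega> \<in> {}"
      by eventually_elim simp
    then have "prob ({\<omega> \<in> space M. X 1 \<omega> = 0} \<inter> {\<omega> \<in> space M. X (1 + m 0 y) \<omega> = y}) \<le> prob {}"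
      by (rule finite_measure_mono_AE) simp
    moreover have "\<phi> 0 y * prob {\<omega> \<in> space M. X 1 \<omega> = 0} \<le> prob ({\<omega> \<in> space M. X 1 \<omega> = 0} \<inter> {\<omega> \<in> space M. X (1 + m 0 y) \<omega> = y})"
      by (rule A1_local[OF S_zero y]) (auto intro: X_eq_F)
    ultimately show False using X1 \<phi>_pos[OF S_zero y] by simp
  qed
  then show thesis using that by blast
qed

section \<open>The first excursion: lower bounds\<close>

lemma lyap_submartingale:
  assumes a: "0 < a"
  shows "\<exists>x0\<ge>exp 1. \<forall>t x B. x0 \<le> x \<longrightarrow> 1 \<le> t \<longrightarrow> B \<in> sets (F t) \<longrightarrow> B \<subseteq> {\<omega> \<in> space M. X t \<omega> = x} \<longrightarrow>
     lyap a x * prob B \<le> (\<integral>\<omega>. indicator B \<omega> * lyap a (X (t + 1) \<omega>) \<partial>M)"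
proof -
  define \<kappa> where "\<kappa> = s2 / 2 * (1 + r) * a"
  have \<kappa>: "0 < \<kappa>" using s2_pos r_gt a by (simp add: \<kappa>_def)
  obtain x0 where x0e: "exp 1 \<le> x0" and x0: "\<forall>t x B. x0 \<le> x \<longrightarrow> 1 \<le> t \<longrightarrow> B \<in> sets (F t) \<longrightarrow> B \<subseteq> {\<omega> \<in> space M. X t \<omega> = x} \<longrightarrow>
      \<bar>(\<integral>\<omega>. indicator B \<omega> * lyap a (X (t + 1) \<omega>) \<partial>M) - lyap a x * prob B - s2 / 2 * (1 + r) * a * lyap_rate a x * prob B\<bar>
        \<le> \<kappa> * lyap_rate a x * prob B"
    using lyap_drift[OF \<kappa>, of a] by (elim exE conjE)
  show ?thesis
  proof (rule exI[of _ x0], rule conjI[OF x0e], intro allI impI)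
    fix t x B assume h: "x0 \<le> x" "1 \<le> t" "B \<in> sets (F t)" "B \<subseteq> {\<omega> \<in> space M. X t \<omega> = x}"
    have eq: "s2 / 2 * (1 + r) * a * lyap_rate a x * prob B = \<kappa> * lyap_rate a x * prob B" by (simp add: \<kappa>_def)
    from x0[rule_format, OF h] show "lyap a x * prob B \<le> (\<integral>\<omega>. indicator B \<omega> * lyap a (X (t + 1) \<omega>) \<partial>M)"
      unfolding eq by linarith
  qed
qed

lemma weight_sum_le:
  assumes a: "0 < a" "a \<le> 1 + r"
  shows "\<exists>K>0. \<forall>T B. (\<forall>t\<in>{1..T}. B t \<subseteq> alive t \<and> integrable M (\<lambda>\<omega>. indicator (B t) \<omega> * lyap_rate (- a) (X t \<omega>))) \<longrightarrow>
     (\<Sum>t=1..T. \<integral>\<omega>. indicator (B t) \<omega> * lyap_rate (- a) (X t \<omega>) \<partial>M) \<le> K"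
proof -
  obtain K where K: "0 < K" and le: "(\<integral>\<^sup>+\<omega>. (\<Sum>t. ennreal (indicator (alive (Suc t)) \<omega> * lyap_rate (- a) (X (Suc t) \<omega>))) \<partial>M) \<le> ennreal K"
    using excursion_weight_finite[OF a] by (elim exE conjE)
  have [measurable]: "alive t \<in> sets M" for t by (rule alive_M)
  have [measurable]: "(\<lambda>\<omega>. ennreal (indicator (alive (Suc t)) \<omega> * lyap_rate (- a) (X (Suc t) \<omega>))) \<in> borel_measurable M" for t
    by measurable
  have "(\<Sum>t=1..T. \<integral>\<omega>. indicator (B t) \<omega> * lyap_rate (- a) (X t \<omega>) \<partial>M) \<le> K"
    if B: "\<forall>t\<in>{1..T}. B t \<subseteq> alive t \<and> integrable M (\<lambda>\<omega>. indicator (B t) \<omega> * lyap_rate (- a) (X t \<omega>))" for T B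
  proof -
    have nn: "0 \<le> indicator (B t) \<omega> * lyap_rate (- a) (X t \<omega>)" for t \<omega> using lyap_rate_pos[of "- a" "X t \<omega>"] by simp
    have "ennreal (\<Sum>t=1..T. \<integral>\<omega>. indicator (B t) \<omega> * lyap_rate (- a) (X t \<omega>) \<partial>M) = (\<Sum>t=1..T. ennreal (\<integral>\<omega>. indicator (B t) \<omega> * lyap_rate (- a) (X t \<omega>) \<partial>M))"
      using nn by (intro sum_ennreal[symmetric] integral_nonneg_AE AE_I2)
    also have "\<dots> = (\<Sum>t=1..T. \<integral>\<^sup>+\<omega>. ennreal (indicator (B t) \<omega> * lyap_rate (- a) (X t \<omega>)) \<partial>M)"
      using B nn by (intro sum.cong refl nn_integral_eq_integral[symmetric] AE_I2) auto
    also have "\<dots> \<le> (\<Sum>t=1..T. \<integral>\<^sup>+\<omega>. ennreal (indicator (alive t) \<omega> * lyap_rate (- a) (X t \<omega>)) \<partial>M)"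
    proof (intro sum_mono nn_integral_mono ennreal_leI mult_right_mono)
      fix t \<omega> assume "t \<in> {1..T}"
      then show "indicator (B t) \<omega> \<le> (indicator (alive t) \<omega> :: real)" using B by (auto simp: indicator_def)
      show "0 \<le> lyap_rate (- a) (X t \<omega>)" using lyap_rate_pos less_imp_le by blast
    qed
    also have "\<dots> = (\<Sum>t<T. \<integral>\<^sup>+\<omega>. ennreal (indicator (alive (Suc t)) \<omega> * lyap_rate (- a) (X (Suc t) \<omega>)) \<partial>M)"
      by (rule sum.reindex_bij_witness[of _ Suc "\<lambda>t. t - 1"]) auto
    also have "\<dots> \<le> (\<Sum>t. \<integral>\<^sup>+\<omega>. ennreal (indicator (alive (Suc t)) \<omega> * lyap_rate (- a) (X (Suc t) \<omega>)) \<partial>M)"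
      by (intro sum_le_suminf) auto
    also have "\<dots> = (\<integral>\<^sup>+\<omega>. (\<Sum>t. ennreal (indicator (alive (Suc t)) \<omega> * lyap_rate (- a) (X (Suc t) \<omega>))) \<partial>M)"
      by (rule nn_integral_suminf[symmetric]) measurable
    also have "\<dots> \<le> ennreal K" by (rule le)
    finally show ?thesis using K by (subst (asm) ennreal_le_iff) auto
  qed
  then show ?thesis using K by blast
qed

lemma overshoot_bound:
  assumes a: "0 < a"
  shows "\<exists>K>0. \<forall>n x y. exp 1 \<le> n \<longrightarrow> x < n \<longrightarrow> n \<le> y \<longrightarrow> 0 \<le> x \<longrightarrow>
     lyap a y \<le> lyap a (2 * n) + K * n powr (1 + r + \<delta> / 4 - p) * \<bar>y - x\<bar> powr p"
proof -
  obtain K where K: "0 < K" "\<And>u. exp 1 \<le> u \<Longrightarrow> powln (1 + r) a u \<le> K * u powr (1 + r + \<delta> / 4)"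
    using powln_le_powr[of "\<delta> / 4" "1 + r" a] \<delta>_pos by auto
  define q where "q = 1 + r + \<delta> / 4"
  have q: "0 < q" "q \<le> p" using r_gt \<delta>_pos \<delta>_less by (auto simp: q_def)
  have "lyap a y \<le> lyap a (2 * n) + K * 2 powr q * n powr (q - p) * \<bar>y - x\<bar> powr p"
    if n: "exp 1 \<le> n" and x: "x < n" "0 \<le> x" and y: "n \<le> y" for n x y
  proof (cases "y \<le> 2 * n")
    case True
    have "0 \<le> K * 2 powr q * n powr (q - p) * \<bar>y - x\<bar> powr p" using K(1) by simp
    moreover have "lyap a y \<le> lyap a (2 * n)" using True a r_gt by (intro lyap_mono) auto
    ultimately show ?thesis by linarith
  next
    case False
    define D where "D = y - x"
    have n0: "0 < n" using n by (rule less_le_trans[OF exp_gt_zero])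
    have D: "n \<le> D" "y \<le> 2 * D" using False x by (auto simp: D_def)
    have "max y (exp 1) = y" using n y by simp
    then have "lyap a y \<le> K * y powr q" using K(2)[of y] n y by (simp add: lyap_def q_def)
    also have "\<dots> \<le> K * (2 * D) powr q" using K(1) D q n0 y by (intro mult_left_mono powr_mono2) auto
    also have "\<dots> = K * 2 powr q * (D powr (q - p) * D powr p)"
      using D n0 by (simp add: powr_mult flip: powr_add)
    also have "\<dots> \<le> K * 2 powr q * (n powr (q - p) * D powr p)"
      using K(1) D n0 q by (intro mult_left_mono mult_right_mono powr_mono2') auto
    finally have "lyap a y \<le> K * 2 powr q * n powr (q - p) * \<bar>y - x\<bar> powr p" using D n0 by (simp add: D_def mult.assoc)
    then show ?thesis using lyap_pos[of a "2 * n"] by linarith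
  qed
  then show ?thesis using K(1) unfolding q_def by (intro exI[of _ "K * 2 powr (1 + r + \<delta> / 4)"]) auto
qed

lemma moment_weight_bound:
  "\<exists>K>0. \<forall>n x. exp 1 \<le> x \<longrightarrow> x < n \<longrightarrow>
     (1 + x) powr (p - 2 - \<delta>) \<le> K * n powr (p - 1 - r - \<delta> + \<delta> / 4) * lyap_rate (- a) x"
proof -
  obtain K where K: "0 < K" "\<And>u. exp 1 \<le> u \<Longrightarrow> K * u powr (r - 1 - \<delta> / 4) \<le> powln (r - 1) (- a - 1) u"
    using powln_ge_powr[of "\<delta> / 4" "r - 1" "- a - 1"] \<delta>_pos by auto
  define z where "z = p - 1 - r - \<delta> + \<delta> / 4"
  have z: "0 < z" using \<delta>_less \<delta>_pos by (simp add: z_def)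
  have "(1 + x) powr (p - 2 - \<delta>) \<le> 2 powr \<bar>p - 2 - \<delta>\<bar> / K * n powr z * lyap_rate (- a) x" if x: "exp 1 \<le> x" "x < n" for n x
  proof -
    have x1: "1 < x" using x exp_gt_one[of "1::real"] by linarith
    have lwx: "lyap_rate (- a) x = powln (r - 1) (- a - 1) x" using x by (simp add: lyap_rate_def max_def)
    have "(1 + x) powr (p - 2 - \<delta>) \<le> 2 powr \<bar>p - 2 - \<delta>\<bar> * x powr (p - 2 - \<delta>)"
      using x1 by (intro powr_le_of_comparable) auto
    also have "x powr (p - 2 - \<delta>) = x powr z * x powr (r - 1 - \<delta> / 4)"
    proof -
      have "p - 2 - \<delta> = z + (r - 1 - \<delta> / 4)" by (simp add: z_def)
      then show ?thesis by (simp only: powr_add)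
    qed
    also have "2 powr \<bar>p - 2 - \<delta>\<bar> * (x powr z * x powr (r - 1 - \<delta> / 4)) = 2 powr \<bar>p - 2 - \<delta>\<bar> / K * (x powr z * (K * x powr (r - 1 - \<delta> / 4)))"
      using K(1) by simp
    also have "\<dots> \<le> 2 powr \<bar>p - 2 - \<delta>\<bar> / K * (n powr z * lyap_rate (- a) x)"
      unfolding lwx using K x z x1 by (intro mult_left_mono mult_mono powr_mono2 K(2)) auto
    finally show ?thesis by (simp add: mult.assoc)
  qed
  then show ?thesis using K(1) unfolding z_def by (intro exI[of _ "2 powr \<bar>p - 2 - \<delta>\<bar> / K"]) auto
qed

text \<open>The submartingale is started from a high state \<open>y\<close> reached within the first excursion and stopped below
  \<open>x0\<close> or above \<open>n\<close>. Overshoots beyond \<open>2 * n\<close> contribute \<open>O(n powr (- \<delta> / 2))\<close> because the excursion sum of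
  \<open>lyap_rate (- a)\<close> has finite mean.\<close>

lemma up_crossing_lower:
  assumes a: "0 < a" "a \<le> 1 + r"
  shows "\<exists>c1>0. \<exists>n1. \<forall>n\<ge>n1. \<exists>T U. (\<forall>t\<in>{1..T}. U t \<in> sets (F (t + 1)) \<and> U t \<subseteq> alive t \<and> U t \<subseteq> {\<omega> \<in> space M. n \<le> X (t + 1) \<omega>})
     \<and> disjoint_family_on U {1..T} \<and> c1 / lyap a (2 * n) \<le> (\<Sum>t=1..T. prob (U t))"
proof -
  obtain x0 where x0e: "exp 1 \<le> x0" and sub: "\<forall>t x B. x0 \<le> x \<longrightarrow> 1 \<le> t \<longrightarrow> B \<in> sets (F t) \<longrightarrow> B \<subseteq> {\<omega> \<in> space M. X t \<omega> = x} \<longrightarrow>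
     lyap a x * prob B \<le> (\<integral>\<omega>. indicator B \<omega> * lyap a (X (t + 1) \<omega>) \<partial>M)"
    using lyap_submartingale[OF a(1)] by (elim exE conjE)
  obtain Kw where Kw: "0 < Kw" and wsum: "\<forall>T B. (\<forall>t\<in>{1..T}. B t \<subseteq> alive t \<and> integrable M (\<lambda>\<omega>. indicator (B t) \<omega> * lyap_rate (- a) (X t \<omega>))) \<longrightarrow>
     (\<Sum>t=1..T. \<integral>\<omega>. indicator (B t) \<omega> * lyap_rate (- a) (X t \<omega>) \<partial>M) \<le> Kw"
    using weight_sum_le[OF a] by (elim exE conjE)
  obtain Ko where Ko: "0 < Ko" and over: "\<forall>n x y. exp 1 \<le> n \<longrightarrow> x < n \<longrightarrow> n \<le> y \<longrightarrow> 0 \<le> x \<longrightarrow>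
     lyap a y \<le> lyap a (2 * n) + Ko * n powr (1 + r + \<delta> / 4 - p) * \<bar>y - x\<bar> powr p"
    using overshoot_bound[OF a(1)] by (elim exE conjE)
  obtain Km where Km: "0 < Km" and mom: "\<forall>n x. exp 1 \<le> x \<longrightarrow> x < n \<longrightarrow>
     (1 + x) powr (p - 2 - \<delta>) \<le> Km * n powr (p - 1 - r - \<delta> + \<delta> / 4) * lyap_rate (- a) x"
    using moment_weight_bound[of a] by (elim exE conjE)
  have x00: "0 < x0" using x0e by (rule less_le_trans[OF exp_gt_zero])
  have lfm: "lyap a u \<le> lyap a v" if "u \<le> v" for u v using that a r_gt by (intro lyap_mono) auto
  have "eventually (\<lambda>u. 2 * lyap a x0 \<le> lyap a u \<and> x0 \<le> u) at_top"
    using lyap_at_top[of a] by (intro eventually_conj eventually_ge_at_top) (simp add: filterlim_at_top)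
  then obtain y0 where y0: "\<forall>u\<ge>y0. 2 * lyap a x0 \<le> lyap a u \<and> x0 \<le> u" by (auto simp: eventually_at_top_linorder)
  obtain y where y: "y \<in> S" "y0 \<le> y"
  proof -
    have "\<not> S \<subseteq> {0..y0}" using S_unbdd bounded_subset[OF bounded_closed_interval] by blast
    then show thesis using S_nonneg that by (auto simp: subset_iff)
  qed
  have yx0: "x0 \<le> y" and lfy: "2 * lyap a x0 \<le> lyap a y" using y0 y by auto
  obtain t0 where t0: "1 \<le> t0" and P0: "0 < prob (alive t0 \<inter> {\<omega> \<in> space M. X t0 \<omega> = y})"
    using reach_positive[OF y(1)] .
  define A0 where "A0 = alive t0 \<inter> {\<omega> \<in> space M. X t0 \<omega> = y}"
  define P where "P = prob A0"
  have P: "0 < P" using P0 by (simp add: P_def A0_def)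
  have A0F: "A0 \<in> sets (F t0)" unfolding A0_def using t0 by (intro sets.Int alive_F X_eq_F) auto
  define c1 where "c1 = P * lyap a y / 4"
  have c1: "0 < c1" using P lyap_pos[of a y] by (simp add: c1_def)
  define K5 where "K5 = Ko * (C * Km) * Kw"
  have K5: "0 < K5" using Ko C_pos Km Kw by (simp add: K5_def)
  have "((\<lambda>n. K5 * n powr (- (\<delta> / 2))) \<longlongrightarrow> K5 * 0) at_top"
    using \<delta>_pos by (intro tendsto_mult tendsto_const tendsto_neg_powr) (auto simp: filterlim_ident)
  then have "eventually (\<lambda>n. K5 * n powr (- (\<delta> / 2)) < P * lyap a y / 8) at_top"
    using P lyap_pos[of a y] by (intro order_tendstoD(2)[where y = "K5 * 0"]) auto
  then obtain n2 where n2: "\<forall>n\<ge>n2. K5 * n powr (- (\<delta> / 2)) < P * lyap a y / 8" by (auto simp: eventually_at_top_linorder)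
  define n1 where "n1 = max n2 (y + 1)"
  have main: "\<exists>T U. (\<forall>t\<in>{1..T}. U t \<in> sets (F (t + 1)) \<and> U t \<subseteq> alive t \<and> U t \<subseteq> {\<omega> \<in> space M. n \<le> X (t + 1) \<omega>})
     \<and> disjoint_family_on U {1..T} \<and> c1 / lyap a (2 * n) \<le> (\<Sum>t=1..T. prob (U t))" if n: "n1 \<le> n" for n
  proof -
    have ny: "y < n" and n2n: "K5 * n powr (- (\<delta> / 2)) < P * lyap a y / 8" using n n2 by (auto simp: n1_def)
    have ne: "exp 1 \<le> n" using ny yx0 x0e by linarith
    have n0: "0 < n" using ne by (rule less_le_trans[OF exp_gt_zero])
    define B where "B = (\<lambda>t. if t < t0 then {} else A0 \<inter> {\<omega> \<in> space M. \<forall>s\<in>{t0..t}. X s \<omega> \<in> {x0..<n}})"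
    define U where "U = (\<lambda>t. B t \<inter> {\<omega> \<in> space M. n \<le> X (t + 1) \<omega>})"
    define D where "D = (\<lambda>t. B t \<inter> {\<omega> \<in> space M. X (t + 1) \<omega> < x0})"
    have BF: "B t \<in> sets (F t)" for t
    proof (cases "t < t0")
      case False
      then have "A0 \<in> sets (F t)" using A0F F_mono[of t0 t] by auto
      moreover have "{\<omega> \<in> space M. \<forall>s\<in>{t0..t}. X s \<omega> \<in> {x0..<n}} \<in> sets (F t)"
        using t0 by (intro pred_F_bounded_all X_preimage_F) auto
      ultimately show ?thesis using False by (simp add: B_def)
    qed (simp add: B_def)
    have Bl: "B t \<subseteq> {\<omega> \<in> space M. X t \<omega> < n}" and Bx0: "B t \<subseteq> {\<omega> \<in> space M. x0 \<le> X t \<omega>}" for t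
      unfolding B_def by (auto split: if_splits)
    have Bal: "B t \<subseteq> alive t" for t
    proof
      fix \<omega> assume w: "\<omega> \<in> B t"
      then have tt: "t0 \<le> t" "\<omega> \<in> A0" "\<And>s. t0 \<le> s \<Longrightarrow> s \<le> t \<Longrightarrow> x0 \<le> X s \<omega>" by (auto simp: B_def split: if_splits)
      have "X s \<omega> \<noteq> 0" if "2 \<le> s" "s \<le> t" for s
      proof (cases "s \<le> t0")
        case True then show ?thesis using tt(2) that by (auto simp: A0_def alive_def)
      next
        case False then show ?thesis using tt(3)[of s] that x00 by auto
      qed
      then show "\<omega> \<in> alive t" using tt(2) by (auto simp: alive_def A0_def)
    qed
    have Bt0: "B t0 = A0" unfolding B_def A0_def using yx0 ny by auto
    have BSuc: "B (Suc t) = B t \<inter> {\<omega> \<in> space M. X (Suc t) \<omega> \<in> {x0..<n}}" if "t0 \<le> t" for t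
      unfolding B_def using that by (auto simp: le_Suc_eq)
    have BM: "B t \<in> sets M" if "1 \<le> t" for t using sets_F_M[OF that BF] .
    have UF: "U t \<in> sets (F (t + 1))" and DF: "D t \<in> sets (F (t + 1))" for t
      unfolding U_def D_def using BF[of t] F_mono[of t "t + 1"] by (auto intro!: sets.Int X_ge_F X_less_F)
    have UM: "U t \<in> sets M" and DM: "D t \<in> sets M" for t using sets_F_M[OF _ UF] sets_F_M[OF _ DF] by auto
    define Ph where "Ph = (\<lambda>t. \<integral>\<omega>. indicator (B t) \<omega> * lyap a (X t \<omega>) \<partial>M)"
    define W where "W = (\<lambda>t. \<integral>\<omega>. indicator (B t) \<omega> * lyap_rate (- a) (X t \<omega>) \<partial>M)"
    define R where "R = Ko * n powr (1 + r + \<delta> / 4 - p)"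
    have R: "0 < R" using Ko n0 by (simp add: R_def)
    have step: "Ph t \<le> Ph (Suc t) + lyap a x0 * prob (D t) + lyap a (2 * n) * prob (U t) + K5 / Kw * n powr (- (\<delta> / 2)) * W t"
      if tt: "t0 \<le> t" for t
    proof -
      have t: "1 \<le> t" using tt t0 by simp
      have Bx: "B t \<inter> {\<omega> \<in> space M. X t \<omega> = x} \<in> sets (F t)" "B t \<inter> {\<omega> \<in> space M. X t \<omega> = x} \<subseteq> {\<omega> \<in> space M. X t \<omega> = x}" for x
        using BF[of t] X_eq_F[OF t order_refl] by auto
      have Bemp: "B t \<inter> {\<omega> \<in> space M. X t \<omega> = x} = {}" if "x < x0" for x
        using Bx0[of t] that by auto
      let ?g = "\<lambda>\<omega>. - lyap a (X (t + 1) \<omega>)"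
      have li: "integrable M (\<lambda>\<omega>. indicator (B t \<inter> {\<omega> \<in> space M. X t \<omega> = x}) \<omega> * ?g \<omega>)" for x
        using lyap_local_integrable[OF t Bx, where b = a] by simp
      have ll: "(\<integral>\<omega>. indicator (B t \<inter> {\<omega> \<in> space M. X t \<omega> = x}) \<omega> * ?g \<omega> \<partial>M) \<le> - lyap a x * prob (B t \<inter> {\<omega> \<in> space M. X t \<omega> = x})" for x
      proof (cases "x < x0")
        case True then show ?thesis by (simp add: Bemp)
      next
        case False
        then have "x0 \<le> x" by simp
        from sub[rule_format, OF this t Bx] show ?thesis by simp
      qed
      have ig: "integrable M (\<lambda>\<omega>. indicator (B t) \<omega> * ?g \<omega>)"
        by (rule local_to_global_le(1)[OF t BF Bl li ll])
      have "(\<integral>\<omega>. indicator (B t) \<omega> * ?g \<omega> \<partial>M) \<le> (\<integral>\<omega>. indicator (B t) \<omega> * (- lyap a (X t \<omega>)) \<partial>M)"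
        by (rule local_to_global_le(3)[OF t BF Bl li ll])
      then have s1: "Ph t \<le> (\<integral>\<omega>. indicator (B t) \<omega> * lyap a (X (t + 1) \<omega>) \<partial>M)" unfolding Ph_def by simp
      have ig': "integrable M (\<lambda>\<omega>. indicator (B t) \<omega> * lyap a (X (t + 1) \<omega>))" using ig by simp
      let ?q = "\<lambda>\<omega>. \<bar>X (t + 1) \<omega> - X t \<omega>\<bar> powr p"
      note lq = jump_moment[OF t Bx]
      have iq: "integrable M (\<lambda>\<omega>. indicator (B t) \<omega> * ?q \<omega>)"
        by (rule local_to_global_le(1)[OF t BF Bl lq])
      have s3: "(\<integral>\<omega>. indicator (B t) \<omega> * ?q \<omega> \<partial>M) \<le> (\<integral>\<omega>. indicator (B t) \<omega> * (C * (1 + X t \<omega>) powr (p - 2 - \<delta>)) \<partial>M)"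
        by (rule local_to_global_le(3)[OF t BF Bl lq])
      have i1: "integrable M (\<lambda>\<omega>. indicator (B (Suc t)) \<omega> * lyap a (X (Suc t) \<omega>))"
        by (rule local_fun_integrable[OF _ BF Bl]) simp
      have i2: "integrable M (\<lambda>\<omega>. lyap a x0 * indicator (D t) \<omega>)" and i3: "integrable M (\<lambda>\<omega>. lyap a (2 * n) * indicator (U t) \<omega>)"
        using DM UM by (auto intro!: integrable_mult_right integrable_real_indicator simp: emeasure_eq_measure)
      have i4: "integrable M (\<lambda>\<omega>. R * (indicator (B t) \<omega> * ?q \<omega>))" using iq by (rule integrable_mult_right)
      have "(\<integral>\<omega>. indicator (B t) \<omega> * lyap a (X (t + 1) \<omega>) \<partial>M)
        \<le> (\<integral>\<omega>. indicator (B (Suc t)) \<omega> * lyap a (X (Suc t) \<omega>) + lyap a x0 * indicator (D t) \<omega> + lyap a (2 * n) * indicator (U t) \<omega>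
            + R * (indicator (B t) \<omega> * ?q \<omega>) \<partial>M)"
      proof (rule integral_mono[OF ig'])
        show "integrable M (\<lambda>\<omega>. indicator (B (Suc t)) \<omega> * lyap a (X (Suc t) \<omega>) + lyap a x0 * indicator (D t) \<omega> + lyap a (2 * n) * indicator (U t) \<omega>
            + R * (indicator (B t) \<omega> * ?q \<omega>))"
          by (intro Bochner_Integration.integrable_add i1 i2 i3 i4)
        fix \<omega> assume w: "\<omega> \<in> space M"
        have nn: "0 \<le> R * ?q \<omega>" "0 \<le> lyap a (X (Suc t) \<omega>)" "0 \<le> lyap a x0" "0 \<le> lyap a (2 * n)"
          using R lyap_pos by (auto simp: less_imp_le)
        show "indicator (B t) \<omega> * lyap a (X (t + 1) \<omega>) \<le> indicator (B (Suc t)) \<omega> * lyap a (X (Suc t) \<omega>) + lyap a x0 * indicator (D t) \<omega> + lyap a (2 * n) * indicator (U t) \<omega>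
            + R * (indicator (B t) \<omega> * ?q \<omega>)"
        proof (cases "\<omega> \<in> B t")
          case True
          consider "X (Suc t) \<omega> < x0" | "x0 \<le> X (Suc t) \<omega>" "X (Suc t) \<omega> < n" | "n \<le> X (Suc t) \<omega>" by linarith
          then show ?thesis
          proof cases
            case 1
            then have "\<omega> \<in> D t" "\<omega> \<notin> U t" "\<omega> \<notin> B (Suc t)" using True w tt yx0 ny BSuc[OF tt] by (auto simp: D_def U_def)
            moreover have "lyap a (X (Suc t) \<omega>) \<le> lyap a x0" using 1 by (intro lfm) simp
            ultimately show ?thesis using True nn by simp
          next
            case 2
            then have "\<omega> \<notin> D t" "\<omega> \<notin> U t" "\<omega> \<in> B (Suc t)" using True w tt BSuc[OF tt] by (auto simp: D_def U_def)
            then show ?thesis using True nn by simp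
          next
            case 3
            then have "\<omega> \<notin> D t" "\<omega> \<in> U t" "\<omega> \<notin> B (Suc t)" using True w tt yx0 ny BSuc[OF tt] by (auto simp: D_def U_def)
            moreover have "lyap a (X (Suc t) \<omega>) \<le> lyap a (2 * n) + R * \<bar>X (Suc t) \<omega> - X t \<omega>\<bar> powr p"
              unfolding R_def using Bl[of t] True 3 ne X_nonneg[OF t w] by (intro over[rule_format]) auto
            ultimately show ?thesis using True by simp
          qed
        next
          case False
          then have "\<omega> \<notin> D t" "\<omega> \<notin> U t" "\<omega> \<notin> B (Suc t)" using BSuc[OF tt] by (auto simp: D_def U_def)
          then show ?thesis using False by simp
        qed
      qed
      also have "\<dots> = Ph (Suc t) + lyap a x0 * prob (D t) + lyap a (2 * n) * prob (U t) + R * (\<integral>\<omega>. indicator (B t) \<omega> * ?q \<omega> \<partial>M)"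
        unfolding Bochner_Integration.integral_add[OF Bochner_Integration.integrable_add[OF Bochner_Integration.integrable_add[OF i1 i2] i3] i4]
          Bochner_Integration.integral_add[OF Bochner_Integration.integrable_add[OF i1 i2] i3] Bochner_Integration.integral_add[OF i1 i2]
          Ph_def using DM UM by simp
      finally have s2: "(\<integral>\<omega>. indicator (B t) \<omega> * lyap a (X (t + 1) \<omega>) \<partial>M)
         \<le> Ph (Suc t) + lyap a x0 * prob (D t) + lyap a (2 * n) * prob (U t) + R * (\<integral>\<omega>. indicator (B t) \<omega> * ?q \<omega> \<partial>M)" .
      define z where "z = n powr (p - 1 - r - \<delta> + \<delta> / 4)"
      have "(\<integral>\<omega>. indicator (B t) \<omega> * (C * (1 + X t \<omega>) powr (p - 2 - \<delta>)) \<partial>M) \<le> (\<integral>\<omega>. C * Km * z * (indicator (B t) \<omega> * lyap_rate (- a) (X t \<omega>)) \<partial>M)"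
      proof (rule integral_mono)
        show "integrable M (\<lambda>\<omega>. indicator (B t) \<omega> * (C * (1 + X t \<omega>) powr (p - 2 - \<delta>)))"
          by (rule local_fun_integrable[OF t BF Bl])
        show "integrable M (\<lambda>\<omega>. C * Km * z * (indicator (B t) \<omega> * lyap_rate (- a) (X t \<omega>)))"
          by (intro integrable_mult_right local_fun_integrable[OF t BF Bl])
        fix \<omega> assume "\<omega> \<in> space M"
        show "indicator (B t) \<omega> * (C * (1 + X t \<omega>) powr (p - 2 - \<delta>)) \<le> C * Km * z * (indicator (B t) \<omega> * lyap_rate (- a) (X t \<omega>))"
        proof (cases "\<omega> \<in> B t")
          case True
          then have "exp 1 \<le> X t \<omega>" "X t \<omega> < n" using Bl[of t] Bx0[of t] x0e by auto
          from mom[rule_format, OF this] have "C * (1 + X t \<omega>) powr (p - 2 - \<delta>) \<le> C * (Km * z * lyap_rate (- a) (X t \<omega>))"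
            unfolding z_def using C_pos by (intro mult_left_mono) auto
          then show ?thesis using True by (simp add: mult.assoc)
        qed simp
      qed
      then have s4: "(\<integral>\<omega>. indicator (B t) \<omega> * (C * (1 + X t \<omega>) powr (p - 2 - \<delta>)) \<partial>M) \<le> C * Km * z * W t"
        unfolding W_def by simp
      have "R * (\<integral>\<omega>. indicator (B t) \<omega> * ?q \<omega> \<partial>M) \<le> R * (C * Km * z * W t)"
        using s3 s4 R by (intro mult_left_mono) auto
      also have "\<dots> = Ko * (C * Km) * (n powr (1 + r + \<delta> / 4 - p) * z) * W t" by (simp add: R_def mult_ac)
      also have "n powr (1 + r + \<delta> / 4 - p) * z = n powr (- (\<delta> / 2))"
        unfolding z_def by (simp flip: powr_add)
      also have "Ko * (C * Km) = K5 / Kw" using Kw by (simp add: K5_def)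
      finally show ?thesis using s1 s2 by linarith
    qed
    have DB: "prob (D t) \<le> prob (B t) - prob (B (Suc t))" if tt: "t0 \<le> t" for t
    proof -
      have "D t \<subseteq> B t - B (Suc t)" using BSuc[OF tt] by (auto simp: D_def)
      then have "prob (D t) \<le> prob (B t - B (Suc t))"
        using BM[of t] BM[of "Suc t"] tt t0 by (intro finite_measure_mono) auto
      also have "\<dots> = prob (B t) - prob (B (Suc t))"
        using BM[of t] BM[of "Suc t"] tt t0 BSuc[OF tt] by (intro finite_measure_Diff) auto
      finally show ?thesis .
    qed
    define k5 where "k5 = K5 / Kw * n powr (- (\<delta> / 2))"
    have k5: "0 \<le> k5" using K5 Kw by (simp add: k5_def)
    have sumstep: "lyap a y * P \<le> Ph (t0 + J) + lyap a x0 * (P - prob (B (t0 + J)))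
        + lyap a (2 * n) * (\<Sum>j<J. prob (U (t0 + j))) + k5 * (\<Sum>j<J. W (t0 + j))" for J
    proof (induction J)
      case 0
      have "Ph t0 = (\<integral>\<omega>. lyap a y * indicator A0 \<omega> \<partial>M)"
        unfolding Ph_def Bt0 by (rule Bochner_Integration.integral_cong) (auto simp: A0_def indicator_def)
      also have "\<dots> = lyap a y * P" using BM[OF t0] unfolding Bt0 P_def by simp
      finally show ?case by (simp add: Bt0 P_def)
    next
      case (Suc J)
      have "lyap a x0 * prob (D (t0 + J)) \<le> lyap a x0 * (prob (B (t0 + J)) - prob (B (Suc (t0 + J))))"
        using DB[of "t0 + J"] lyap_pos[of a x0] by (intro mult_left_mono) auto
      with step[of "t0 + J"] Suc show ?case unfolding k5_def[symmetric] by (simp add: algebra_simps)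
    qed
    have Wle: "(\<Sum>j<J. W (t0 + j)) \<le> Kw" for J
    proof -
      have Wn: "0 \<le> W t" for t unfolding W_def using lyap_rate_pos[of "- a"] by (intro integral_nonneg_AE AE_I2) (simp add: less_imp_le)
      have "(\<Sum>j<J. W (t0 + j)) = (\<Sum>t=t0..<t0 + J. W t)"
        by (rule sum.reindex_bij_witness[of _ "\<lambda>t. t - t0" "\<lambda>j. t0 + j"]) auto
      also have "\<dots> \<le> (\<Sum>t=1..t0 + J. W t)" using t0 Wn by (intro sum_mono2) auto
      also have "\<dots> \<le> Kw" unfolding W_def
        by (rule wsum[rule_format]) (use Bal local_fun_integrable[OF _ BF Bl] in auto)
      finally show ?thesis .
    qed
    have Phle: "Ph t \<le> lyap a n * prob (alive t)" if t: "1 \<le> t" for t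
    proof -
      have "Ph t \<le> (\<integral>\<omega>. lyap a n * indicator (alive t) \<omega> \<partial>M)" unfolding Ph_def
      proof (rule integral_mono)
        show "integrable M (\<lambda>\<omega>. indicator (B t) \<omega> * lyap a (X t \<omega>))" by (rule local_fun_integrable[OF t BF Bl])
        show "integrable M (\<lambda>\<omega>. lyap a n * indicator (alive t) \<omega>)"
          using alive_M by (intro integrable_mult_right integrable_real_indicator) (auto simp: emeasure_eq_measure)
        fix \<omega> assume "\<omega> \<in> space M"
        show "indicator (B t) \<omega> * lyap a (X t \<omega>) \<le> lyap a n * indicator (alive t) \<omega>"
        proof (cases "\<omega> \<in> B t")
          case True
          then have "\<omega> \<in> alive t" "X t \<omega> \<le> n" using Bal[of t] Bl[of t] by auto
          then show ?thesis using True lfm[of "X t \<omega>" n] by simp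
        next
          case False then show ?thesis using lyap_pos[of a n] by (simp add: less_imp_le)
        qed
      qed
      also have "\<dots> = lyap a n * prob (alive t)" using alive_M by simp
      finally show ?thesis .
    qed
    have "(\<lambda>t. lyap a n * prob (alive t)) \<longlonglongrightarrow> lyap a n * 0" by (intro tendsto_mult tendsto_const prob_alive_tendsto)
    then have "eventually (\<lambda>t. lyap a n * prob (alive t) < P * lyap a y / 8) sequentially"
      using P lyap_pos[of a y] by (intro order_tendstoD(2)[where y = "lyap a n * 0"]) auto
    then obtain J where J: "\<forall>t\<ge>J. lyap a n * prob (alive t) < P * lyap a y / 8" by (auto simp: eventually_sequentially)
    have h1: "Ph (t0 + J) \<le> P * lyap a y / 8" using Phle[of "t0 + J"] J[rule_format, of "t0 + J"] t0 by auto
    have h2: "lyap a x0 * (P - prob (B (t0 + J))) \<le> P * lyap a y / 2"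
    proof -
      have "lyap a x0 * (P - prob (B (t0 + J))) \<le> lyap a x0 * P" using lyap_pos[of a x0] by (intro mult_left_mono) auto
      also have "\<dots> \<le> lyap a y / 2 * P" using lfy P by (intro mult_right_mono) auto
      finally show ?thesis by (simp add: mult.commute)
    qed
    have h3: "k5 * (\<Sum>j<J. W (t0 + j)) \<le> P * lyap a y / 8"
    proof -
      have "k5 * (\<Sum>j<J. W (t0 + j)) \<le> k5 * Kw" using Wle k5 by (rule mult_left_mono)
      also have "\<dots> = K5 * n powr (- (\<delta> / 2))" using Kw by (simp add: k5_def)
      finally show ?thesis using n2n by linarith
    qed
    have "c1 \<le> lyap a (2 * n) * (\<Sum>j<J. prob (U (t0 + j)))"
      using sumstep[of J] h1 h2 h3 unfolding c1_def by (simp add: mult.commute[of "lyap a y" P])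
    then have "c1 / lyap a (2 * n) \<le> (\<Sum>j<J. prob (U (t0 + j)))"
      using lyap_pos[of a "2 * n"] by (simp add: field_simps)
    also have "\<dots> = (\<Sum>t=t0..<t0 + J. prob (U t))"
      by (rule sum.reindex_bij_witness[of _ "\<lambda>t. t - t0" "\<lambda>j. t0 + j"]) auto
    also have "\<dots> \<le> (\<Sum>t=1..t0 + J. prob (U t))" using t0 by (intro sum_mono2) auto
    finally have f: "c1 / lyap a (2 * n) \<le> (\<Sum>t=1..t0 + J. prob (U t))" .
    have nd: "U i \<inter> U j = {}" if "i < j" for i j
    proof (rule ccontr)
      assume "U i \<inter> U j \<noteq> {}"
      then obtain \<omega> where w: "\<omega> \<in> U i" "\<omega> \<in> U j" by blast
      then have "t0 \<le> i" "n \<le> X (Suc i) \<omega>" by (auto simp: U_def B_def split: if_splits)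
      moreover have "X (Suc i) \<omega> < n" using w(2) that \<open>t0 \<le> i\<close> by (auto simp: U_def B_def split: if_splits)
      ultimately show False by simp
    qed
    have "disjoint_family_on U {1..t0 + J}"
      unfolding disjoint_family_on_def using nd by (metis inf_commute linorder_neqE_nat)
    moreover have "\<forall>t\<in>{1..t0 + J}. U t \<in> sets (F (t + 1)) \<and> U t \<subseteq> alive t \<and> U t \<subseteq> {\<omega> \<in> space M. n \<le> X (t + 1) \<omega>}"
    proof (intro ballI conjI)
      fix t
      show "U t \<in> sets (F (t + 1))" by (rule UF)
      show "U t \<subseteq> alive t" using Bal[of t] by (auto simp: U_def)
      show "U t \<subseteq> {\<omega> \<in> space M. n \<le> X (t + 1) \<omega>}" by (auto simp: U_def)
    qed
    ultimately show ?thesis using f by (intro exI[of _ "t0 + J"] exI[of _ U] conjI)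
  qed
  show ?thesis
    by (rule exI[of _ c1], rule conjI[OF c1], rule exI[of _ n1], intro allI impI, rule main)
qed

lemma local_to_global_bounded:
  assumes t: "1 \<le> t" and B: "B \<in> sets (F t)"
    and g: "g \<in> borel_measurable M" "\<And>\<omega>. \<omega> \<in> space M \<Longrightarrow> \<bar>g \<omega>\<bar> \<le> K"
    and h: "h \<in> borel_measurable borel" "\<And>x. \<bar>h x\<bar> \<le> K"
    and ll: "\<And>x. (\<integral>\<omega>. indicator (B \<inter> {\<omega> \<in> space M. X t \<omega> = x}) \<omega> * g \<omega> \<partial>M)
               \<le> h x * prob (B \<inter> {\<omega> \<in> space M. X t \<omega> = x})"
  shows "(\<integral>\<omega>. indicator B \<omega> * g \<omega> \<partial>M) \<le> (\<integral>\<omega>. indicator B \<omega> * (h (X t \<omega>) :: real) \<partial>M)"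
proof -
  have BM [measurable]: "B \<in> sets M" using sets_F_M[OF t B] .
  have [measurable]: "X t \<in> borel_measurable M" "g \<in> borel_measurable M" "h \<in> borel_measurable borel" using t g h by auto
  define E where "E = (\<lambda>N::nat. B \<inter> {\<omega> \<in> space M. X t \<omega> < real N})"
  have EF: "E N \<in> sets (F t)" for N unfolding E_def using B t by (intro sets.Int X_less_F) auto
  have EM [measurable]: "E N \<in> sets M" for N using sets_F_M[OF t EF] .
  have bint: "integrable M (\<lambda>\<omega>. indicator A \<omega> * u \<omega>)" if [measurable]: "A \<in> sets M" "u \<in> borel_measurable M" and u: "\<And>\<omega>. \<omega> \<in> space M \<Longrightarrow> \<bar>u \<omega>\<bar> \<le> K" for A and u :: "'a \<Rightarrow> real"
  proof (rule Bochner_Integration.integrable_bound[of M "\<lambda>_. K"])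
    show "AE \<omega> in M. norm (indicator A \<omega> * u \<omega>) \<le> norm K"
      by (rule AE_I2) (use u in \<open>fastforce simp: indicator_def\<close>)
  qed auto
  have le: "(\<integral>\<omega>. indicator (E N) \<omega> * g \<omega> \<partial>M) \<le> (\<integral>\<omega>. indicator (E N) \<omega> * h (X t \<omega>) \<partial>M)" for N
  proof (rule local_to_global_le(3)[OF t EF])
    show "E N \<subseteq> {\<omega> \<in> space M. X t \<omega> < real N}" by (auto simp: E_def)
    fix x assume x: "x < real N"
    have eq: "E N \<inter> {\<omega> \<in> space M. X t \<omega> = x} = B \<inter> {\<omega> \<in> space M. X t \<omega> = x}" using x by (auto simp: E_def)
    show "integrable M (\<lambda>\<omega>. indicator (E N \<inter> {\<omega> \<in> space M. X t \<omega> = x}) \<omega> * g \<omega>)"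
      using sets_F_M[OF t sets.Int[OF EF X_eq_F[OF t order_refl]]] by (intro bint g)
    show "(\<integral>\<omega>. indicator (E N \<inter> {\<omega> \<in> space M. X t \<omega> = x}) \<omega> * g \<omega> \<partial>M) \<le> h x * prob (E N \<inter> {\<omega> \<in> space M. X t \<omega> = x})"
      unfolding eq by (rule ll)
  qed
  have lim: "(\<lambda>N. \<integral>\<omega>. indicator (E N) \<omega> * u \<omega> \<partial>M) \<longlonglongrightarrow> (\<integral>\<omega>. indicator B \<omega> * u \<omega> \<partial>M)"
    if [measurable]: "u \<in> borel_measurable M" and u: "\<And>\<omega>. \<omega> \<in> space M \<Longrightarrow> \<bar>u \<omega>\<bar> \<le> K" for u :: "'a \<Rightarrow> real"
  proof (rule integral_dominated_convergence[where w = "\<lambda>_. K"])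
    show "AE \<omega> in M. (\<lambda>N. indicator (E N) \<omega> * u \<omega>) \<longlonglongrightarrow> indicator B \<omega> * u \<omega>"
    proof (rule AE_I2)
      fix \<omega> assume w: "\<omega> \<in> space M"
      obtain N0 :: nat where N0: "X t \<omega> < real N0" using reals_Archimedean2 by blast
      have "indicator (E N) \<omega> * u \<omega> = indicator B \<omega> * u \<omega>" if "N0 \<le> N" for N
      proof -
        have "X t \<omega> < real N" using N0 that by linarith
        then show ?thesis using w by (simp add: E_def indicator_def)
      qed
      then show "(\<lambda>N. indicator (E N) \<omega> * u \<omega>) \<longlonglongrightarrow> indicator B \<omega> * u \<omega>"
        by (intro tendsto_eventually eventually_sequentiallyI)
    qed
    show "AE \<omega> in M. norm (indicator (E N) \<omega> * u \<omega>) \<le> K" for N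
      by (rule AE_I2) (use u in \<open>fastforce simp: indicator_def\<close>)
  qed auto
  have l1: "(\<lambda>N. \<integral>\<omega>. indicator (E N) \<omega> * g \<omega> \<partial>M) \<longlonglongrightarrow> (\<integral>\<omega>. indicator B \<omega> * g \<omega> \<partial>M)"
    by (rule lim[OF g])
  have l2: "(\<lambda>N. \<integral>\<omega>. indicator (E N) \<omega> * h (X t \<omega>) \<partial>M) \<longlonglongrightarrow> (\<integral>\<omega>. indicator B \<omega> * h (X t \<omega>) \<partial>M)"
    by (rule lim[OF _ h(2)]) measurable
  show ?thesis
    by (rule LIMSEQ_le[OF l1 l2]) (intro exI allI impI, rule le)
qed

text \<open>The function \<open>((n - x)\<^sup>+)\<^sup>2 / n\<^sup>2\<close> of the process has drift \<open>O(1 / n\<^sup>2)\<close> above \<open>n / 2\<close>, vanishes above \<open>n\<close>, and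
  is at least \<open>1 / 4\<close> below \<open>n / 2\<close>.\<close>

lemma stay_high:
  "\<exists>\<epsilon>>0. \<exists>n2>0. \<forall>n\<ge>n2. \<forall>s\<ge>1. \<forall>B\<in>sets (F s). \<forall>k::nat. B \<subseteq> {\<omega> \<in> space M. n \<le> X s \<omega>} \<longrightarrow> real k \<le> \<epsilon> * n\<^sup>2 \<longrightarrow>
     prob B / 2 \<le> prob (B \<inter> {\<omega> \<in> space M. \<forall>u\<in>{s..s + k}. n / 2 \<le> X u \<omega>})"
proof -
  obtain x1 where x1: "\<And>t x B. x1 \<le> x \<Longrightarrow> 1 \<le> t \<Longrightarrow> B \<in> sets (F t) \<Longrightarrow> B \<subseteq> {\<omega> \<in> space M. X t \<omega> = x} \<Longrightarrow>
      \<bar>(\<integral>\<omega>. indicator B \<omega> * (X (t + 1) \<omega> - X t \<omega>) \<partial>M) - c / x * prob B\<bar> \<le> 1 / (x * ln x) * prob B"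
    by (rule local_mean[of 1]) auto
  obtain x2 where x2: "\<And>t x B. x2 \<le> x \<Longrightarrow> 1 \<le> t \<Longrightarrow> B \<in> sets (F t) \<Longrightarrow> B \<subseteq> {\<omega> \<in> space M. X t \<omega> = x} \<Longrightarrow>
      \<bar>(\<integral>\<omega>. indicator B \<omega> * (X (t + 1) \<omega> - X t \<omega>)\<^sup>2 \<partial>M) - s2 * prob B\<bar> \<le> 1 / ln x * prob B"
    by (rule local_var[of 1]) auto
  define xm where "xm = max (exp 1) (max x1 x2)"
  define K where "K = 2 * (\<bar>c\<bar> + 1) + (s2 + 1)"
  have K: "0 < K" using s2_pos by (simp add: K_def)
  define \<epsilon> where "\<epsilon> = 1 / (8 * K)"
  have \<epsilon>: "0 < \<epsilon>" using K by (simp add: \<epsilon>_def)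
  have n2: "0 < 2 * xm" unfolding xm_def using exp_gt_zero[of "1::real"] by linarith
  have main: "prob B / 2 \<le> prob (B \<inter> {\<omega> \<in> space M. \<forall>u\<in>{s..s + k}. n / 2 \<le> X u \<omega>})"
    if n: "2 * xm \<le> n" and s: "1 \<le> s" and B: "B \<in> sets (F s)" "B \<subseteq> {\<omega> \<in> space M. n \<le> X s \<omega>}" and k: "real k \<le> \<epsilon> * n\<^sup>2" for n s B k
  proof -
    have n0: "0 < n" using n n2 by linarith
    define Q where "Q = (\<lambda>j. B \<inter> {\<omega> \<in> space M. \<forall>u\<in>{s..s + j}. n / 2 \<le> X u \<omega>})"
    define h where "h = (\<lambda>z::real. if z < 0 then 1 else (max 0 (n - z))\<^sup>2 / n\<^sup>2)"
    have h01: "0 \<le> h z" "h z \<le> 1" for z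
    proof -
      show "0 \<le> h z" by (simp add: h_def)
      have "(max 0 (n - z))\<^sup>2 \<le> n\<^sup>2" if "0 \<le> z" using that n0 by (intro power_mono) auto
      then show "h z \<le> 1" using n0 by (simp add: h_def)
    qed
    have hm [measurable]: "h \<in> borel_measurable borel" unfolding h_def by measurable
    have BM: "B \<in> sets M" using sets_F_M[OF s B(1)] .
    have QF: "Q j \<in> sets (F (s + j))" for j
    proof -
      have "B \<in> sets (F (s + j))" using B(1) F_mono[of s "s + j"] by auto
      moreover have "{\<omega> \<in> space M. \<forall>u\<in>{s..s + j}. n / 2 \<le> X u \<omega>} \<in> sets (F (s + j))"
        using s by (intro pred_F_bounded_all X_ge_F) auto
      ultimately show ?thesis by (simp add: Q_def)
    qed
    have QM [measurable]: "Q j \<in> sets M" for j using sets_F_M[OF _ QF[of j]] s by simp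
    have Q0: "Q 0 = B" using B n0 by (auto simp: Q_def)
    have QSuc: "Q (Suc j) = Q j \<inter> {\<omega> \<in> space M. n / 2 \<le> X (s + Suc j) \<omega>}" for j
      unfolding Q_def by (auto simp: le_Suc_eq)
    have [measurable]: "X (s + j) \<in> borel_measurable M" for j using s by simp
    have hi: "integrable M (\<lambda>\<omega>. indicator (Q j) \<omega> * h (X (s + i) \<omega>))" for i j
    proof (rule Bochner_Integration.integrable_bound[of M "\<lambda>_. 1"])
      show "AE \<omega> in M. norm (indicator (Q j) \<omega> * h (X (s + i) \<omega>)) \<le> norm (1::real)"
        using h01 by (intro AE_I2) (auto simp: indicator_def)
    qed auto
    define H where "H = (\<lambda>j. \<integral>\<omega>. indicator (Q j) \<omega> * h (X (s + j) \<omega>) \<partial>M)"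
    have local: "(\<integral>\<omega>. indicator E \<omega> * h (X (t + 1) \<omega>) \<partial>M) \<le> (h x + K / n\<^sup>2) * prob E"
      if t: "1 \<le> t" and E: "E \<in> sets (F t)" "E \<subseteq> {\<omega> \<in> space M. X t \<omega> = x}" and x: "n / 2 \<le> x" for t E x
    proof -
      have xm: "xm \<le> x" using x n by linarith
      have xe: "exp 1 \<le> x" and xx: "x1 \<le> x" "x2 \<le> x" using xm by (auto simp: xm_def)
      have x0: "0 < x" using xe by (rule less_le_trans[OF exp_gt_zero])
      have lx: "1 \<le> ln x" using xe x0 by (metis ln_exp ln_le_cancel_iff exp_gt_zero)
      have EM: "E \<in> sets M" using sets_F_M[OF t E(1)] .
      define d where "d = - 2 * max 0 (n - x) / n\<^sup>2"
      have "\<bar>d\<bar> = 2 * max 0 (n - x) / n\<^sup>2" by (simp add: d_def)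
      also have "\<dots> \<le> 2 * (n / 2) / n\<^sup>2" using x n0 by (intro divide_right_mono mult_left_mono) (auto simp: max_def)
      also have "\<dots> = 1 / n" using n0 by (simp add: power2_eq_square)
      finally have d: "\<bar>d\<bar> \<le> 1 / n" .
      have hq: "h y \<le> h x + d * (y - x) + (y - x)\<^sup>2 / n\<^sup>2" if "0 \<le> y" for y
      proof -
        have "(max 0 v)\<^sup>2 \<le> (max 0 u)\<^sup>2 + 2 * max 0 u * (v - u) + (v - u)\<^sup>2" for u v :: real
        proof -
          have "(max 0 u)\<^sup>2 + 2 * max 0 u * (v - u) + (v - u)\<^sup>2 = (if 0 \<le> u then v\<^sup>2 else (v - u)\<^sup>2)"
            by (simp add: max_def power2_eq_square algebra_simps)
          moreover have "(max 0 v)\<^sup>2 \<le> v\<^sup>2" by (simp add: max_def)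
          moreover have "(max 0 v)\<^sup>2 \<le> (v - u)\<^sup>2" if "u < 0"
            using that by (cases "0 \<le> v") (auto simp: max_def intro!: power_mono)
          ultimately show ?thesis by auto
        qed
        from this[of "n - y" "n - x"] have "(max 0 (n - y))\<^sup>2 \<le> (max 0 (n - x))\<^sup>2 + 2 * max 0 (n - x) * (x - y) + (x - y)\<^sup>2" by simp
        then have "(max 0 (n - y))\<^sup>2 / n\<^sup>2 \<le> ((max 0 (n - x))\<^sup>2 + 2 * max 0 (n - x) * (x - y) + (x - y)\<^sup>2) / n\<^sup>2"
          by (rule divide_right_mono) simp
        also have "\<dots> = (max 0 (n - x))\<^sup>2 / n\<^sup>2 + d * (y - x) + (y - x)\<^sup>2 / n\<^sup>2"
        proof -
          have "2 * max 0 (n - x) * (x - y) / n\<^sup>2 = d * (y - x)" unfolding d_def by (simp add: algebra_simps diff_divide_distrib)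
          then show ?thesis by (simp add: add_divide_distrib power2_commute[of x y])
        qed
        finally show ?thesis using that x0 by (simp add: h_def)
      qed
      define I1 where "I1 = (\<integral>\<omega>. indicator E \<omega> * (X (t + 1) \<omega> - X t \<omega>) \<partial>M)"
      define I2 where "I2 = (\<integral>\<omega>. indicator E \<omega> * (X (t + 1) \<omega> - X t \<omega>)\<^sup>2 \<partial>M)"
      note i1 = local_jump_integrable(1)[OF t E] and i2 = local_jump_integrable(2)[OF t E]
      have i0: "integrable M (\<lambda>\<omega>. h x * indicator E \<omega>)"
        using EM by (intro integrable_mult_right integrable_real_indicator) (auto simp: emeasure_eq_measure)
      have [measurable]: "X (t + 1) \<in> borel_measurable M" "E \<in> sets M" using t EM by auto
      have "(\<integral>\<omega>. indicator E \<omega> * h (X (t + 1) \<omega>) \<partial>M)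
        \<le> (\<integral>\<omega>. h x * indicator E \<omega> + d * (indicator E \<omega> * (X (t + 1) \<omega> - X t \<omega>)) + (indicator E \<omega> * (X (t + 1) \<omega> - X t \<omega>)\<^sup>2) / n\<^sup>2 \<partial>M)"
      proof (rule integral_mono)
        show "integrable M (\<lambda>\<omega>. indicator E \<omega> * h (X (t + 1) \<omega>))"
        proof (rule Bochner_Integration.integrable_bound[of M "\<lambda>_. 1"])
          show "AE \<omega> in M. norm (indicator E \<omega> * h (X (t + 1) \<omega>)) \<le> norm (1::real)"
            using h01 by (intro AE_I2) (auto simp: indicator_def)
        qed auto
        show "integrable M (\<lambda>\<omega>. h x * indicator E \<omega> + d * (indicator E \<omega> * (X (t + 1) \<omega> - X t \<omega>)) + (indicator E \<omega> * (X (t + 1) \<omega> - X t \<omega>)\<^sup>2) / n\<^sup>2)"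
          by (intro Bochner_Integration.integrable_add integrable_divide integrable_mult_right i0 i1 i2)
        fix \<omega> assume w: "\<omega> \<in> space M"
        show "indicator E \<omega> * h (X (t + 1) \<omega>) \<le> h x * indicator E \<omega> + d * (indicator E \<omega> * (X (t + 1) \<omega> - X t \<omega>)) + (indicator E \<omega> * (X (t + 1) \<omega> - X t \<omega>)\<^sup>2) / n\<^sup>2"
        proof (cases "\<omega> \<in> E")
          case True
          then have "X t \<omega> = x" using E(2) by auto
          then show ?thesis using True hq[of "X (t + 1) \<omega>"] X_nonneg[of "t + 1" \<omega>] w by simp
        qed simp
      qed
      also have "\<dots> = h x * prob E + d * I1 + I2 / n\<^sup>2"
        unfolding Bochner_Integration.integral_add[OF Bochner_Integration.integrable_add[OF i0 integrable_mult_right[OF i1]] integrable_divide[OF i2]]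
          Bochner_Integration.integral_add[OF i0 integrable_mult_right[OF i1]] I1_def I2_def using EM by simp
      also have "\<dots> \<le> h x * prob E + 2 * (\<bar>c\<bar> + 1) / n\<^sup>2 * prob E + (s2 + 1) / n\<^sup>2 * prob E"
      proof (intro add_mono order_refl)
        have tri: "\<bar>u\<bar> \<le> \<bar>v\<bar> + w" if "\<bar>u - v\<bar> \<le> w" for u v w :: real using that by linarith
        have xl: "n / 2 \<le> x * ln x"
        proof -
          have "x * 1 \<le> x * ln x" using lx x0 by (intro mult_left_mono) auto
          then show ?thesis using x by simp
        qed
        have "\<bar>c\<bar> / x \<le> \<bar>c\<bar> / (n / 2)" by (rule frac_le) (use n0 x in auto)
        moreover have "1 / (x * ln x) \<le> 1 / (n / 2)" by (rule frac_le) (use n0 xl in auto)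
        ultimately have fr: "\<bar>c\<bar> / x + 1 / (x * ln x) \<le> 2 * (\<bar>c\<bar> + 1) / n" by (simp add: add_divide_distrib mult.commute)
        have "\<bar>I1\<bar> \<le> \<bar>c / x * prob E\<bar> + 1 / (x * ln x) * prob E" unfolding I1_def by (rule tri) (rule x1[OF xx(1) t E])
        also have "\<dots> = (\<bar>c\<bar> / x + 1 / (x * ln x)) * prob E" using x0 by (simp add: abs_mult abs_divide distrib_right)
        also have "\<dots> \<le> 2 * (\<bar>c\<bar> + 1) / n * prob E" using fr by (rule mult_right_mono) simp
        finally have I1: "\<bar>I1\<bar> \<le> 2 * (\<bar>c\<bar> + 1) / n * prob E" .
        have "d * I1 \<le> \<bar>d\<bar> * \<bar>I1\<bar>" by (metis abs_ge_self abs_mult)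
        also have "\<dots> \<le> 1 / n * (2 * (\<bar>c\<bar> + 1) / n * prob E)" by (rule mult_mono[OF d I1]) (use n0 in auto)
        finally show "d * I1 \<le> 2 * (\<bar>c\<bar> + 1) / n\<^sup>2 * prob E" by (simp add: power2_eq_square)
        have "I2 \<le> s2 * prob E + 1 / ln x * prob E" using x2[OF xx(2) t E] unfolding I2_def by linarith
        also have "\<dots> \<le> s2 * prob E + 1 * prob E" using lx by (intro add_left_mono mult_right_mono) auto
        finally have "I2 \<le> (s2 + 1) * prob E" by (simp add: algebra_simps)
        then have "I2 / n\<^sup>2 \<le> (s2 + 1) * prob E / n\<^sup>2" by (rule divide_right_mono) simp
        then show "I2 / n\<^sup>2 \<le> (s2 + 1) / n\<^sup>2 * prob E" by simp
      qed
      also have "\<dots> = (h x + K / n\<^sup>2) * prob E" unfolding K_def by (simp add: algebra_simps add_divide_distrib)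
      finally show ?thesis .
    qed
    have step: "H (Suc j) + (prob (Q j) - prob (Q (Suc j))) / 4 \<le> H j + K / n\<^sup>2 * prob B" for j
    proof -
      have sj: "1 \<le> s + j" using s by simp
      have "(\<integral>\<omega>. indicator (Q j) \<omega> * h (X (s + j + 1) \<omega>) \<partial>M) \<le> (\<integral>\<omega>. indicator (Q j) \<omega> * (h (X (s + j) \<omega>) + K / n\<^sup>2) \<partial>M)"
      proof (rule local_to_global_bounded[OF sj QF, where K = "1 + K / n\<^sup>2"])
        show "(\<lambda>\<omega>. h (X (s + j + 1) \<omega>)) \<in> borel_measurable M" using s by measurable
        show "\<bar>h (X (s + j + 1) \<omega>)\<bar> \<le> 1 + K / n\<^sup>2" for \<omega> using h01[of "X (s + j + 1) \<omega>"] K by (simp add: add_increasing2)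
        show "(\<lambda>x. h x + K / n\<^sup>2) \<in> borel_measurable borel" by measurable
        show "\<bar>h x + K / n\<^sup>2\<bar> \<le> 1 + K / n\<^sup>2" for x using h01[of x] K by simp
        fix x
        have Ex: "Q j \<inter> {\<omega> \<in> space M. X (s + j) \<omega> = x} \<in> sets (F (s + j))"
          "Q j \<inter> {\<omega> \<in> space M. X (s + j) \<omega> = x} \<subseteq> {\<omega> \<in> space M. X (s + j) \<omega> = x}"
          using QF[of j] X_eq_F[OF sj order_refl] by auto
        show "(\<integral>\<omega>. indicator (Q j \<inter> {\<omega> \<in> space M. X (s + j) \<omega> = x}) \<omega> * h (X (s + j + 1) \<omega>) \<partial>M)
            \<le> (h x + K / n\<^sup>2) * prob (Q j \<inter> {\<omega> \<in> space M. X (s + j) \<omega> = x})"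
        proof (cases "n / 2 \<le> x")
          case True
          from local[OF sj Ex True] show ?thesis .
        next
          case False
          then have "Q j \<inter> {\<omega> \<in> space M. X (s + j) \<omega> = x} = {}" by (auto simp: Q_def)
          then show ?thesis by simp
        qed
      qed
      also have "\<dots> = (\<integral>\<omega>. indicator (Q j) \<omega> * h (X (s + j) \<omega>) + K / n\<^sup>2 * indicator (Q j) \<omega> \<partial>M)"
        by (rule Bochner_Integration.integral_cong) (auto simp: distrib_left mult.commute)
      also have "\<dots> = H j + K / n\<^sup>2 * prob (Q j)" unfolding H_def
        using hi[of j j] QM[of j]
        by (subst Bochner_Integration.integral_add) (auto intro!: integrable_mult_right integrable_real_indicator simp: emeasure_eq_measure)
      also have "\<dots> \<le> H j + K / n\<^sup>2 * prob B"
        using K BM by (intro add_left_mono mult_left_mono finite_measure_mono) (auto simp: Q_def)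
      finally have up: "(\<integral>\<omega>. indicator (Q j) \<omega> * h (X (s + Suc j) \<omega>) \<partial>M) \<le> H j + K / n\<^sup>2 * prob B" by simp
      have sub: "Q (Suc j) \<subseteq> Q j" using QSuc by auto
      have id: "integrable M (\<lambda>\<omega>. 1 / 4 * indicator (Q j - Q (Suc j)) \<omega> :: real)"
        using QM by (intro integrable_mult_right integrable_real_indicator) (auto simp: emeasure_eq_measure)
      have "H (Suc j) + (prob (Q j) - prob (Q (Suc j))) / 4
          = (\<integral>\<omega>. indicator (Q (Suc j)) \<omega> * h (X (s + Suc j) \<omega>) + 1 / 4 * indicator (Q j - Q (Suc j)) \<omega> \<partial>M)"
        unfolding Bochner_Integration.integral_add[OF hi id] H_def
        using finite_measure_Diff[OF QM QM sub] QM by simp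
      also have "\<dots> \<le> (\<integral>\<omega>. indicator (Q j) \<omega> * h (X (s + Suc j) \<omega>) \<partial>M)"
      proof (rule integral_mono[OF Bochner_Integration.integrable_add[OF hi id] hi])
        fix \<omega> assume w: "\<omega> \<in> space M"
        show "indicator (Q (Suc j)) \<omega> * h (X (s + Suc j) \<omega>) + 1 / 4 * indicator (Q j - Q (Suc j)) \<omega> \<le> indicator (Q j) \<omega> * h (X (s + Suc j) \<omega>)"
        proof (cases "\<omega> \<in> Q j - Q (Suc j)")
          case True
          then have lt: "X (s + Suc j) \<omega> < n / 2" using w unfolding QSuc by (simp add: not_le)
          have x0: "0 \<le> X (s + Suc j) \<omega>" by (rule X_nonneg[OF _ w]) simp
          have "(n / 2)\<^sup>2 \<le> (max 0 (n - X (s + Suc j) \<omega>))\<^sup>2" by (rule power_mono) (use lt n0 in linarith)+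
          then have "(n / 2)\<^sup>2 / n\<^sup>2 \<le> (max 0 (n - X (s + Suc j) \<omega>))\<^sup>2 / n\<^sup>2" by (rule divide_right_mono) simp
          moreover have "h (X (s + Suc j) \<omega>) = (max 0 (n - X (s + Suc j) \<omega>))\<^sup>2 / n\<^sup>2" unfolding h_def using x0 by (simp only: not_less[symmetric] if_False)
          moreover have "(n / 2)\<^sup>2 / n\<^sup>2 = 1 / 4" using n0 by (simp add: power_divide)
          ultimately have "1 / 4 \<le> h (X (s + Suc j) \<omega>)" by linarith
          then show ?thesis using True by simp
        next
          case False
          show ?thesis
          proof (cases "\<omega> \<in> Q j")
            case True
            then have "\<omega> \<in> Q (Suc j)" using False by blast
            then show ?thesis using True by simp
          next
            case notin: False
            then have "\<omega> \<notin> Q (Suc j)" using sub by blast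
            then show ?thesis using notin by simp
          qed
        qed
      qed
      finally show ?thesis using up by linarith
    qed
    have tot: "H j + (prob B - prob (Q j)) / 4 \<le> real j * (K / n\<^sup>2 * prob B)" for j
    proof (induction j)
      case 0
      have "H 0 = (\<integral>\<omega>. 0 \<partial>M)" unfolding H_def Q0
        by (rule Bochner_Integration.integral_cong) (use B(2) n0 in \<open>auto simp: indicator_def h_def\<close>)
      then show ?case by (simp add: Q0)
    next
      case (Suc j)
      have "real (Suc j) * z = real j * z + z" for z by (simp add: algebra_simps)
      then have "real (Suc j) * (K / n\<^sup>2 * prob B) = real j * (K / n\<^sup>2 * prob B) + K / n\<^sup>2 * prob B" .
      then show ?case using step[of j] Suc unfolding diff_divide_distrib by linarith
    qed
    have "0 \<le> H k" unfolding H_def using h01 by (intro integral_nonneg_AE AE_I2) simp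
    then have "(prob B - prob (Q k)) / 4 \<le> real k * (K / n\<^sup>2 * prob B)" using tot[of k] by linarith
    also have "\<dots> \<le> \<epsilon> * n\<^sup>2 * (K / n\<^sup>2 * prob B)" using k K by (intro mult_right_mono) auto
    also have "\<dots> = prob B / 8" using n0 K by (simp add: \<epsilon>_def)
    finally have "prob B / 2 \<le> prob (Q k)" by (simp add: field_simps)
    then show ?thesis unfolding Q_def .
  qed
  show ?thesis
    by (rule exI[of _ \<epsilon>], rule conjI[OF \<epsilon>], rule exI[of _ "2 * xm"], rule conjI[OF n2], intro allI ballI impI, rule main, assumption+)
qed

lemma esum_lower_tail:
  assumes a: "0 < a" "a \<le> 1 + r" and \<alpha>: "0 \<le> \<alpha>"
  shows "\<exists>c2>0. \<exists>d>0. \<exists>n3>0. \<forall>n\<ge>n3. c2 / lyap a (2 * n) \<le> prob {\<omega> \<in> space M. d * n powr (\<alpha> + 2) \<le> esum (\<lambda>x. rpow x \<alpha>) 0 \<omega>}"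
proof -
  obtain c1 n1 where c1: "0 < c1" and up: "\<forall>n\<ge>n1. \<exists>T U. (\<forall>t\<in>{1..T}. U t \<in> sets (F (t + 1)) \<and> U t \<subseteq> alive t \<and> U t \<subseteq> {\<omega> \<in> space M. n \<le> X (t + 1) \<omega>})
     \<and> disjoint_family_on U {1..T} \<and> c1 / lyap a (2 * n) \<le> (\<Sum>t=1..T. prob (U t))"
    using up_crossing_lower[OF a] by (elim exE conjE)
  obtain \<epsilon> n2 where \<epsilon>: "0 < \<epsilon>" "0 < n2" and stay: "\<forall>n\<ge>n2. \<forall>s\<ge>1. \<forall>B\<in>sets (F s). \<forall>k::nat. B \<subseteq> {\<omega> \<in> space M. n \<le> X s \<omega>} \<longrightarrow> real k \<le> \<epsilon> * n\<^sup>2 \<longrightarrow>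
     prob B / 2 \<le> prob (B \<inter> {\<omega> \<in> space M. \<forall>u\<in>{s..s + k}. n / 2 \<le> X u \<omega>})"
    using stay_high by (elim exE conjE)
  define d where "d = \<epsilon> * (1 / 2) powr \<alpha>"
  have d: "0 < d" using \<epsilon> by (simp add: d_def)
  have main: "c1 / 2 / lyap a (2 * n) \<le> prob {\<omega> \<in> space M. d * n powr (\<alpha> + 2) \<le> esum (\<lambda>x. rpow x \<alpha>) 0 \<omega>}" if n: "max n1 n2 \<le> n" for n
  proof -
    have nn: "n1 \<le> n" "n2 \<le> n" using n by auto
    have n0: "0 < n" using nn \<epsilon> by linarith
    obtain T U where U: "\<forall>t\<in>{1..T}. U t \<in> sets (F (t + 1)) \<and> U t \<subseteq> alive t \<and> U t \<subseteq> {\<omega> \<in> space M. n \<le> X (t + 1) \<omega>}"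
      and disj: "disjoint_family_on U {1..T}" and sumU: "c1 / lyap a (2 * n) \<le> (\<Sum>t=1..T. prob (U t))"
      using up[rule_format, OF nn(1)] by (elim exE conjE)
    define k where "k = nat \<lfloor>\<epsilon> * n\<^sup>2\<rfloor>"
    have "0 \<le> \<epsilon> * n\<^sup>2" using \<epsilon> by simp
    then have k: "real k \<le> \<epsilon> * n\<^sup>2" "\<epsilon> * n\<^sup>2 \<le> real (Suc k)" unfolding k_def by linarith+
    define G where "G = (\<lambda>t. U t \<inter> {\<omega> \<in> space M. \<forall>u\<in>{t + 1..t + 1 + k}. n / 2 \<le> X u \<omega>})"
    have GM: "G t \<in> sets M" if "t \<in> {1..T}" for t
    proof -
      have "U t \<in> sets (F (t + 1 + k))" using U that F_mono[of "t + 1" "t + 1 + k"] by auto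
      moreover have "{\<omega> \<in> space M. \<forall>u\<in>{t + 1..t + 1 + k}. n / 2 \<le> X u \<omega>} \<in> sets (F (t + 1 + k))"
        by (intro pred_F_bounded_all X_ge_F) auto
      ultimately show ?thesis unfolding G_def by (intro sets_F_M[of "t + 1 + k"] sets.Int) auto
    qed
    have pG: "prob (U t) / 2 \<le> prob (G t)" if "t \<in> {1..T}" for t
      unfolding G_def using U that nn(2) k(1) by (intro stay[rule_format]) auto
    have "c1 / 2 / lyap a (2 * n) \<le> (\<Sum>t=1..T. prob (U t)) / 2" using sumU by (simp add: field_simps)
    also have "\<dots> \<le> (\<Sum>t=1..T. prob (G t))" unfolding sum_divide_distrib using pG by (intro sum_mono) auto
    also have "\<dots> = prob (\<Union>t\<in>{1..T}. G t)"
    proof (rule finite_measure_finite_Union[symmetric])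
      show "disjoint_family_on G {1..T}" using disj unfolding disjoint_family_on_def G_def by blast
    qed (use GM in auto)
    also have "\<dots> \<le> prob {\<omega> \<in> space M. d * n powr (\<alpha> + 2) \<le> esum (\<lambda>x. rpow x \<alpha>) 0 \<omega>}"
    proof (rule finite_measure_mono_AE)
      show "AE \<omega> in M. \<omega> \<in> (\<Union>t\<in>{1..T}. G t) \<longrightarrow> \<omega> \<in> {\<omega> \<in> space M. d * n powr (\<alpha> + 2) \<le> esum (\<lambda>x. rpow x \<alpha>) 0 \<omega>}"
        using AE_tau_finite AE_space
      proof eventually_elim
        case (elim \<omega>)
        then have fin: "\<And>n. tau X n \<omega> \<noteq> \<infinity>" and w: "\<omega> \<in> space M" by auto
        show ?case
        proof
          assume "\<omega> \<in> (\<Union>t\<in>{1..T}. G t)"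
          then obtain t where t: "t \<in> {1..T}" "\<omega> \<in> G t" by blast
          then have al: "\<omega> \<in> alive t" and hi: "\<And>u. t + 1 \<le> u \<Longrightarrow> u \<le> t + 1 + k \<Longrightarrow> n / 2 \<le> X u \<omega>" using U by (auto simp: G_def)
          have "\<omega> \<in> alive (t + 1 + k)"
          proof -
            have "X u \<omega> \<noteq> 0" if "2 \<le> u" "u \<le> t + 1 + k" for u
            proof (cases "u \<le> t")
              case True then show ?thesis using al that by (auto simp: alive_def)
            next
              case False then show ?thesis using hi[of u] that n0 by auto
            qed
            then show ?thesis using w by (auto simp: alive_def)
          qed
          then have T1: "t + 1 + k < return_time X 1 \<omega>" using alive_iff[OF fin w, of "t + 1 + k"] by simp
          have rn: "0 \<le> rpow x \<alpha>" for x by (simp add: rpow_def)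
          have "d * n powr (\<alpha> + 2) = \<epsilon> * n\<^sup>2 * (n / 2) powr \<alpha>"
            using n0 by (simp add: d_def powr_add powr_divide powr_mult field_simps)
          also have "\<dots> \<le> real (Suc k) * (n / 2) powr \<alpha>" using k(2) by (intro mult_right_mono) auto
          also have "\<dots> = (\<Sum>u=t + 1..<t + 2 + k. (n / 2) powr \<alpha>)" by simp
          also have "\<dots> \<le> (\<Sum>u=t + 1..<t + 2 + k. rpow (X u \<omega>) \<alpha>)"
          proof (rule sum_mono)
            fix u assume "u \<in> {t + 1..<t + 2 + k}"
            then have "n / 2 \<le> X u \<omega>" by (intro hi) auto
            then show "(n / 2) powr \<alpha> \<le> rpow (X u \<omega>) \<alpha>" using n0 \<alpha> by (auto simp: rpow_def intro!: powr_mono2)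
          qed
          also have "\<dots> \<le> (\<Sum>u=1..<return_time X 1 \<omega>. rpow (X u \<omega>) \<alpha>)" using T1 rn by (intro sum_mono2) auto
          also have "\<dots> = esum (\<lambda>x. rpow x \<alpha>) 0 \<omega>" unfolding esum_def sum_list_excursion[OF fin] return_time_0[OF fin] by simp
          finally show "\<omega> \<in> {\<omega> \<in> space M. d * n powr (\<alpha> + 2) \<le> esum (\<lambda>x. rpow x \<alpha>) 0 \<omega>}" using w by simp
        qed
      qed
      show "{\<omega> \<in> space M. d * n powr (\<alpha> + 2) \<le> esum (\<lambda>x. rpow x \<alpha>) 0 \<omega>} \<in> sets M" by measurable
    qed
    finally show ?thesis .
  qed
  have "0 < c1 / 2" "0 < max n1 n2" using c1 \<epsilon> by auto
  then show ?thesis using d main by (intro exI[of _ "c1 / 2"] exI[of _ d] exI[of _ "max n1 n2"] conjI allI impI) auto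
qed

end

section \<open>Sums over excursions\<close>

lemma powln_filterlim_at_top:
  assumes "0 < g" shows "filterlim (powln g b) at_top at_top"
proof -
  obtain K where K: "0 < K" "\<And>u. exp 1 \<le> u \<Longrightarrow> K * u powr (g - g / 2) \<le> powln g b u"
    using powln_ge_powr[of "g / 2" g b] assms by auto
  have "filterlim (\<lambda>u. K * u powr (g - g / 2)) at_top at_top"
    using K(1) assms by (intro filterlim_tendsto_pos_mult_at_top[OF tendsto_const] powr_filterlim_at_top) auto
  moreover have "eventually (\<lambda>u. K * u powr (g - g / 2) \<le> powln g b u) at_top"
    using eventually_ge_at_top[of "exp 1"] by eventually_elim (rule K(2))
  ultimately show ?thesis by (rule filterlim_at_top_mono)
qed

lemma eventually_le_ln_powr:
  assumes "0 < e" shows "eventually (\<lambda>n::nat. K \<le> ln (real n) powr e) sequentially"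
proof -
  have "filterlim (\<lambda>u::real. ln u powr e) at_top at_top"
    by (rule filterlim_compose[OF powr_filterlim_at_top[OF assms] ln_at_top])
  then have "filterlim (\<lambda>n::nat. ln (real n) powr e) at_top sequentially"
    by (rule filterlim_compose[OF _ filterlim_real_sequentially])
  then show ?thesis by (simp add: filterlim_at_top)
qed

lemma ln_ge_1: "exp 1 \<le> u \<Longrightarrow> 1 \<le> ln (u::real)"
  by (metis ln_exp ln_le_cancel_iff exp_gt_zero less_le_trans)

lemma eventually_exp_le_real: "eventually (\<lambda>n::nat. K \<le> real n) sequentially"
  using filterlim_real_sequentially by (simp add: filterlim_at_top)

lemma summable_ln_powr:
  "summable (\<lambda>n. 1 / (real n * ln (real n) powr (3 / 2)))"
proof -
  define f where "f = (\<lambda>x::real. - 2 * ln x powr (- (1 / 2)))"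
  have d: "(f has_real_derivative 1 / (x * ln x powr (3 / 2))) (at x)" if "1 < x" for x
  proof -
    have l: "ln x > 0" using that by simp
    have "(f has_real_derivative - 2 * (- (1 / 2) * ln x powr (- (1 / 2) - 1) * (1 / x))) (at x)"
      unfolding f_def using that l by (auto intro!: derivative_eq_intros)
    moreover have "- 2 * (- (1 / 2) * ln x powr (- (1 / 2) - 1) * (1 / x)) = 1 / (x * ln x powr (3 / 2))"
      using l that by (simp add: powr_minus field_simps)
    ultimately show ?thesis by (simp only:)
  qed
  have le: "1 / (real (Suc n) * ln (real (Suc n)) powr (3 / 2)) \<le> f (real (Suc n)) - f (real n)" if n: "2 \<le> n" for n
  proof -
    have "\<exists>z. real n < z \<and> z < real (Suc n) \<and> f (real (Suc n)) - f (real n) = (real (Suc n) - real n) * (1 / (z * ln z powr (3 / 2)))"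
      using n by (intro MVT2 d) auto
    then obtain z where z: "real n < z" "z < real (Suc n)" "f (real (Suc n)) - f (real n) = 1 / (z * ln z powr (3 / 2))" by auto
    have z1: "1 < z" using z n by simp
    have "z * ln z powr (3 / 2) \<le> real (Suc n) * ln (real (Suc n)) powr (3 / 2)"
      using z z1 by (intro mult_mono powr_mono2) auto
    moreover have "0 < z * ln z powr (3 / 2)" using z1 by simp
    ultimately show ?thesis unfolding z(3) by (intro divide_left_mono) auto
  qed
  have "summable (\<lambda>n. 1 / (real (n + 3) * ln (real (n + 3)) powr (3 / 2)))"
  proof (rule summableI_nonneg_bounded[where x = "- f 2"])
    fix N
    have "(\<Sum>n<N. 1 / (real (n + 3) * ln (real (n + 3)) powr (3 / 2))) \<le> f (real (N + 2)) - f 2"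
    proof (induction N)
      case (Suc N)
      from le[of "N + 2"] have "1 / (real (N + 3) * ln (real (N + 3)) powr (3 / 2)) \<le> f (real (N + 3)) - f (real (N + 2))"
        by (simp add: numeral_eq_Suc)
      with Suc show ?case by (simp add: numeral_eq_Suc)
    qed simp
    moreover have "f (real (N + 2)) \<le> 0" by (simp add: f_def)
    ultimately show "(\<Sum>n<N. 1 / (real (n + 3) * ln (real (n + 3)) powr (3 / 2))) \<le> - f 2" by linarith
  qed simp
  then show ?thesis by (subst (asm) summable_iff_shift)
qed

context lamperti begin

lemma esum_prob_eq: "prob (esum g k -` A \<inter> space M) = prob (esum g 0 -` A \<inter> space M)" if "A \<in> sets borel"
proof -
  have "measure (distr M borel (esum g k)) A = prob (esum g k -` A \<inter> space M)" for k
    using that by (intro measure_distr) auto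
  from this[of k] this[of 0] show ?thesis using esum_distr[of g k] by simp
qed

lemma prob_all_esum_less:
  assumes "0 < n"
  shows "prob {\<omega> \<in> space M. \<forall>k<n. esum g k \<omega> < z} = (1 - prob {\<omega> \<in> space M. z \<le> esum g 0 \<omega>}) ^ n"
proof -
  have "prob (\<Inter>k\<in>{..<n}. esum g k -` {..<z} \<inter> space M) = (\<Prod>k\<in>{..<n}. prob (esum g k -` {..<z} \<inter> space M))"
    using assms by (intro indep_varsD[OF esum_indep]) auto
  also have "\<dots> = prob (esum g 0 -` {..<z} \<inter> space M) ^ n"
  proof -
    have "(\<Prod>k\<in>{..<n}. prob (esum g k -` {..<z} \<inter> space M)) = (\<Prod>k\<in>{..<n}. prob (esum g 0 -` {..<z} \<inter> space M))"
      by (intro prod.cong refl esum_prob_eq) simp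
    then show ?thesis by simp
  qed
  also have "esum g 0 -` {..<z} \<inter> space M = space M - {\<omega> \<in> space M. z \<le> esum g 0 \<omega>}" by auto
  also have "prob \<dots> = 1 - prob {\<omega> \<in> space M. z \<le> esum g 0 \<omega>}" by (rule prob_compl) measurable
  also have "(\<Inter>k\<in>{..<n}. esum g k -` {..<z} \<inter> space M) = {\<omega> \<in> space M. \<forall>k<n. esum g k \<omega> < z}"
    using assms by auto
  finally show ?thesis .
qed

lemma esum_nonneg: "(\<And>x. 0 \<le> g x) \<Longrightarrow> 0 \<le> esum g k \<omega>"
  unfolding esum_def by (rule sum_list_nonneg) auto

lemma sums_lower:
  assumes \<alpha>: "0 \<le> \<alpha>" and e: "0 < e"
  shows "AE \<omega> in M. eventually (\<lambda>n. real n powr ((\<alpha> + 2) / (1 + r)) * ln (real n) powr (- ((\<alpha> + 2) / (1 + r)) - e)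
     \<le> (\<Sum>k<n. esum (\<lambda>x. rpow x \<alpha>) k \<omega>)) sequentially"
proof -
  define q where "q = (\<alpha> + 2) / (1 + r)"
  have r1: "0 < 1 + r" using r_gt by simp
  have q: "0 < q" using \<alpha> r1 by (simp add: q_def)
  define a where "a = min (1 + r) (e / (4 * q))"
  have a: "0 < a" "a \<le> 1 + r" using r1 e q by (auto simp: a_def)
  have aq: "2 * a * q < e"
  proof -
    have "a \<le> e / (4 * q)" by (simp add: a_def)
    then have "a * q \<le> e / 4" using q by (simp add: field_simps)
    then show ?thesis using e by linarith
  qed
  obtain c2 d n3 where c2: "0 < c2" and d: "0 < d" and n3: "0 < n3"
    and tail: "\<forall>n\<ge>n3. c2 / lyap a (2 * n) \<le> prob {\<omega> \<in> space M. d * n powr (\<alpha> + 2) \<le> esum (\<lambda>x. rpow x \<alpha>) 0 \<omega>}"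
    using esum_lower_tail[OF a \<alpha>] by (elim exE conjE)
  define v where "v = (\<lambda>n::nat. powln (1 / (1 + r)) (- ((1 + 2 * a) / (1 + r))) (real n))"
  define z where "z = (\<lambda>n. d * (v n / 2) powr (\<alpha> + 2))"
  let ?xi = "esum (\<lambda>x. rpow x \<alpha>)"
  have "filterlim v at_top sequentially"
    unfolding v_def using r1 by (intro filterlim_compose[OF powln_filterlim_at_top filterlim_real_sequentially]) simp
  then have ev1: "eventually (\<lambda>n. max (exp 1) (2 * n3) \<le> v n) sequentially" unfolding filterlim_at_top by blast
  have ev2: "eventually (\<lambda>n::nat. 2 / (c2 * (1 + r) powr a) \<le> ln (real n) powr a) sequentially"
    by (rule eventually_le_ln_powr[OF a(1)])
  have ev3: "eventually (\<lambda>n::nat. exp 1 \<le> real n) sequentially" by (rule eventually_exp_le_real)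
  define A where "A = (\<lambda>n. {\<omega> \<in> space M. \<forall>k<n. ?xi k \<omega> < z n})"
  have AM: "A n \<in> sets M" for n unfolding A_def by measurable
  have "eventually (\<lambda>n. prob (A n) \<le> 1 / (real n)\<^sup>2) sequentially"
    using ev1 ev2 ev3
  proof eventually_elim
    case (elim n)
    define L where "L = ln (real n)"
    have n1: "1 < real n" using elim(3) exp_gt_one[of "1::real"] by linarith
    have L: "1 \<le> L" using ln_ge_1[OF elim(3)] by (simp add: L_def)
    have v0: "0 < v n" "exp 1 \<le> v n" "n3 \<le> v n / 2" using elim(1) exp_gt_zero[of "1::real"] by linarith+
    have vp: "v n powr (1 + r) = real n * L powr (- (1 + 2 * a))"
      unfolding v_def powln_def L_def[symmetric] using n1 L r1 by (simp add: powr_mult powr_powr)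
    have "v n \<le> real n powr (1 / (1 + r))"
    proof -
      have "L powr (- ((1 + 2 * a) / (1 + r))) \<le> L powr 0" using L a r1 by (intro powr_mono) auto
      then have "real n powr (1 / (1 + r)) * L powr (- ((1 + 2 * a) / (1 + r))) \<le> real n powr (1 / (1 + r)) * 1"
        using L by (intro mult_left_mono) auto
      then show ?thesis unfolding v_def powln_def L_def by simp
    qed
    then have "ln (v n) \<le> ln (real n powr (1 / (1 + r)))" by (subst ln_le_cancel_iff) (use v0 n1 in auto)
    also have "\<dots> = L / (1 + r)" using n1 by (simp add: ln_powr L_def)
    finally have lv: "ln (v n) \<le> L / (1 + r)" .
    have "lyap a (v n) = v n powr (1 + r) * ln (v n) powr a" using v0(2) by (simp add: lyap_def powln_def max_def)
    also have "\<dots> \<le> (real n * L powr (- (1 + 2 * a))) * (L / (1 + r)) powr a"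
      unfolding vp using lv a ln_ge_1[OF v0(2)] by (intro mult_left_mono powr_mono2) auto
    also have "\<dots> = real n / (L * L powr a * (1 + r) powr a)"
      using L r1 by (simp add: powr_divide powr_minus powr_add powr_mult field_simps flip: powr_add)
    finally have lfv: "lyap a (v n) \<le> real n / (L * L powr a * (1 + r) powr a)" .
    have "2 * L / real n \<le> c2 * (L * L powr a * (1 + r) powr a) / real n"
    proof (rule divide_right_mono)
      have "2 \<le> c2 * (1 + r) powr a * L powr a" using elim(2) c2 r1 unfolding L_def by (simp add: field_simps)
      then have "2 * L \<le> c2 * (1 + r) powr a * L powr a * L" using L by (intro mult_right_mono) auto
      then show "2 * L \<le> c2 * (L * L powr a * (1 + r) powr a)" by (simp add: mult_ac)
    qed simp
    also have "\<dots> = c2 / (real n / (L * L powr a * (1 + r) powr a))" by simp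
    also have "\<dots> \<le> c2 / lyap a (v n)"
      using lfv c2 lyap_pos[of a "v n"] n1 L r1 by (intro divide_left_mono) (auto intro!: mult_pos_pos)
    also have "\<dots> \<le> prob {\<omega> \<in> space M. z n \<le> ?xi 0 \<omega>}"
      using tail[rule_format, OF v0(3)] unfolding z_def by simp
    finally have pl: "2 * L / real n \<le> prob {\<omega> \<in> space M. z n \<le> ?xi 0 \<omega>}" .
    define pz where "pz = prob {\<omega> \<in> space M. z n \<le> ?xi 0 \<omega>}"
    have pz: "2 * L / real n \<le> pz" "pz \<le> 1" using pl by (auto simp: pz_def)
    have "prob (A n) = (1 - pz) ^ n" unfolding A_def pz_def using n1 by (intro prob_all_esum_less) simp
    also have "\<dots> \<le> exp (- (2 * L / real n)) ^ n"
    proof (rule power_mono)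
      have "1 - pz \<le> exp (- pz)" using exp_ge_add_one_self[of "- pz"] by simp
      also have "\<dots> \<le> exp (- (2 * L / real n))" using pz by simp
      finally show "1 - pz \<le> exp (- (2 * L / real n))" .
    qed (use pz in simp)
    also have "\<dots> = exp (- 2 * L)" using n1 by (simp flip: exp_of_nat_mult)
    also have "\<dots> = 1 / (real n)\<^sup>2" using n1 unfolding L_def
      by (simp add: exp_minus exp_double inverse_eq_divide)
    finally show ?case .
  qed
  then have "summable (\<lambda>n. prob (A n))"
    by (intro summable_comparison_test_ev[OF _ inverse_power_summable[of 2]]) (auto simp: inverse_eq_divide)
  then have "AE \<omega> in M. eventually (\<lambda>n. \<omega> \<in> space M - A n) sequentially"
    using AM by (intro borel_cantelli_AE1) (auto simp: emeasure_eq_measure)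
  then show ?thesis
  proof eventually_elim
    case (elim \<omega>)
    have ev4: "eventually (\<lambda>n::nat. 2 powr (\<alpha> + 2) / d \<le> ln (real n) powr (e - 2 * a * q)) sequentially"
      using aq by (intro eventually_le_ln_powr) simp
    from elim ev1 ev3 ev4 show ?case
    proof eventually_elim
      case (elim n)
      define L where "L = ln (real n)"
      have n1: "1 < real n" using elim(3) exp_gt_one[of "1::real"] by linarith
      have L: "1 \<le> L" using ln_ge_1[OF elim(3)] by (simp add: L_def)
      have rn: "0 \<le> rpow x \<alpha>" for x by (simp add: rpow_def)
      from elim(1) obtain k where k: "k < n" "z n \<le> ?xi k \<omega>" by (auto simp: A_def not_less)
      have "real n powr q * L powr (- q - e) \<le> z n"
      proof -
        have "(v n) powr (\<alpha> + 2) = real n powr q * L powr (- ((1 + 2 * a) * q))"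
          unfolding v_def powln_def L_def[symmetric] q_def using n1 L by (simp add: powr_mult powr_powr mult.commute)
        then have zeq: "z n = real n powr q * (d / 2 powr (\<alpha> + 2) * L powr (- ((1 + 2 * a) * q)))"
          unfolding z_def using n1 by (simp add: powr_divide v_def powln_pos less_imp_le)
        have le: "L powr (- q - e) \<le> d / 2 powr (\<alpha> + 2) * L powr (- ((1 + 2 * a) * q))"
        proof -
          have "L powr (- q - e) * (2 powr (\<alpha> + 2) / d) \<le> L powr (- q - e) * L powr (e - 2 * a * q)"
            using elim(4) unfolding L_def by (intro mult_left_mono) auto
          also have "\<dots> = L powr (- ((1 + 2 * a) * q))" by (simp flip: powr_add) (simp add: algebra_simps)
          finally show ?thesis using d by (simp add: field_simps)
        qed
        show ?thesis unfolding zeq by (rule mult_left_mono[OF le]) simp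
      qed
      also have "\<dots> \<le> ?xi k \<omega>" by (rule k(2))
      also have "\<dots> \<le> (\<Sum>k<n. ?xi k \<omega>)" using k(1) rn by (intro member_le_sum esum_nonneg) auto
      finally show ?case unfolding q_def L_def by simp
    qed
  qed
qed

lemma lyap_rate_integrable:
  assumes a: "0 < a" "a \<le> 1 + r" shows "integrable M (esum (lyap_rate (- a)) 0)"
proof -
  obtain K where K: "0 < K" and le: "(\<integral>\<^sup>+\<omega>. (\<Sum>t. ennreal (indicator (alive (Suc t)) \<omega> * lyap_rate (- a) (X (Suc t) \<omega>))) \<partial>M) \<le> ennreal K"
    using excursion_weight_finite[OF a] by (elim exE conjE)
  have lw0: "0 \<le> lyap_rate (- a) x" for x using lyap_rate_pos less_imp_le by blast
  have "(\<integral>\<^sup>+\<omega>. ennreal (norm (esum (lyap_rate (- a)) 0 \<omega>)) \<partial>M) = (\<integral>\<^sup>+\<omega>. (\<Sum>t. ennreal (indicator (alive (Suc t)) \<omega> * lyap_rate (- a) (X (Suc t) \<omega>))) \<partial>M)"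
  proof (rule nn_integral_cong_AE)
    show "AE \<omega> in M. ennreal (norm (esum (lyap_rate (- a)) 0 \<omega>)) = (\<Sum>t. ennreal (indicator (alive (Suc t)) \<omega> * lyap_rate (- a) (X (Suc t) \<omega>)))"
      using AE_tau_finite AE_space
    proof eventually_elim
      case (elim \<omega>)
      then have fin: "\<And>n. tau X n \<omega> \<noteq> \<infinity>" by simp
      have "norm (esum (lyap_rate (- a)) 0 \<omega>) = esum (lyap_rate (- a)) 0 \<omega>"
        using esum_nonneg[of "lyap_rate (- a)" 0 \<omega>, OF lw0] by (simp only: real_norm_def abs_of_nonneg)
      then show ?case using suminf_alive_eq[OF fin elim(2), where g = "lyap_rate (- a)", OF lw0] by (simp only:)
    qed
  qed
  also have "\<dots> < \<infinity>" using le by (rule le_less_trans) simp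
  finally show ?thesis by (intro integrableI_bounded) auto
qed

lemma esum_dominated:
  assumes "\<And>x. 0 \<le> g x" "\<And>x. x \<in> set (excursion X (Suc k) \<omega>) \<Longrightarrow> g x \<le> K * h x"
  shows "esum g k \<omega> \<le> K * esum h k \<omega>"
  unfolding esum_def sum_list_const_mult[symmetric] by (rule sum_list_mono) (use assms in auto)

lemma AE_excursion_nonneg: "AE \<omega> in M. \<forall>k. \<forall>x\<in>set (excursion X (Suc k) \<omega>). 0 \<le> x"
  using AE_tau_finite AE_space
proof eventually_elim
  case (elim \<omega>)
  then have fin: "\<And>n. tau X n \<omega> \<noteq> \<infinity>" by simp
  show ?case
  proof (intro allI ballI)
    fix k x assume "x \<in> set (excursion X (Suc k) \<omega>)"
    then obtain t where t: "return_time X k \<omega> \<le> t" "x = X t \<omega>" unfolding excursion_Suc[OF fin] by auto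
    have "1 \<le> t" using t return_time_gt[OF fin, of k] by simp
    then show "0 \<le> x" using X_nonneg[OF _ elim(2)] t by simp
  qed
qed

lemma rpow_le_max: "0 \<le> \<alpha> \<Longrightarrow> 0 \<le> x \<Longrightarrow> rpow x \<alpha> \<le> (max x (exp 1)) powr \<alpha>"
proof -
  assume h: "0 \<le> \<alpha>" "0 \<le> x"
  have "x powr \<alpha> \<le> (max x (exp 1)) powr \<alpha>" using h by (intro powr_mono2) auto
  moreover have "1 \<le> (max x (exp (1::real))) powr \<alpha>" using h max_e_gt_1[of x] by (intro ge_one_powr_ge_zero) auto
  ultimately show ?thesis by (auto simp: rpow_def)
qed

lemma excursion_max_prob:
  assumes a: "0 < a" "a \<le> 1 + r"
  shows "\<exists>Q>0. \<forall>n>0. \<forall>k. prob {\<omega> \<in> space M. \<exists>x\<in>set (excursion X (Suc k) \<omega>). n \<le> x} \<le> Q / lyap (- a) n"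
proof -
  obtain Q where Q: "0 < Q" and tail: "\<forall>n>0. prob {\<omega> \<in> space M. \<exists>t\<ge>1. \<omega> \<in> alive t \<and> n \<le> X t \<omega>} \<le> Q / lyap (- a) n"
    using excursion_max_tail[OF a] by (elim exE conjE)
  have "prob {\<omega> \<in> space M. \<exists>x\<in>set (excursion X (Suc k) \<omega>). n \<le> x} \<le> Q / lyap (- a) n" if n: "0 < n" for n k
  proof -
    have "prob {\<omega> \<in> space M. \<exists>x\<in>set (excursion X (Suc k) \<omega>). n \<le> x} = prob {\<omega> \<in> space M. \<exists>x\<in>set (excursion X 1 \<omega>). n \<le> x}"
      by (rule excursion_prob_eq[of "\<lambda>l. \<exists>x\<in>set l. n \<le> x"])
    also have "\<dots> \<le> prob {\<omega> \<in> space M. \<exists>t\<ge>1. \<omega> \<in> alive t \<and> n \<le> X t \<omega>}"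
    proof (rule finite_measure_mono_AE)
      show "AE \<omega> in M. \<omega> \<in> {\<omega> \<in> space M. \<exists>x\<in>set (excursion X 1 \<omega>). n \<le> x} \<longrightarrow> \<omega> \<in> {\<omega> \<in> space M. \<exists>t\<ge>1. \<omega> \<in> alive t \<and> n \<le> X t \<omega>}"
        using AE_tau_finite
      proof eventually_elim
        case (elim \<omega>)
        then have fin: "\<And>n. tau X n \<omega> \<noteq> \<infinity>" by simp
        show ?case
        proof
          assume w: "\<omega> \<in> {\<omega> \<in> space M. \<exists>x\<in>set (excursion X 1 \<omega>). n \<le> x}"
          then have sp: "\<omega> \<in> space M" by simp
          from w obtain x where x: "x \<in> set (excursion X (Suc 0) \<omega>)" "n \<le> x" by auto
          then obtain t where t: "1 \<le> t" "t < return_time X 1 \<omega>" "n \<le> X t \<omega>"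
            unfolding excursion_Suc[OF fin] return_time_0[OF fin] by auto
          then have "\<omega> \<in> alive t" using alive_iff[OF fin sp t(1)] by simp
          then show "\<omega> \<in> {\<omega> \<in> space M. \<exists>t\<ge>1. \<omega> \<in> alive t \<and> n \<le> X t \<omega>}" using t sp by blast
        qed
      qed
      have eq: "{\<omega> \<in> space M. \<exists>t\<ge>1. \<omega> \<in> alive t \<and> n \<le> X t \<omega>} = (\<Union>t\<in>{1..}. alive t \<inter> {\<omega> \<in> space M. n \<le> X t \<omega>})"
        by (auto simp: alive_def)
      show "{\<omega> \<in> space M. \<exists>t\<ge>1. \<omega> \<in> alive t \<and> n \<le> X t \<omega>} \<in> sets M" unfolding eq
        by (rule sets.countable_UN') (auto intro!: sets.Int alive_M sets_F_M[OF _ X_ge_F[OF _ order_refl]])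
    qed
    also have "\<dots> \<le> Q / lyap (- a) n" using tail n by blast
    finally show ?thesis .
  qed
  then show ?thesis using Q by blast
qed

lemma sums_upper:
  assumes \<alpha>: "0 \<le> \<alpha>" and r\<alpha>: "r \<le> 1 + \<alpha>"
  shows "AE \<omega> in M. eventually (\<lambda>n. (\<Sum>k<n. esum (\<lambda>x. rpow x \<alpha>) k \<omega>)
     \<le> real n powr ((\<alpha> + 2) / (1 + r)) * ln (real n) powr (2 * ((\<alpha> + 2) / (1 + r)))) sequentially"
proof -
  define q where "q = (\<alpha> + 2) / (1 + r)"
  have r1: "0 < 1 + r" using r_gt by simp
  have q: "1 \<le> q" using r1 r\<alpha> by (simp add: q_def field_simps)
  define a where "a = min (1 + r) (1 / 2)"
  have a: "0 < a" "a \<le> 1 + r" "a \<le> 1 / 2" unfolding a_def using r1 by linarith+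
  let ?xi = "esum (\<lambda>x. rpow x \<alpha>)"
  define E where "E = expectation (esum (lyap_rate (- a)) 0) + 1"
  have "AE \<omega> in M. eventually (\<lambda>n. (\<Sum>k<n. esum (lyap_rate (- a)) k \<omega>) / real n \<le> E) sequentially"
    unfolding E_def by (rule slln_upper[OF esum_indep esum_distr lyap_rate_integrable[OF a(1,2)]]) simp
  moreover
  obtain Q where Q: "0 < Q" and tail: "\<forall>n>0. \<forall>k. prob {\<omega> \<in> space M. \<exists>x\<in>set (excursion X (Suc k) \<omega>). n \<le> x} \<le> Q / lyap (- a) n"
    using excursion_max_prob[OF a(1,2)] by (elim exE conjE)
  define y where "y = (\<lambda>n::nat. powln (1 / (1 + r)) (2 / (1 + r)) (real n))"
  have ytop: "filterlim y at_top sequentially"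
    unfolding y_def using r1 by (intro filterlim_compose[OF powln_filterlim_at_top filterlim_real_sequentially]) simp
  have ev1: "eventually (\<lambda>n. exp 1 \<le> y n) sequentially" using ytop by (simp add: filterlim_at_top)
  have ev3: "eventually (\<lambda>n::nat. exp 1 \<le> real n) sequentially" by (rule eventually_exp_le_real)
  have ybd: "y n powr (1 + r) = real n * ln (real n) powr 2" "ln (y n) \<le> 3 / (1 + r) * ln (real n)" "1 \<le> ln (real n)" "1 < real n"
    if "exp 1 \<le> real n" "exp 1 \<le> y n" for n
  proof -
    define L where "L = ln (real n)"
    show n1: "1 < real n" using that(1) exp_gt_one[of "1::real"] by linarith
    show L1: "1 \<le> ln (real n)" by (rule ln_ge_1[OF that(1)])
    then have L: "1 \<le> L" by (simp add: L_def)
    show "y n powr (1 + r) = real n * ln (real n) powr 2"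
    proof -
      have "y n powr (1 + r) = (real n powr (1 / (1 + r))) powr (1 + r) * (L powr (2 / (1 + r))) powr (1 + r)"
        unfolding y_def powln_def L_def[symmetric] by (rule powr_mult)
      also have "\<dots> = real n powr (1 / (1 + r) * (1 + r)) * L powr (2 / (1 + r) * (1 + r))" by (simp only: powr_powr)
      also have "1 / (1 + r) * (1 + r) = 1" using r1 by simp
      also have "2 / (1 + r) * (1 + r) = 2" using r1 by (simp add: field_simps)
      finally show ?thesis using n1 by (simp add: L_def)
    qed
    have "ln (y n) = ln (real n powr (1 / (1 + r))) + ln (L powr (2 / (1 + r)))"
      unfolding y_def powln_def L_def[symmetric] by (rule ln_mult_pos) (use n1 L in auto)
    also have "\<dots> = 1 / (1 + r) * L + 2 / (1 + r) * ln L" using n1 L by (simp add: ln_powr L_def)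
    also have "\<dots> \<le> 1 / (1 + r) * L + 2 / (1 + r) * L"
      using L r1 ln_le_minus_one[of L] by (intro add_left_mono mult_left_mono) auto
    also have "\<dots> = 3 / (1 + r) * L" by (simp add: add_divide_distrib[symmetric] distrib_right[symmetric])
    finally show "ln (y n) \<le> 3 / (1 + r) * ln (real n)" by (simp add: L_def)
  qed
  define A where "A = (\<lambda>n. {\<omega> \<in> space M. \<exists>x\<in>set (excursion X (Suc n) \<omega>). y n \<le> x})"
  have AM: "A n \<in> sets M" for n unfolding A_def by (rule excursion_pred_sets[of "\<lambda>l. \<exists>x\<in>set l. y n \<le> x"])
  define Q' where "Q' = Q * (3 / (1 + r)) powr a"
  have "eventually (\<lambda>n. prob (A n) \<le> Q' * (1 / (real n * ln (real n) powr (3 / 2)))) sequentially"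
    using ev1 ev3
  proof eventually_elim
    case (elim n)
    note yb = ybd[OF elim(2,1)]
    define L where "L = ln (real n)"
    have L: "1 \<le> L" using yb by (simp add: L_def)
    have y0: "0 < y n" using elim(1) by (rule less_le_trans[OF exp_gt_zero])
    have ly: "1 \<le> ln (y n)" by (rule ln_ge_1[OF elim(1)])
    have "prob (A n) \<le> Q / lyap (- a) (y n)" unfolding A_def using tail y0 by blast
    also have "lyap (- a) (y n) = y n powr (1 + r) * ln (y n) powr (- a)" using elim(1) by (simp add: lyap_def powln_def max_def)
    also have "Q / \<dots> = Q * ln (y n) powr a / (real n * L powr 2)"
      unfolding yb(1) L_def using ly by (simp add: powr_minus field_simps)
    also have "\<dots> \<le> Q * (3 / (1 + r) * L) powr a / (real n * L powr 2)"
      using yb Q ly a L unfolding L_def by (intro divide_right_mono mult_left_mono powr_mono2) auto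
    also have "\<dots> = Q' * (L powr a / (real n * L powr 2))" unfolding Q'_def powr_mult[of "3 / (1 + r)" L] by simp
    also have "\<dots> \<le> Q' * (1 / (real n * L powr (3 / 2)))"
    proof (intro mult_left_mono)
      have "L powr a \<le> L powr (1 / 2)" using L a by (intro powr_mono) auto
      then have "L powr a / (real n * L powr 2) \<le> L powr (1 / 2) / (real n * L powr 2)" using yb by (intro divide_right_mono) auto
      also have "\<dots> = 1 / (real n * L powr (3 / 2))"
      proof -
        have "L powr 2 = L powr (1 / 2) * L powr (3 / 2)" by (simp flip: powr_add)
        then show ?thesis using L by simp
      qed
      finally show "L powr a / (real n * L powr 2) \<le> 1 / (real n * L powr (3 / 2))" .
    qed (use Q in \<open>simp add: Q'_def\<close>)
    finally show ?case unfolding L_def .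
  qed
  then have "summable (\<lambda>n. prob (A n))"
    by (intro summable_comparison_test_ev[OF _ summable_mult[OF summable_ln_powr]]) auto
  then have "AE \<omega> in M. eventually (\<lambda>n. \<omega> \<in> space M - A n) sequentially"
    using AM by (intro borel_cantelli_AE1) (auto simp: emeasure_eq_measure)
  moreover note AE_excursion_nonneg
  ultimately show ?thesis
  proof eventually_elim
    case (elim \<omega>)
    obtain k0 where k0: "\<And>k. k0 \<le> k \<Longrightarrow> \<omega> \<in> space M - A k" "exp 1 \<le> real k0"
    proof -
      from eventually_conj[OF elim(2) ev3] obtain N where "\<forall>k\<ge>N. \<omega> \<in> space M - A k \<and> exp 1 \<le> real k"
        by (auto simp: eventually_sequentially)
      then show thesis using that[of N] by auto
    qed
    define Mx where "Mx = Max (insert 0 (\<Union>k\<in>{..<k0}. set (excursion X (Suc k) \<omega>)))"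
    have Mx: "x \<le> Mx" if "x \<in> set (excursion X (Suc k) \<omega>)" "k < k0" for x k
      unfolding Mx_def using that by (intro Max_ge) auto
    have ev5: "eventually (\<lambda>n. Mx \<le> y n) sequentially" using ytop by (simp add: filterlim_at_top)
    define K where "K = \<bar>E\<bar> * (3 / (1 + r)) powr (a + 1)"
    have ev6: "eventually (\<lambda>n::nat. K \<le> ln (real n) powr (1 / 2)) sequentially" by (rule eventually_le_ln_powr) simp
    from elim(1) ev1 ev3 ev5 ev6 show ?case
    proof eventually_elim
      case (elim n)
      note yb = ybd[OF elim(3,2)]
      define L where "L = ln (real n)"
      have L: "1 \<le> L" using yb by (simp add: L_def)
      have y0: "0 < y n" using elim(2) by (rule less_le_trans[OF exp_gt_zero])
      have xy: "x \<le> y n" if x: "x \<in> set (excursion X (Suc k) \<omega>)" and k: "k < n" for x k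
      proof (cases "k < k0")
        case True then show ?thesis using Mx[OF x True] elim(4) by linarith
      next
        case False
        then have "x < y k" using k0(1)[of k] x by (auto simp: A_def not_le)
        also have "y k \<le> y n" unfolding y_def using k0(2) False k r1 by (intro powln_mono) auto
        finally show ?thesis by simp
      qed
      define Z where "Z = powln (\<alpha> - (r - 1)) (a + 1) (y n)"
      have Z0: "0 \<le> Z" unfolding Z_def powln_def by simp
      have rZ: "rpow x \<alpha> \<le> Z * lyap_rate (- a) x" if "0 \<le> x" "x \<le> y n" for x
      proof -
        define u where "u = max x (exp 1)"
        have u: "exp 1 \<le> u" "u \<le> y n" "1 < u" using that elim(2) max_e_gt_1[of x] by (auto simp: u_def)
        have "rpow x \<alpha> \<le> u powr \<alpha>" unfolding u_def by (rule rpow_le_max[OF \<alpha> that(1)])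
        also have "u powr \<alpha> = powln (\<alpha> - (r - 1)) (a + 1) u * lyap_rate (- a) x"
        proof -
          have "powln (\<alpha> - (r - 1)) (a + 1) u * lyap_rate (- a) x = (u powr (\<alpha> - (r - 1)) * u powr (r - 1)) * (ln u powr (a + 1) * ln u powr (- a - 1))"
            unfolding lyap_rate_def u_def[symmetric] powln_def by simp
          also have "\<dots> = u powr \<alpha> * 1" using u by (simp flip: powr_add)
          finally show ?thesis by simp
        qed
        also have "\<dots> \<le> Z * lyap_rate (- a) x"
          unfolding Z_def using u r\<alpha> a lyap_rate_pos[of "- a" x] by (intro mult_right_mono powln_mono) auto
        finally show ?thesis .
      qed
      have "(\<Sum>k<n. ?xi k \<omega>) \<le> (\<Sum>k<n. Z * esum (lyap_rate (- a)) k \<omega>)"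
      proof (intro sum_mono esum_dominated)
        fix k x assume "k \<in> {..<n}" "x \<in> set (excursion X (Suc k) \<omega>)"
        then show "rpow x \<alpha> \<le> Z * lyap_rate (- a) x" using xy[of x k] \<open>\<forall>k. \<forall>x\<in>set (excursion X (Suc k) \<omega>). 0 \<le> x\<close> by (intro rZ) auto
      qed (simp add: rpow_def)
      also have "\<dots> = Z * (\<Sum>k<n. esum (lyap_rate (- a)) k \<omega>)" by (simp add: sum_distrib_left)
      also have "\<dots> \<le> Z * (\<bar>E\<bar> * real n)"
      proof (rule mult_left_mono[OF _ Z0])
        have "(\<Sum>k<n. esum (lyap_rate (- a)) k \<omega>) \<le> E * real n" using elim(1) yb by (simp add: field_simps)
        also have "\<dots> \<le> \<bar>E\<bar> * real n" by (intro mult_right_mono) auto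
        finally show "(\<Sum>k<n. esum (lyap_rate (- a)) k \<omega>) \<le> \<bar>E\<bar> * real n" .
      qed
      also have "\<dots> \<le> (real n powr (q - 1) * L powr (2 * (q - 1)) * ((3 / (1 + r)) powr (a + 1) * L powr (a + 1))) * (\<bar>E\<bar> * real n)"
      proof (intro mult_right_mono)
        have "Z = (y n powr (1 + r)) powr (q - 1) * ln (y n) powr (a + 1)"
        proof -
          have "(1 + r) * (q - 1) = \<alpha> - (r - 1)" using r1 by (simp add: q_def field_simps)
          then show ?thesis unfolding Z_def powln_def by (simp add: powr_powr)
        qed
        also have "\<dots> \<le> (y n powr (1 + r)) powr (q - 1) * (3 / (1 + r) * L) powr (a + 1)"
          using yb ln_ge_1[OF elim(2)] a unfolding L_def by (intro mult_left_mono powr_mono2) auto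
        also have "\<dots> = real n powr (q - 1) * L powr (2 * (q - 1)) * ((3 / (1 + r)) powr (a + 1) * L powr (a + 1))"
          unfolding yb(1) L_def[symmetric] powr_mult[of "3 / (1 + r)" L] powr_mult[of "real n" "L powr 2"] powr_powr ..
        finally show "Z \<le> real n powr (q - 1) * L powr (2 * (q - 1)) * ((3 / (1 + r)) powr (a + 1) * L powr (a + 1))" .
      qed simp
      also have "\<dots> = (real n powr (q - 1) * real n) * (L powr (2 * (q - 1)) * L powr (a + 1) * K)"
        unfolding K_def by (simp add: mult_ac)
      also have "real n powr (q - 1) * real n = real n powr q"
        using yb by (simp add: powr_diff)
      also have "real n powr q * (L powr (2 * (q - 1)) * L powr (a + 1) * K) \<le> real n powr q * L powr (2 * q)"
      proof (intro mult_left_mono)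
        have "L powr (2 * (q - 1)) * L powr (a + 1) * K \<le> L powr (2 * (q - 1)) * L powr (a + 1) * L powr (1 / 2)"
          using elim(5) unfolding L_def by (intro mult_left_mono) auto
        also have "\<dots> = L powr (2 * q - 1 / 2 + a)" by (simp flip: powr_add) (simp add: algebra_simps)
        also have "\<dots> \<le> L powr (2 * q)" using L a by (intro powr_mono) auto
        finally show "L powr (2 * (q - 1)) * L powr (a + 1) * K \<le> L powr (2 * q)" .
      qed simp
      finally show ?case unfolding q_def L_def by simp
    qed
  qed
qed

end

section \<open>From excursions to deterministic times\<close>

lemma renewal_index:
  fixes T :: "nat \<Rightarrow> nat"
  assumes T: "strict_mono T" "T 0 = 1"
  obtains N :: "nat \<Rightarrow> nat" where "filterlim N at_top sequentially"
    "\<And>t. 1 \<le> t \<Longrightarrow> T (N t) \<le> t" "\<And>t. 1 \<le> t \<Longrightarrow> t < T (Suc (N t))" "\<And>t. 1 \<le> t \<Longrightarrow> N t + 1 \<le> t"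
proof -
  have Tge: "n < T n" for n
  proof (induction n)
    case (Suc n)
    have "T n < T (Suc n)" using T(1) by (simp add: strict_mono_def)
    then show ?case using Suc by simp
  qed (simp add: T)
  define N where "N = (\<lambda>t. LEAST n. t < T (Suc n))"
  have N2: "t < T (Suc (N t))" for t
    unfolding N_def by (rule LeastI_ex, rule exI[of _ t]) (use Tge[of "Suc t"] in simp)
  have N1: "T (N t) \<le> t" if "1 \<le> t" for t
  proof (cases "N t")
    case 0 then show ?thesis using that T by simp
  next
    case (Suc k)
    then have "\<not> t < T (Suc k)" using not_less_Least[of k "\<lambda>n. t < T (Suc n)"] unfolding N_def by simp
    then show ?thesis using Suc by simp
  qed
  have N3: "N t + 1 \<le> t" if "1 \<le> t" for t using N1[OF that] Tge[of "N t"] by simp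
  have "filterlim N at_top sequentially"
    unfolding filterlim_at_top
  proof
    fix m
    have "m \<le> N t" if "T m \<le> t" for t
    proof (rule ccontr)
      assume "\<not> m \<le> N t"
      then have "T (Suc (N t)) \<le> T m" using T(1) by (simp add: strict_mono_less_eq)
      then show False using N2[of t] that by simp
    qed
    then show "eventually (\<lambda>t. m \<le> N t) sequentially" by (rule eventually_sequentiallyI)
  qed
  then show thesis using that N1 N2 N3 by blast
qed

lemma renewal_lower:
  fixes T N :: "nat \<Rightarrow> nat" and A S :: "nat \<Rightarrow> real"
  assumes N: "filterlim N at_top sequentially" "\<And>t. 1 \<le> t \<Longrightarrow> t < T (Suc (N t))" "\<And>t. 1 \<le> t \<Longrightarrow> N t + 1 \<le> t"
    and S: "\<And>t. 1 \<le> t \<Longrightarrow> A (N t) \<le> S t"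
    and TU: "eventually (\<lambda>n. real (T n) - 1 \<le> K * (real n powr q0 * ln (real n) powr bT)) sequentially"
    and AL: "eventually (\<lambda>n. real n powr q * ln (real n) powr (- bA) \<le> A n) sequentially"
    and pos: "0 < K" "0 < q0" "0 \<le> bT" "0 < q" "0 \<le> bA" and e: "q * bT / q0 + bA < e"
  shows "eventually (\<lambda>t. real t powr (q / q0) * ln (real t) powr (- e) \<le> S t) sequentially"
proof -
  define K' where "K' = 2 powr q * K powr (q / q0)"
  have K': "0 < K'" using pos by (simp add: K'_def)
  have e1: "eventually (\<lambda>t. real (T (Suc (N t))) - 1 \<le> K * (real (Suc (N t)) powr q0 * ln (real (Suc (N t))) powr bT)) sequentially"
    using eventually_compose_filterlim[OF TU filterlim_compose[OF filterlim_Suc N(1)]] by simp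
  have e2: "eventually (\<lambda>t. real (N t) powr q * ln (real (N t)) powr (- bA) \<le> A (N t)) sequentially"
    by (rule eventually_compose_filterlim[OF AL N(1)])
  have e3: "eventually (\<lambda>t. 3 \<le> N t) sequentially" using N(1) by (simp add: filterlim_at_top)
  have e4: "eventually (\<lambda>t. K' \<le> ln (real t) powr (e - (q * bT / q0 + bA))) sequentially"
    using e by (intro eventually_le_ln_powr) simp
  from e1 e2 e3 e4 eventually_ge_at_top[of "1::nat"] show ?thesis
  proof eventually_elim
    case (elim t)
    define n where "n = N t"
    define L where "L = ln (real t)"
    have n3: "3 \<le> n" and nt: "n + 1 \<le> t" using elim N(3)[of t] by (auto simp: n_def)
    have ln1: "1 \<le> ln (real n)" using n3 exp_le by (intro ln_ge_1) linarith
    have nL: "ln (real (Suc n)) \<le> L" "ln (real n) \<le> L" using n3 nt by (auto simp: L_def)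
    have L: "1 \<le> L" using ln1 nL by linarith
    have t0: "0 < real t" using nt by simp
    have "real t \<le> real (T (Suc n)) - 1" using N(2)[OF elim(5)] by (simp add: n_def)
    also have "\<dots> \<le> K * (real (Suc n) powr q0 * ln (real (Suc n)) powr bT)" using elim(1) by (simp add: n_def)
    also have "\<dots> \<le> K * ((2 * real n) powr q0 * L powr bT)"
      using pos n3 nL by (intro mult_left_mono mult_mono powr_mono2) auto
    finally have "real t powr (q / q0) \<le> (K * ((2 * real n) powr q0 * L powr bT)) powr (q / q0)"
      using pos by (intro powr_mono2) auto
    also have "\<dots> = K powr (q / q0) * ((2 * real n) powr (q0 * (q / q0)) * L powr (bT * (q / q0)))"
      by (simp only: powr_mult powr_powr)
    also have "q0 * (q / q0) = q" using pos by simp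
    also have "(2 * real n) powr q = 2 powr q * real n powr q" by (rule powr_mult)
    finally have "real t powr (q / q0) \<le> K' * (real n powr q * L powr (bT * (q / q0)))"
      by (simp add: K'_def mult_ac)
    then have "real t powr (q / q0) * L powr (- e) \<le> K' * (real n powr q * L powr (bT * (q / q0))) * L powr (- e)"
      by (rule mult_right_mono) simp
    also have "\<dots> \<le> L powr (e - (q * bT / q0 + bA)) * (real n powr q * L powr (bT * (q / q0))) * L powr (- e)"
      using elim(4) unfolding L_def by (intro mult_right_mono) auto
    also have "\<dots> = real n powr q * (L powr (e - (q * bT / q0 + bA)) * L powr (bT * (q / q0)) * L powr (- e))" by (simp add: mult_ac)
    also have "L powr (e - (q * bT / q0 + bA)) * L powr (bT * (q / q0)) * L powr (- e) = L powr (- bA)"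
      by (simp flip: powr_add)
    also have "real n powr q * L powr (- bA) \<le> real n powr q * ln (real n) powr (- bA)"
      using nL ln1 pos by (intro mult_left_mono powr_mono2') auto
    also have "\<dots> \<le> A n" using elim(2) by (simp add: n_def)
    also have "\<dots> \<le> S t" using S[OF elim(5)] by (simp add: n_def)
    finally show ?case unfolding L_def .
  qed
qed

lemma renewal_upper:
  fixes T N :: "nat \<Rightarrow> nat" and A S :: "nat \<Rightarrow> real"
  assumes N: "filterlim N at_top sequentially" "\<And>t. 1 \<le> t \<Longrightarrow> T (N t) \<le> t" "\<And>t. 1 \<le> t \<Longrightarrow> N t + 1 \<le> t"
    and S: "\<And>t. 1 \<le> t \<Longrightarrow> S t \<le> A (Suc (N t))"
    and TL: "eventually (\<lambda>n. real n powr q0 * ln (real n) powr (- bT) \<le> real (T n) - 1) sequentially"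
    and AU: "eventually (\<lambda>n. A n \<le> real n powr q * ln (real n) powr bA) sequentially"
    and pos: "0 < q0" "0 \<le> bT" "0 < q" "0 \<le> bA" and e: "q * bT / q0 + bA < e"
  shows "eventually (\<lambda>t. S t \<le> real t powr (q / q0) * ln (real t) powr e) sequentially"
proof -
  have e1: "eventually (\<lambda>t. A (Suc (N t)) \<le> real (Suc (N t)) powr q * ln (real (Suc (N t))) powr bA) sequentially"
    using eventually_compose_filterlim[OF AU filterlim_compose[OF filterlim_Suc N(1)]] by simp
  have e2: "eventually (\<lambda>t. real (N t) powr q0 * ln (real (N t)) powr (- bT) \<le> real (T (N t)) - 1) sequentially"
    by (rule eventually_compose_filterlim[OF TL N(1)])
  have e3: "eventually (\<lambda>t. 3 \<le> N t) sequentially" using N(1) by (simp add: filterlim_at_top)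
  have e4: "eventually (\<lambda>t. 2 powr q \<le> ln (real t) powr (e - (q * bT / q0 + bA))) sequentially"
    using e by (intro eventually_le_ln_powr) simp
  from e1 e2 e3 e4 eventually_ge_at_top[of "1::nat"] show ?thesis
  proof eventually_elim
    case (elim t)
    define n where "n = N t"
    define L where "L = ln (real t)"
    have n3: "3 \<le> n" and nt: "n + 1 \<le> t" using elim N(3)[of t] by (auto simp: n_def)
    have ln1: "1 \<le> ln (real n)" using n3 exp_le by (intro ln_ge_1) linarith
    have nL: "ln (real (Suc n)) \<le> L" "ln (real n) \<le> L" using n3 nt by (auto simp: L_def)
    have L: "1 \<le> L" using ln1 nL by linarith
    have "real n powr q0 * L powr (- bT) \<le> real n powr q0 * ln (real n) powr (- bT)"
      using nL ln1 pos by (intro mult_left_mono powr_mono2') auto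
    also have "\<dots> \<le> real (T n) - 1" using elim(2) by (simp add: n_def)
    also have "\<dots> \<le> real t" using N(2)[OF elim(5)] by (simp add: n_def)
    finally have "real n powr q0 \<le> real t * L powr bT" using L by (simp add: powr_minus field_simps)
    then have "(real n powr q0) powr (q / q0) \<le> (real t * L powr bT) powr (q / q0)" using pos by (intro powr_mono2) auto
    also have "\<dots> = real t powr (q / q0) * L powr (bT * (q / q0))" by (simp only: powr_mult powr_powr)
    finally have nq: "real n powr q \<le> real t powr (q / q0) * L powr (bT * (q / q0))" using pos by (simp add: powr_powr)
    have "S t \<le> A (Suc n)" using S[OF elim(5)] by (simp add: n_def)
    also have "\<dots> \<le> real (Suc n) powr q * ln (real (Suc n)) powr bA" using elim(1) by (simp add: n_def)
    also have "\<dots> \<le> (2 * real n) powr q * L powr bA"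
      using pos n3 nL by (intro mult_mono powr_mono2) auto
    also have "\<dots> = 2 powr q * real n powr q * L powr bA" by (simp only: powr_mult)
    also have "\<dots> \<le> L powr (e - (q * bT / q0 + bA)) * (real t powr (q / q0) * L powr (bT * (q / q0))) * L powr bA"
      using elim(4) nq unfolding L_def by (intro mult_right_mono mult_mono) auto
    also have "\<dots> = real t powr (q / q0) * (L powr (e - (q * bT / q0 + bA)) * L powr (bT * (q / q0)) * L powr bA)" by (simp add: mult_ac)
    also have "L powr (e - (q * bT / q0 + bA)) * L powr (bT * (q / q0)) * L powr bA = L powr e"
      by (simp flip: powr_add)
    finally show ?case unfolding L_def .
  qed
qed

lemma renewal_ratio:
  fixes T N :: "nat \<Rightarrow> nat" and A S :: "nat \<Rightarrow> real"
  assumes N: "filterlim N at_top sequentially" "\<And>t. 1 \<le> t \<Longrightarrow> T (N t) \<le> t" "\<And>t. 1 \<le> t \<Longrightarrow> t < T (Suc (N t))"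
    and S: "\<And>t. 1 \<le> t \<Longrightarrow> A (N t) \<le> S t" "\<And>t. 1 \<le> t \<Longrightarrow> S t \<le> A (Suc (N t))" and A0: "\<And>n. 0 \<le> A n" and Tpos: "\<And>n. 0 < T n"
    and TL: "(\<lambda>n. (real (T n) - 1) / real n) \<longlonglongrightarrow> u" and AL: "(\<lambda>n. A n / real n) \<longlonglongrightarrow> v" and u: "0 < u"
  shows "(\<lambda>t. S t / real t) \<longlonglongrightarrow> v / u"
proof -
  have i0: "(\<lambda>n. 1 / real n) \<longlonglongrightarrow> 0" by (rule lim_1_over_n)
  have T1: "(\<lambda>n. real (T n) / real n) \<longlonglongrightarrow> u"
    using tendsto_add[OF TL i0] by (simp add: add_divide_distrib[symmetric])
  have sn: "(\<lambda>n. real (Suc n) / real n) \<longlonglongrightarrow> 1"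
  proof -
    have "(\<lambda>n. 1 + 1 / real n) \<longlonglongrightarrow> 1 + 0" by (intro tendsto_add tendsto_const i0)
    moreover have "eventually (\<lambda>n. 1 + 1 / real n = real (Suc n) / real n) sequentially"
      using eventually_gt_at_top[of 0] by eventually_elim (simp add: field_simps)
    ultimately show ?thesis using Lim_transform_eventually by fastforce
  qed
  have shift: "(\<lambda>n. f (Suc n) / real n) \<longlonglongrightarrow> l" if "(\<lambda>n. f n / real n) \<longlonglongrightarrow> l" for f :: "nat \<Rightarrow> real" and l
  proof -
    have "(\<lambda>n. f (Suc n) / real (Suc n) * (real (Suc n) / real n)) \<longlonglongrightarrow> l * 1"
      using that by (intro tendsto_mult sn) (rule LIMSEQ_Suc)
    then show ?thesis by simp
  qed
  have lo: "(\<lambda>n. (A n / real n) / (real (T (Suc n)) / real n)) \<longlonglongrightarrow> v / u"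
    using u by (intro tendsto_divide AL shift[of "\<lambda>n. real (T n)"] T1) auto
  have up: "(\<lambda>n. (A (Suc n) / real n) / (real (T n) / real n)) \<longlonglongrightarrow> v / u"
    using u by (intro tendsto_divide T1 shift[of A] AL) auto
  have e3: "eventually (\<lambda>t. 1 \<le> N t) sequentially" using N(1) by (simp add: filterlim_at_top)
  show ?thesis
  proof (rule tendsto_sandwich[OF _ _ filterlim_compose[OF lo N(1)] filterlim_compose[OF up N(1)]])
    show "eventually (\<lambda>t. (A (N t) / real (N t)) / (real (T (Suc (N t))) / real (N t)) \<le> S t / real t) sequentially"
      using e3 eventually_ge_at_top[of "1::nat"]
    proof eventually_elim
      case (elim t)
      have "A (N t) / real (T (Suc (N t))) \<le> S t / real t"
        using S(1)[OF elim(2)] A0[of "N t"] N(3)[OF elim(2)] elim by (intro frac_le) auto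
      then show ?case using elim by simp
    qed
    show "eventually (\<lambda>t. S t / real t \<le> (A (Suc (N t)) / real (N t)) / (real (T (N t)) / real (N t))) sequentially"
      using e3 eventually_ge_at_top[of "1::nat"]
    proof eventually_elim
      case (elim t)
      have "S t / real t \<le> A (Suc (N t)) / real (T (N t))"
        using S(2)[OF elim(2)] A0[of "Suc (N t)"] N(2)[OF elim(2)] Tpos[of "N t"] by (intro frac_le) auto
      then show ?case using elim by simp
    qed
  qed
qed

context lamperti begin

lemma rpow_nonneg: "0 \<le> rpow x a" by (simp add: rpow_def)

lemma rpow_0: "rpow x 0 = 1" by (simp add: rpow_def)

lemma path_renewal:
  assumes fin: "\<And>n. tau X n \<omega> \<noteq> \<infinity>"
  obtains N where "filterlim N at_top sequentially"
    "\<And>t. 1 \<le> t \<Longrightarrow> return_time X (N t) \<omega> \<le> t" "\<And>t. 1 \<le> t \<Longrightarrow> t < return_time X (Suc (N t)) \<omega>" "\<And>t. 1 \<le> t \<Longrightarrow> N t + 1 \<le> t"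
    "\<And>t \<alpha>. 1 \<le> t \<Longrightarrow> (\<Sum>k<N t. esum (\<lambda>x. rpow x \<alpha>) k \<omega>) \<le> Salpha X \<alpha> t \<omega>"
    "\<And>t \<alpha>. 1 \<le> t \<Longrightarrow> Salpha X \<alpha> t \<omega> \<le> (\<Sum>k<Suc (N t). esum (\<lambda>x. rpow x \<alpha>) k \<omega>)"
proof -
  obtain N where N: "filterlim N at_top sequentially"
    "\<And>t. 1 \<le> t \<Longrightarrow> return_time X (N t) \<omega> \<le> t" "\<And>t. 1 \<le> t \<Longrightarrow> t < return_time X (Suc (N t)) \<omega>" "\<And>t. 1 \<le> t \<Longrightarrow> N t + 1 \<le> t"
    by (rule renewal_index[OF return_time_strict_mono[OF fin] return_time_0[OF fin]]) blast
  have eq: "(\<Sum>k<n. esum (\<lambda>x. rpow x \<alpha>) k \<omega>) = (\<Sum>t=1..<return_time X n \<omega>. rpow (X t \<omega>) \<alpha>)" for n \<alpha>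
    unfolding esum_def by (rule sum_excursions[OF fin])
  show thesis
  proof (rule that[OF N])
    fix t :: nat and \<alpha> :: real assume t: "1 \<le> t"
    show "(\<Sum>k<N t. esum (\<lambda>x. rpow x \<alpha>) k \<omega>) \<le> Salpha X \<alpha> t \<omega>"
      unfolding eq Salpha_def using N(2)[OF t] by (intro sum_mono2) (auto simp: rpow_nonneg)
    show "Salpha X \<alpha> t \<omega> \<le> (\<Sum>k<Suc (N t). esum (\<lambda>x. rpow x \<alpha>) k \<omega>)"
      unfolding eq Salpha_def using N(3)[OF t] by (intro sum_mono2) (auto simp: rpow_nonneg)
  qed
qed

lemma return_time_eq_esum:
  assumes fin: "\<And>n. tau X n \<omega> \<noteq> \<infinity>" shows "real (return_time X n \<omega>) - 1 = (\<Sum>k<n. esum (\<lambda>x. rpow x 0) k \<omega>)"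
proof -
  have "(\<Sum>k<n. esum (\<lambda>x. rpow x 0) k \<omega>) = (\<Sum>t=1..<return_time X n \<omega>. rpow (X t \<omega>) 0)"
    unfolding esum_def by (rule sum_excursions[OF fin])
  then show ?thesis using return_time_gt[OF fin, of n] by (simp add: rpow_0)
qed

lemma esum_integrable:
  assumes \<alpha>: "0 \<le> \<alpha>" "1 + \<alpha> < r"
  shows "integrable M (esum (\<lambda>x. rpow x \<alpha>) 0)"
proof -
  define a where "a = min (1 + r) 1"
  have a: "0 < a" "a \<le> 1 + r" using r_gt by (auto simp: a_def)
  obtain K where K: "0 < K" "\<And>u. exp 1 \<le> u \<Longrightarrow> powln (\<alpha> - (r - 1)) (a + 1) u \<le> K * u powr (\<alpha> - (r - 1) + (r - 1 - \<alpha>))"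
    using powln_le_powr[of "r - 1 - \<alpha>" "\<alpha> - (r - 1)" "a + 1"] \<alpha> by auto
  have le: "rpow x \<alpha> \<le> K * lyap_rate (- a) x" if x: "0 \<le> x" for x
  proof -
    define u where "u = max x (exp 1)"
    have u: "exp 1 \<le> u" "1 < u" using max_e_gt_1[of x] by (auto simp: u_def)
    have "rpow x \<alpha> \<le> u powr \<alpha>" unfolding u_def by (rule rpow_le_max[OF \<alpha>(1) x])
    also have "u powr \<alpha> = powln (\<alpha> - (r - 1)) (a + 1) u * lyap_rate (- a) x"
    proof -
      have "powln (\<alpha> - (r - 1)) (a + 1) u * lyap_rate (- a) x = (u powr (\<alpha> - (r - 1)) * u powr (r - 1)) * (ln u powr (a + 1) * ln u powr (- a - 1))"
        unfolding lyap_rate_def u_def[symmetric] powln_def by simp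
      also have "\<dots> = u powr \<alpha> * 1" using u by (simp flip: powr_add)
      finally show ?thesis by simp
    qed
    also have "\<dots> \<le> K * lyap_rate (- a) x"
      using K(2)[OF u(1)] u lyap_rate_pos[of "- a" x] by (intro mult_right_mono) auto
    finally show ?thesis .
  qed
  show ?thesis
  proof (rule Bochner_Integration.integrable_bound[OF integrable_mult_right[OF lyap_rate_integrable[OF a], of K]])
    show "AE \<omega> in M. norm (esum (\<lambda>x. rpow x \<alpha>) 0 \<omega>) \<le> norm (K * esum (lyap_rate (- a)) 0 \<omega>)"
      using AE_excursion_nonneg
    proof eventually_elim
      case (elim \<omega>)
      have "esum (\<lambda>x. rpow x \<alpha>) 0 \<omega> \<le> K * esum (lyap_rate (- a)) 0 \<omega>"
        using elim le by (intro esum_dominated rpow_nonneg) auto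
      moreover have "0 \<le> esum (\<lambda>x. rpow x \<alpha>) 0 \<omega>" by (rule esum_nonneg) (rule rpow_nonneg)
      ultimately show ?case by simp
    qed
  qed simp
qed

lemma esum_expectation_pos:
  assumes \<alpha>: "0 \<le> \<alpha>" and int: "integrable M (esum (\<lambda>x. rpow x \<alpha>) 0)"
  shows "0 < expectation (esum (\<lambda>x. rpow x \<alpha>) 0)"
proof -
  define a where "a = min (1 + r) 1"
  have a: "0 < a" "a \<le> 1 + r" using r_gt by (auto simp: a_def)
  obtain c2 d n3 where c2: "0 < c2" and d: "0 < d" and n3: "0 < n3"
    and tail: "\<forall>n\<ge>n3. c2 / lyap a (2 * n) \<le> prob {\<omega> \<in> space M. d * n powr (\<alpha> + 2) \<le> esum (\<lambda>x. rpow x \<alpha>) 0 \<omega>}"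
    using esum_lower_tail[OF a \<alpha>] by (elim exE conjE)
  define z where "z = d * n3 powr (\<alpha> + 2)"
  have z: "0 < z" using d n3 by (simp add: z_def)
  define P where "P = {\<omega> \<in> space M. z \<le> esum (\<lambda>x. rpow x \<alpha>) 0 \<omega>}"
  have PM: "P \<in> sets M" unfolding P_def by measurable
  have "0 < c2 / lyap a (2 * n3)" using c2 lyap_pos by simp
  also have "\<dots> \<le> prob P" using tail[rule_format, of n3] by (simp add: P_def z_def)
  finally have p: "0 < prob P" .
  have "0 < z * prob P" using z p by simp
  also have "\<dots> = (\<integral>\<omega>. z * indicator P \<omega> \<partial>M)" using PM by simp
  also have "\<dots> \<le> expectation (esum (\<lambda>x. rpow x \<alpha>) 0)"
  proof (rule integral_mono[OF _ int])
    show "integrable M (\<lambda>\<omega>. z * indicator P \<omega>)"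
      using PM by (intro integrable_mult_right integrable_real_indicator) (auto simp: emeasure_eq_measure)
    show "z * indicator P \<omega> \<le> esum (\<lambda>x. rpow x \<alpha>) 0 \<omega>" for \<omega>
      using esum_nonneg[of "\<lambda>x. rpow x \<alpha>" 0 \<omega>] by (auto simp: P_def indicator_def rpow_nonneg)
  qed
  finally show ?thesis .
qed

lemma xi1_eq:
  assumes fin: "\<And>n. tau X n \<omega> \<noteq> \<infinity>" shows "xi1 X \<alpha> \<omega> = ennreal (esum (\<lambda>x. rpow x \<alpha>) 0 \<omega>)"
proof -
  have tau: "tau X 0 \<omega> = enat 1" "tau X 1 \<omega> = enat (return_time X 1 \<omega>)" using tau_return_time[OF fin, of 1] by auto
  have "xi1 X \<alpha> \<omega> = (\<Sum>t\<in>{1..<return_time X 1 \<omega>}. if enat t \<ge> tau X 0 \<omega> \<and> enat t < tau X 1 \<omega> then ennreal (rpow (X t \<omega>) \<alpha>) else 0)"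
    unfolding xi1_def tau by (intro suminf_finite) auto
  also have "\<dots> = (\<Sum>t\<in>{1..<return_time X 1 \<omega>}. ennreal (rpow (X t \<omega>) \<alpha>))" unfolding tau by (intro sum.cong) auto
  also have "\<dots> = ennreal (\<Sum>t=1..<return_time X 1 \<omega>. rpow (X t \<omega>) \<alpha>)" by (intro sum_ennreal) (rule rpow_nonneg)
  also have "(\<Sum>t=1..<return_time X 1 \<omega>. rpow (X t \<omega>) \<alpha>) = esum (\<lambda>x. rpow x \<alpha>) 0 \<omega>"
    unfolding esum_def sum_list_excursion[OF fin] return_time_0[OF fin] by simp
  finally show ?thesis .
qed

lemma ell1_eq:
  assumes fin: "\<And>n. tau X n \<omega> \<noteq> \<infinity>" shows "ell1 X x \<omega> = ennreal (esum (indicator {x}) 0 \<omega>)"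
proof -
  have tau: "tau X 0 \<omega> = enat 1" "tau X 1 \<omega> = enat (return_time X 1 \<omega>)" using tau_return_time[OF fin, of 1] by auto
  have "ell1 X x \<omega> = (\<Sum>t\<in>{1..<return_time X 1 \<omega>}. if enat t \<ge> tau X 0 \<omega> \<and> enat t < tau X 1 \<omega> \<and> X t \<omega> = x then 1 else 0)"
    unfolding ell1_def tau by (intro suminf_finite) auto
  also have "\<dots> = (\<Sum>t\<in>{1..<return_time X 1 \<omega>}. ennreal (indicator {x} (X t \<omega>)))" unfolding tau by (intro sum.cong) auto
  also have "\<dots> = ennreal (\<Sum>t=1..<return_time X 1 \<omega>. indicator {x} (X t \<omega>))" by (intro sum_ennreal) simp
  also have "(\<Sum>t=1..<return_time X 1 \<omega>. indicator {x} (X t \<omega>)) = esum (indicator {x}) 0 \<omega>"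
    unfolding esum_def sum_list_excursion[OF fin] return_time_0[OF fin] by simp
  finally show ?thesis .
qed

lemma eta1_eq:
  assumes fin: "\<And>n. tau X n \<omega> \<noteq> \<infinity>" shows "ennreal_of_enat (eta X 1 \<omega>) = ennreal (esum (\<lambda>x. rpow x 0) 0 \<omega>)"
proof -
  have "eta X 1 \<omega> = enat (return_time X 1 \<omega> - 1)"
    unfolding eta_def using tau_return_time[OF fin, of 1] by simp
  moreover have "real (return_time X 1 \<omega>) - 1 = esum (\<lambda>x. rpow x 0) 0 \<omega>" using return_time_eq_esum[OF fin, of 1] by simp
  moreover have "1 \<le> return_time X 1 \<omega>" using return_time_gt[OF fin, of 1] by simp
  ultimately show ?thesis by (simp add: ennreal_of_nat_eq_real_of_nat of_nat_diff)
qed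

lemma nn_integral_xi1_eq_infsum:
  "(\<integral>\<^sup>+\<omega>. xi1 X \<alpha> \<omega> \<partial>M) = (\<Sum>\<^sub>\<infinity>x\<in>S. ennreal (rpow x \<alpha>) * (\<integral>\<^sup>+\<omega>. ell1 X x \<omega> \<partial>M))"
proof -
  have ax: "(\<integral>\<^sup>+\<omega>. xi1 X \<alpha> \<omega> \<partial>M) = (\<integral>\<^sup>+\<omega>. ennreal (esum (\<lambda>x. rpow x \<alpha>) 0 \<omega>) \<partial>M)"
    by (rule nn_integral_cong_AE) (use AE_tau_finite in eventually_elim, rule xi1_eq, simp)
  have al: "(\<integral>\<^sup>+\<omega>. ell1 X x \<omega> \<partial>M) = (\<integral>\<^sup>+\<omega>. ennreal (esum (indicator {x}) 0 \<omega>) \<partial>M)" for x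
    by (rule nn_integral_cong_AE) (use AE_tau_finite in eventually_elim, rule ell1_eq, simp)
  have fs: "(\<Sum>x\<in>G. ennreal (rpow x \<alpha>) * (\<integral>\<^sup>+\<omega>. ell1 X x \<omega> \<partial>M))
      = (\<integral>\<^sup>+\<omega>. ennreal (esum (\<lambda>z. if z \<in> G then rpow z \<alpha> else 0) 0 \<omega>) \<partial>M)" if G: "finite G" for G
  proof -
    have "(\<Sum>x\<in>G. ennreal (rpow x \<alpha>) * (\<integral>\<^sup>+\<omega>. ell1 X x \<omega> \<partial>M)) = (\<Sum>x\<in>G. \<integral>\<^sup>+\<omega>. ennreal (rpow x \<alpha>) * ennreal (esum (indicator {x}) 0 \<omega>) \<partial>M)"
      unfolding al by (intro sum.cong refl nn_integral_cmult[symmetric]) measurable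
    also have "\<dots> = (\<integral>\<^sup>+\<omega>. (\<Sum>x\<in>G. ennreal (rpow x \<alpha>) * ennreal (esum (indicator {x}) 0 \<omega>)) \<partial>M)"
      by (rule nn_integral_sum[symmetric]) measurable
    also have "\<dots> = (\<integral>\<^sup>+\<omega>. ennreal (esum (\<lambda>z. if z \<in> G then rpow z \<alpha> else 0) 0 \<omega>) \<partial>M)"
    proof (rule nn_integral_cong)
      fix \<omega>
      have "(\<Sum>x\<in>G. rpow x \<alpha> * sum_list (map (indicator {x}) l)) = sum_list (map (\<lambda>z. if z \<in> G then rpow z \<alpha> else 0) l)" for l
      proof (induction l)
        case (Cons z l)
        have "(\<Sum>x\<in>G. rpow x \<alpha> * indicator {x} z) = (\<Sum>x\<in>G. if x = z then rpow x \<alpha> else 0)"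
          by (intro sum.cong) (auto simp: indicator_def)
        also have "\<dots> = (if z \<in> G then rpow z \<alpha> else 0)" using G by simp
        finally show ?case using Cons by (simp add: distrib_left sum.distrib)
      qed simp
      then have "(\<Sum>x\<in>G. rpow x \<alpha> * esum (indicator {x}) 0 \<omega>) = esum (\<lambda>z. if z \<in> G then rpow z \<alpha> else 0) 0 \<omega>"
        unfolding esum_def .
      moreover have "(\<Sum>x\<in>G. ennreal (rpow x \<alpha>) * ennreal (esum (indicator {x}) 0 \<omega>)) = ennreal (\<Sum>x\<in>G. rpow x \<alpha> * esum (indicator {x}) 0 \<omega>)"
      proof -
        have nn: "0 \<le> esum (indicator {x}) 0 \<omega>" for x by (rule esum_nonneg) simp
        show ?thesis by (subst sum_ennreal[symmetric]) (auto simp: nn rpow_nonneg ennreal_mult)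
      qed
      ultimately show "(\<Sum>x\<in>G. ennreal (rpow x \<alpha>) * ennreal (esum (indicator {x}) 0 \<omega>)) = ennreal (esum (\<lambda>z. if z \<in> G then rpow z \<alpha> else 0) 0 \<omega>)" by simp
    qed
    finally show ?thesis .
  qed
  have mono: "esum (\<lambda>z. if z \<in> G then rpow z \<alpha> else 0) 0 \<omega> \<le> esum (\<lambda>z. rpow z \<alpha>) 0 \<omega>" for G \<omega>
    unfolding esum_def by (rule sum_list_mono) (simp add: rpow_nonneg)
  have inf: "(\<Sum>\<^sub>\<infinity>x\<in>S. ennreal (rpow x \<alpha>) * (\<integral>\<^sup>+\<omega>. ell1 X x \<omega> \<partial>M))
     = (SUP G\<in>{G. finite G \<and> G \<subseteq> S}. (\<Sum>x\<in>G. ennreal (rpow x \<alpha>) * (\<integral>\<^sup>+\<omega>. ell1 X x \<omega> \<partial>M)))"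
    by (rule nonneg_infsum_complete) simp
  show ?thesis
  proof (rule antisym)
    define Gn where "Gn = (\<lambda>n::nat. {x \<in> S. x < real n})"
    have "(\<lambda>n. \<integral>\<^sup>+\<omega>. ennreal (esum (\<lambda>z. if z \<in> Gn n then rpow z \<alpha> else 0) 0 \<omega>) \<partial>M)
        \<longlonglongrightarrow> (\<integral>\<^sup>+\<omega>. ennreal (esum (\<lambda>z. if z \<in> S then rpow z \<alpha> else 0) 0 \<omega>) \<partial>M)"
    proof (rule nn_integral_LIMSEQ)
      show "incseq (\<lambda>n \<omega>. ennreal (esum (\<lambda>z. if z \<in> Gn n then rpow z \<alpha> else 0) 0 \<omega>))"
        unfolding incseq_def le_fun_def esum_def Gn_def
        by (intro allI impI ennreal_leI sum_list_mono) (auto simp: rpow_nonneg)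
      fix \<omega>
      obtain n0 :: nat where n0: "Max (insert 0 (set (excursion X (Suc 0) \<omega>))) < real n0" using reals_Archimedean2 by blast
      have "esum (\<lambda>z. if z \<in> Gn n then rpow z \<alpha> else 0) 0 \<omega> = esum (\<lambda>z. if z \<in> S then rpow z \<alpha> else 0) 0 \<omega>" if n: "n0 \<le> n" for n
        unfolding esum_def
      proof (intro arg_cong[where f = sum_list] map_cong refl)
        fix z assume "z \<in> set (excursion X (Suc 0) \<omega>)"
        then have "z \<le> Max (insert 0 (set (excursion X (Suc 0) \<omega>)))" by (intro Max_ge) auto
        then have "z < real n" using n0 n by linarith
        then show "(if z \<in> Gn n then rpow z \<alpha> else 0) = (if z \<in> S then rpow z \<alpha> else 0)" by (simp add: Gn_def)
      qed
      then show "(\<lambda>n. ennreal (esum (\<lambda>z. if z \<in> Gn n then rpow z \<alpha> else 0) 0 \<omega>)) \<longlonglongrightarrow> ennreal (esum (\<lambda>z. if z \<in> S then rpow z \<alpha> else 0) 0 \<omega>)"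
        by (intro tendsto_eventually eventually_sequentiallyI[of n0]) (simp only:)
    qed measurable
    also have "(\<integral>\<^sup>+\<omega>. ennreal (esum (\<lambda>z. if z \<in> S then rpow z \<alpha> else 0) 0 \<omega>) \<partial>M) = (\<integral>\<^sup>+\<omega>. xi1 X \<alpha> \<omega> \<partial>M)"
      unfolding ax
    proof (rule nn_integral_cong_AE)
      show "AE \<omega> in M. ennreal (esum (\<lambda>z. if z \<in> S then rpow z \<alpha> else 0) 0 \<omega>) = ennreal (esum (\<lambda>z. rpow z \<alpha>) 0 \<omega>)"
        using AE_tau_finite AE_space
      proof eventually_elim
        case (elim \<omega>)
        then have fin: "\<And>n. tau X n \<omega> \<noteq> \<infinity>" by simp
        have "z \<in> S" if z: "z \<in> set (excursion X (Suc 0) \<omega>)" for z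
        proof -
          obtain t where "return_time X 0 \<omega> \<le> t" "z = X t \<omega>" using z unfolding excursion_Suc[OF fin] by auto
          then show ?thesis using X_in_S[OF _ elim(2)] return_time_0[OF fin] by simp
        qed
        then have "map (\<lambda>z. if z \<in> S then rpow z \<alpha> else 0) (excursion X (Suc 0) \<omega>) = map (\<lambda>z. rpow z \<alpha>) (excursion X (Suc 0) \<omega>)"
          by (intro map_cong refl) simp
        then show ?case unfolding esum_def by (simp only:)
      qed
    qed
    finally have "(\<lambda>n. \<integral>\<^sup>+\<omega>. ennreal (esum (\<lambda>z. if z \<in> Gn n then rpow z \<alpha> else 0) 0 \<omega>) \<partial>M) \<longlonglongrightarrow> (\<integral>\<^sup>+\<omega>. xi1 X \<alpha> \<omega> \<partial>M)" .
    then show "(\<integral>\<^sup>+\<omega>. xi1 X \<alpha> \<omega> \<partial>M) \<le> (\<Sum>\<^sub>\<infinity>x\<in>S. ennreal (rpow x \<alpha>) * (\<integral>\<^sup>+\<omega>. ell1 X x \<omega> \<partial>M))"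
    proof (rule LIMSEQ_le_const2)
      have "(\<integral>\<^sup>+\<omega>. ennreal (esum (\<lambda>z. if z \<in> Gn n then rpow z \<alpha> else 0) 0 \<omega>) \<partial>M) \<le> (\<Sum>\<^sub>\<infinity>x\<in>S. ennreal (rpow x \<alpha>) * (\<integral>\<^sup>+\<omega>. ell1 X x \<omega> \<partial>M))" for n
        unfolding inf using finite_S_below[of "real n"]
        by (intro SUP_upper2[of "Gn n"]) (auto simp: fs Gn_def)
      then show "\<exists>N. \<forall>n\<ge>N. (\<integral>\<^sup>+\<omega>. ennreal (esum (\<lambda>z. if z \<in> Gn n then rpow z \<alpha> else 0) 0 \<omega>) \<partial>M) \<le> (\<Sum>\<^sub>\<infinity>x\<in>S. ennreal (rpow x \<alpha>) * (\<integral>\<^sup>+\<omega>. ell1 X x \<omega> \<partial>M))"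
        by blast
    qed
  next
    show "(\<Sum>\<^sub>\<infinity>x\<in>S. ennreal (rpow x \<alpha>) * (\<integral>\<^sup>+\<omega>. ell1 X x \<omega> \<partial>M)) \<le> (\<integral>\<^sup>+\<omega>. xi1 X \<alpha> \<omega> \<partial>M)"
      unfolding inf ax
    proof (rule SUP_least)
      fix G assume "G \<in> {G. finite G \<and> G \<subseteq> S}"
      then show "(\<Sum>x\<in>G. ennreal (rpow x \<alpha>) * (\<integral>\<^sup>+\<omega>. ell1 X x \<omega> \<partial>M)) \<le> (\<integral>\<^sup>+\<omega>. ennreal (esum (\<lambda>x. rpow x \<alpha>) 0 \<omega>) \<partial>M)"
        by (subst fs) (auto intro!: nn_integral_mono ennreal_leI mono)
    qed
  qed
qed

lemma infsum_stat_pi: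
  "(\<Sum>\<^sub>\<infinity>x\<in>S. ennreal (rpow x \<alpha>) * stat_pi M X x)
     = (\<integral>\<^sup>+\<omega>. xi1 X \<alpha> \<omega> \<partial>M) / (\<integral>\<^sup>+\<omega>. ennreal_of_enat (eta X 1 \<omega>) \<partial>M)"
proof -
  define E where "E = (\<integral>\<^sup>+\<omega>. ennreal_of_enat (eta X 1 \<omega>) \<partial>M)"
  define f where "f = (\<lambda>x. ennreal (rpow x \<alpha>) * (\<integral>\<^sup>+\<omega>. ell1 X x \<omega> \<partial>M))"
  have "(\<Sum>\<^sub>\<infinity>x\<in>S. ennreal (rpow x \<alpha>) * stat_pi M X x) = (\<Sum>\<^sub>\<infinity>x\<in>S. inverse E * f x)"
    by (rule infsum_cong) (simp add: stat_pi_def f_def E_def divide_ennreal_def mult_ac)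
  also have "\<dots> = (SUP G\<in>{G. finite G \<and> G \<subseteq> S}. \<Sum>x\<in>G. inverse E * f x)"
    by (rule nonneg_infsum_complete) simp
  also have "\<dots> = (SUP G\<in>{G. finite G \<and> G \<subseteq> S}. inverse E * (\<Sum>x\<in>G. f x))"
    by (simp add: sum_distrib_left)
  also have "\<dots> = inverse E * (SUP G\<in>{G. finite G \<and> G \<subseteq> S}. \<Sum>x\<in>G. f x)"
    by (rule SUP_mult_left_ennreal[symmetric])
  also have "(SUP G\<in>{G. finite G \<and> G \<subseteq> S}. \<Sum>x\<in>G. f x) = (\<Sum>\<^sub>\<infinity>x\<in>S. f x)"
    by (rule nonneg_infsum_complete[symmetric]) simp
  also have "\<dots> = (\<integral>\<^sup>+\<omega>. xi1 X \<alpha> \<omega> \<partial>M)" unfolding f_def by (rule nn_integral_xi1_eq_infsum[symmetric])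
  finally show ?thesis unfolding E_def by (simp add: divide_ennreal_def mult.commute)
qed

theorem partial_sums_null_recurrent:
  assumes \<alpha>: "0 \<le> \<alpha>" and r1: "r \<le> 1" and e: "0 < e"
  shows "AE \<omega> in M. eventually (\<lambda>t.
         real t powr ((\<alpha> + 2) / 2) * ln (real t) powr (- ((\<alpha> + 2) * (4 + r) / (1 + r)) - e) \<le> Salpha X \<alpha> t \<omega> \<and>
         Salpha X \<alpha> t \<omega> \<le> real t powr ((\<alpha> + 2) / 2) * ln (real t) powr ((3 * \<alpha> + 6) / (1 + r) + 2 + e)) sequentially"
proof -
  define q where "q = (\<alpha> + 2) / (1 + r)"
  define q0 where "q0 = 2 / (1 + r)"
  have rp: "0 < 1 + r" using r_gt by simp
  have q: "0 < q" "0 < q0" using rp \<alpha> by (auto simp: q_def q0_def)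
  have qq: "q / q0 = (\<alpha> + 2) / 2" using rp by (simp add: q_def q0_def)
  have L0: "AE \<omega> in M. eventually (\<lambda>n. real n powr q0 * ln (real n) powr (- q0 - q0 / q) \<le> (\<Sum>k<n. esum (\<lambda>x. rpow x 0) k \<omega>)) sequentially"
    using sums_lower[of 0 "q0 / q"] q by (simp add: q0_def)
  have U0: "AE \<omega> in M. eventually (\<lambda>n. (\<Sum>k<n. esum (\<lambda>x. rpow x 0) k \<omega>) \<le> real n powr q0 * ln (real n) powr (2 * q0)) sequentially"
    using sums_upper[of 0] r1 by (simp add: q0_def)
  have L1: "AE \<omega> in M. eventually (\<lambda>n. real n powr q * ln (real n) powr (- q - e) \<le> (\<Sum>k<n. esum (\<lambda>x. rpow x \<alpha>) k \<omega>)) sequentially"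
    unfolding q_def by (rule sums_lower[OF \<alpha> e])
  have U1: "AE \<omega> in M. eventually (\<lambda>n. (\<Sum>k<n. esum (\<lambda>x. rpow x \<alpha>) k \<omega>) \<le> real n powr q * ln (real n) powr (2 * q)) sequentially"
    unfolding q_def using r1 \<alpha> by (intro sums_upper) auto
  from L0 U0 L1 U1 AE_tau_finite show ?thesis
  proof eventually_elim
    case (elim \<omega>)
    then have fin: "\<And>n. tau X n \<omega> \<noteq> \<infinity>" by simp
    obtain N where N: "filterlim N at_top sequentially"
      "\<And>t. 1 \<le> t \<Longrightarrow> return_time X (N t) \<omega> \<le> t" "\<And>t. 1 \<le> t \<Longrightarrow> t < return_time X (Suc (N t)) \<omega>" "\<And>t. 1 \<le> t \<Longrightarrow> N t + 1 \<le> t"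
      "\<And>t \<alpha>. 1 \<le> t \<Longrightarrow> (\<Sum>k<N t. esum (\<lambda>x. rpow x \<alpha>) k \<omega>) \<le> Salpha X \<alpha> t \<omega>"
      "\<And>t \<alpha>. 1 \<le> t \<Longrightarrow> Salpha X \<alpha> t \<omega> \<le> (\<Sum>k<Suc (N t). esum (\<lambda>x. rpow x \<alpha>) k \<omega>)"
      by (rule path_renewal[OF fin]) blast
    note Te = return_time_eq_esum[OF fin]
    have "eventually (\<lambda>t. real t powr (q / q0) * ln (real t) powr (- (q * (4 + r) + e)) \<le> Salpha X \<alpha> t \<omega>) sequentially"
    proof (rule renewal_lower[where T = "\<lambda>n. return_time X n \<omega>" and A = "\<lambda>n. \<Sum>k<n. esum (\<lambda>x. rpow x \<alpha>) k \<omega>" and K = 1 and bT = "2 * q0" and bA = "q + e", OF N(1,3,4,5)])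
      show "eventually (\<lambda>n. real (return_time X n \<omega>) - 1 \<le> 1 * (real n powr q0 * ln (real n) powr (2 * q0))) sequentially"
        unfolding Te using elim(2) by simp
      show "eventually (\<lambda>n. real n powr q * ln (real n) powr (- (q + e)) \<le> (\<Sum>k<n. esum (\<lambda>x. rpow x \<alpha>) k \<omega>)) sequentially"
        using elim(3) by simp
      have "q * (2 * q0) / q0 + (q + e) = q * 3 + e" using q by simp
      also have "\<dots> < q * (4 + r) + e" using q rp by simp
      finally show "q * (2 * q0) / q0 + (q + e) < q * (4 + r) + e" .
    qed (use q e in auto)
    moreover have "eventually (\<lambda>t. Salpha X \<alpha> t \<omega> \<le> real t powr (q / q0) * ln (real t) powr (3 * q + 2 + e)) sequentially"
    proof (rule renewal_upper[where T = "\<lambda>n. return_time X n \<omega>" and A = "\<lambda>n. \<Sum>k<n. esum (\<lambda>x. rpow x \<alpha>) k \<omega>" and bT = "q0 + q0 / q" and bA = "2 * q", OF N(1,2,4,6)])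
      show "eventually (\<lambda>n. real n powr q0 * ln (real n) powr (- (q0 + q0 / q)) \<le> real (return_time X n \<omega>) - 1) sequentially"
        unfolding Te using elim(1) by simp
      show "eventually (\<lambda>n. (\<Sum>k<n. esum (\<lambda>x. rpow x \<alpha>) k \<omega>) \<le> real n powr q * ln (real n) powr (2 * q)) sequentially" by (rule elim(4))
      have "q * (q0 + q0 / q) / q0 + 2 * q = 3 * q + 1" using q by (simp add: field_simps)
      then show "q * (q0 + q0 / q) / q0 + 2 * q < 3 * q + 2 + e" using e by simp
    qed (use q in auto)
    ultimately show ?case
    proof eventually_elim
      case (elim t)
      have x1: "- (q * (4 + r) + e) = - ((\<alpha> + 2) * (4 + r) / (1 + r)) - e" by (simp add: q_def)
      have x2: "3 * q + 2 + e = (3 * \<alpha> + 6) / (1 + r) + 2 + e" by (simp add: q_def)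
      show ?case using elim unfolding qq x1 x2 by blast
    qed
  qed
qed

theorem partial_sums_critical:
  assumes \<alpha>: "0 \<le> \<alpha>" and r1: "1 < r" "r \<le> 1 + \<alpha>" and e: "0 < e"
  shows "AE \<omega> in M. eventually (\<lambda>t.
         real t powr ((\<alpha> + 2) / (1 + r)) * ln (real t) powr (- ((\<alpha> + 2) / (1 + r)) - e) \<le> Salpha X \<alpha> t \<omega> \<and>
         Salpha X \<alpha> t \<omega> \<le> real t powr ((\<alpha> + 2) / (1 + r)) * ln (real t) powr ((2 * \<alpha> + 4) / (1 + r) + 2 + e)) sequentially"
proof -
  define q where "q = (\<alpha> + 2) / (1 + r)"
  have rp: "0 < 1 + r" using r_gt by simp
  have q: "0 < q" using rp \<alpha> by (auto simp: q_def)
  let ?eta = "esum (\<lambda>x. rpow x 0)"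
  have int: "integrable M (?eta 0)" using r1 by (intro esum_integrable) auto
  define K where "K = expectation (?eta 0) + 1"
  have K: "0 < K" using esum_expectation_pos[OF _ int] by (simp add: K_def)
  have U0: "AE \<omega> in M. eventually (\<lambda>n. (\<Sum>k<n. ?eta k \<omega>) / real n \<le> K) sequentially"
    unfolding K_def by (rule slln_upper[OF esum_indep esum_distr int]) simp
  have L1: "AE \<omega> in M. eventually (\<lambda>n. real n powr q * ln (real n) powr (- q - e / 2) \<le> (\<Sum>k<n. esum (\<lambda>x. rpow x \<alpha>) k \<omega>)) sequentially"
    unfolding q_def using e by (intro sums_lower[OF \<alpha>]) simp
  have U1: "AE \<omega> in M. eventually (\<lambda>n. (\<Sum>k<n. esum (\<lambda>x. rpow x \<alpha>) k \<omega>) \<le> real n powr q * ln (real n) powr (2 * q)) sequentially"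
    unfolding q_def using r1 \<alpha> by (intro sums_upper) auto
  from U0 L1 U1 AE_tau_finite show ?thesis
  proof eventually_elim
    case (elim \<omega>)
    then have fin: "\<And>n. tau X n \<omega> \<noteq> \<infinity>" by simp
    obtain N where N: "filterlim N at_top sequentially"
      "\<And>t. 1 \<le> t \<Longrightarrow> return_time X (N t) \<omega> \<le> t" "\<And>t. 1 \<le> t \<Longrightarrow> t < return_time X (Suc (N t)) \<omega>" "\<And>t. 1 \<le> t \<Longrightarrow> N t + 1 \<le> t"
      "\<And>t \<alpha>. 1 \<le> t \<Longrightarrow> (\<Sum>k<N t. esum (\<lambda>x. rpow x \<alpha>) k \<omega>) \<le> Salpha X \<alpha> t \<omega>"
      "\<And>t \<alpha>. 1 \<le> t \<Longrightarrow> Salpha X \<alpha> t \<omega> \<le> (\<Sum>k<Suc (N t). esum (\<lambda>x. rpow x \<alpha>) k \<omega>)"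
      by (rule path_renewal[OF fin]) blast
    note Te = return_time_eq_esum[OF fin]
    have big: "eventually (\<lambda>n::nat. exp 1 \<le> real n) sequentially" by (rule eventually_exp_le_real)
    have one: "ln (real n) powr 0 = 1" "0 < real n" if "exp 1 \<le> real n" for n :: nat
      using ln_ge_1[OF that] less_le_trans[OF exp_gt_zero that] by auto
    have "eventually (\<lambda>t. real t powr (q / 1) * ln (real t) powr (- (q + e)) \<le> Salpha X \<alpha> t \<omega>) sequentially"
    proof (rule renewal_lower[where T = "\<lambda>n. return_time X n \<omega>" and A = "\<lambda>n. \<Sum>k<n. esum (\<lambda>x. rpow x \<alpha>) k \<omega>" and K = K and bT = 0 and bA = "q + e / 2", OF N(1,3,4,5)])
      show "eventually (\<lambda>n. real (return_time X n \<omega>) - 1 \<le> K * (real n powr 1 * ln (real n) powr 0)) sequentially"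
        unfolding Te using elim(1) big by eventually_elim (use one in \<open>simp add: field_simps\<close>)
      show "eventually (\<lambda>n. real n powr q * ln (real n) powr (- (q + e / 2)) \<le> (\<Sum>k<n. esum (\<lambda>x. rpow x \<alpha>) k \<omega>)) sequentially"
        using elim(2) by simp
    qed (use q e K in auto)
    moreover have "eventually (\<lambda>t. Salpha X \<alpha> t \<omega> \<le> real t powr (q / 1) * ln (real t) powr (2 * q + 2 + e)) sequentially"
    proof (rule renewal_upper[where T = "\<lambda>n. return_time X n \<omega>" and A = "\<lambda>n. \<Sum>k<n. esum (\<lambda>x. rpow x \<alpha>) k \<omega>" and bT = 0 and bA = "2 * q", OF N(1,2,4,6)])
      show "eventually (\<lambda>n. real n powr 1 * ln (real n) powr (- 0) \<le> real (return_time X n \<omega>) - 1) sequentially"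
        using big
      proof eventually_elim
        case (elim n)
        have "real n + 1 \<le> real (return_time X n \<omega>)" using return_time_gt[OF fin, of n] by linarith
        then show ?case using one[OF elim] by simp
      qed
      show "eventually (\<lambda>n. (\<Sum>k<n. esum (\<lambda>x. rpow x \<alpha>) k \<omega>) \<le> real n powr q * ln (real n) powr (2 * q)) sequentially" by (rule elim(3))
    qed (use q e in auto)
    ultimately show ?case
    proof eventually_elim
      case (elim t)
      have x1: "- (q + e) = - q - e" "q / 1 = q" by auto
      have x2: "2 * q + 2 + e = (2 * \<alpha> + 4) / (1 + r) + 2 + e" by (simp add: q_def)
      show ?case using elim unfolding x1 x2 unfolding q_def by blast
    qed
  qed
qed

theorem partial_sums_ergodic:
  assumes \<alpha>: "0 \<le> \<alpha>" and r1: "1 + \<alpha> < r"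
  defines "L \<equiv> (\<integral>\<^sup>+\<omega>. xi1 X \<alpha> \<omega> \<partial>M) / (\<integral>\<^sup>+\<omega>. ennreal_of_enat (eta X 1 \<omega>) \<partial>M)"
  shows "0 < L" "L < \<infinity>" "AE \<omega> in M. (\<lambda>t. Salpha X \<alpha> t \<omega> / real t) \<longlonglongrightarrow> enn2real L"
proof -
  let ?xi = "esum (\<lambda>x. rpow x \<alpha>)" and ?eta = "esum (\<lambda>x. rpow x 0)"
  have ix: "integrable M (?xi 0)" using \<alpha> r1 by (intro esum_integrable) auto
  have ie: "integrable M (?eta 0)" using \<alpha> r1 by (intro esum_integrable) auto
  define v where "v = expectation (?xi 0)"
  define u where "u = expectation (?eta 0)"
  have v: "0 < v" unfolding v_def by (rule esum_expectation_pos[OF \<alpha> ix])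
  have u: "0 < u" unfolding u_def by (rule esum_expectation_pos[OF _ ie]) simp
  have nn: "0 \<le> esum (\<lambda>x. rpow x b) 0 \<omega>" for b \<omega> by (rule esum_nonneg) (rule rpow_nonneg)
  have "(\<integral>\<^sup>+\<omega>. xi1 X \<alpha> \<omega> \<partial>M) = (\<integral>\<^sup>+\<omega>. ennreal (?xi 0 \<omega>) \<partial>M)"
    by (rule nn_integral_cong_AE) (use AE_tau_finite in eventually_elim, rule xi1_eq, simp)
  also have "\<dots> = ennreal v" unfolding v_def by (rule nn_integral_eq_integral[OF ix]) (simp add: nn)
  finally have xv: "(\<integral>\<^sup>+\<omega>. xi1 X \<alpha> \<omega> \<partial>M) = ennreal v" .
  have "(\<integral>\<^sup>+\<omega>. ennreal_of_enat (eta X 1 \<omega>) \<partial>M) = (\<integral>\<^sup>+\<omega>. ennreal (?eta 0 \<omega>) \<partial>M)"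
    by (rule nn_integral_cong_AE) (use AE_tau_finite in eventually_elim, rule eta1_eq, simp)
  also have "\<dots> = ennreal u" unfolding u_def by (rule nn_integral_eq_integral[OF ie]) (simp add: nn)
  finally have eu: "(\<integral>\<^sup>+\<omega>. ennreal_of_enat (eta X 1 \<omega>) \<partial>M) = ennreal u" .
  have L: "L = ennreal (v / u)" unfolding L_def xv eu using u v by (simp add: divide_ennreal)
  show "0 < L" "L < \<infinity>" unfolding L using u v by (auto simp: ennreal_zero_less_divide)
  have Lr: "enn2real L = v / u" unfolding L using u v by simp
  have S1: "AE \<omega> in M. (\<lambda>n. (\<Sum>k<n. ?xi k \<omega>) / real n) \<longlonglongrightarrow> v"
    unfolding v_def by (rule strong_law_of_large_numbers[OF esum_indep esum_distr ix])
  have S2: "AE \<omega> in M. (\<lambda>n. (\<Sum>k<n. ?eta k \<omega>) / real n) \<longlonglongrightarrow> u"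
    unfolding u_def by (rule strong_law_of_large_numbers[OF esum_indep esum_distr ie])
  from S1 S2 AE_tau_finite show "AE \<omega> in M. (\<lambda>t. Salpha X \<alpha> t \<omega> / real t) \<longlonglongrightarrow> enn2real L"
    unfolding Lr
  proof eventually_elim
    case (elim \<omega>)
    then have fin: "\<And>n. tau X n \<omega> \<noteq> \<infinity>" by simp
    obtain N where N: "filterlim N at_top sequentially"
      "\<And>t. 1 \<le> t \<Longrightarrow> return_time X (N t) \<omega> \<le> t" "\<And>t. 1 \<le> t \<Longrightarrow> t < return_time X (Suc (N t)) \<omega>" "\<And>t. 1 \<le> t \<Longrightarrow> N t + 1 \<le> t"
      "\<And>t \<alpha>. 1 \<le> t \<Longrightarrow> (\<Sum>k<N t. esum (\<lambda>x. rpow x \<alpha>) k \<omega>) \<le> Salpha X \<alpha> t \<omega>"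
      "\<And>t \<alpha>. 1 \<le> t \<Longrightarrow> Salpha X \<alpha> t \<omega> \<le> (\<Sum>k<Suc (N t). esum (\<lambda>x. rpow x \<alpha>) k \<omega>)"
      by (rule path_renewal[OF fin]) blast
    show ?case
    proof (rule renewal_ratio[where T = "\<lambda>n. return_time X n \<omega>" and A = "\<lambda>n. \<Sum>k<n. ?xi k \<omega>", OF N(1,2,3,5,6)])
      show "0 \<le> (\<Sum>k<n. ?xi k \<omega>)" for n by (intro sum_nonneg esum_nonneg rpow_nonneg)
      show "0 < return_time X n \<omega>" for n using return_time_gt[OF fin, of n] by simp
      show "(\<lambda>n. (real (return_time X n \<omega>) - 1) / real n) \<longlonglongrightarrow> u" unfolding return_time_eq_esum[OF fin] by (rule elim(2))
      show "(\<lambda>n. (\<Sum>k<n. ?xi k \<omega>) / real n) \<longlonglongrightarrow> v" by (rule elim(1))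
    qed (use u in auto)
  qed
qed

end

theorem theorem2p9:
  fixes M :: "'a measure" and F :: "nat \<Rightarrow> 'a measure"
    and X :: "nat \<Rightarrow> 'a \<Rightarrow> real" and S :: "real set"
    and c s2 r \<alpha> :: real
  assumes prob: "prob_space M"
    \<comment> \<open>(A0)\<close>
    and filt: "filtration (space M) F"
    and subalg: "\<And>t. t \<ge> 1 \<Longrightarrow> subalgebra M (F t)"
    and S_lf: "locally_finite_set S"
    and S_unbdd: "\<not> bounded S"
    and S_nonneg: "S \<subseteq> {0..}"
    and S_zero: "0 \<in> S"
    and X_adapted: "\<And>t. t \<ge> 1 \<Longrightarrow> X t \<in> borel_measurable (F t)"
    and X_in_S: "\<And>t \<omega>. t \<ge> 1 \<Longrightarrow> \<omega> \<in> space M \<Longrightarrow> X t \<omega> \<in> S"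
    and X1: "prob_space.prob M {\<omega> \<in> space M. X 1 \<omega> = 0} = 1"
    \<comment> \<open>(A1)\<close>
    and A1: "\<exists>m :: real \<Rightarrow> real \<Rightarrow> nat. \<exists>\<phi> :: real \<Rightarrow> real \<Rightarrow> real.
               (\<forall>x\<in>S. \<forall>y\<in>S. m x y \<ge> 1 \<and> \<phi> x y > 0) \<and>
               (\<forall>y\<in>S. \<forall>t\<ge>1. AE \<omega> in M.
                  real_cond_exp M (F t)
                    (indicator {\<omega>' \<in> space M. X (t + m (X t \<omega>') y) \<omega>' = y}) \<omega>
                  \<ge> \<phi> (X t \<omega>) y)"
    \<comment> \<open>(A2), with uniform o(.) terms\<close>
    and s2_pos: "s2 > 0"
    and A2_mean: "\<And>\<epsilon>. \<epsilon> > 0 \<Longrightarrow> \<exists>x0. \<forall>t\<ge>1. AE \<omega> in M. X t \<omega> \<ge> x0 \<longrightarrow>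
                    \<bar>real_cond_exp M (F t) (\<lambda>\<omega>'. X (t + 1) \<omega>' - X t \<omega>') \<omega> - c / X t \<omega>\<bar>
                    \<le> \<epsilon> / (X t \<omega> * ln (X t \<omega>))"
    and A2_var: "\<And>\<epsilon>. \<epsilon> > 0 \<Longrightarrow> \<exists>x0. \<forall>t\<ge>1. AE \<omega> in M. X t \<omega> \<ge> x0 \<longrightarrow>
                    \<bar>real_cond_exp M (F t) (\<lambda>\<omega>'. (X (t + 1) \<omega>' - X t \<omega>') ^ 2) \<omega> - s2\<bar>
                    \<le> \<epsilon> / ln (X t \<omega>)"
    and r_def: "r = - 2 * c / s2"
    \<comment> \<open>(A3)\<close>
    and A3a: "prob_space.prob M {\<omega> \<in> space M. Nexc X \<omega> = \<infinity>} > 0 \<Longrightarrow>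
              (let M' = uniform_measure M {\<omega> \<in> space M. Nexc X \<omega> = \<infinity>} in
                 prob_space.indep_vars M' (\<lambda>_. count_space UNIV) (\<lambda>n. excursion X n) {1..} \<and>
                 (\<forall>n\<ge>1. distr M' (count_space UNIV) (excursion X n)
                          = distr M' (count_space UNIV) (excursion X 1)))"
    and A3b: "\<And>n. prob_space.prob M {\<omega> \<in> space M. tau X n \<omega> < \<infinity>} > 0 \<Longrightarrow>
              cond_prob M (\<lambda>\<omega>. eta X (Suc n) \<omega> < \<infinity>) (\<lambda>\<omega>. tau X n \<omega> < \<infinity>)
              = prob_space.prob M {\<omega> \<in> space M. eta X 1 \<omega> < \<infinity>}"
    \<comment> \<open>r > -1 and (M_p) for some p > max 2 (1 + r)\<close>
    and r_gt: "r > -1"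
    and Mp: "\<exists>p. p > max 2 (1 + r) \<and> (\<exists>\<delta> > 0. \<exists>C :: real. \<forall>t\<ge>1. AE \<omega> in M.
               nn_cond_exp M (F t) (\<lambda>\<omega>'. ennreal (\<bar>X (t + 1) \<omega>' - X t \<omega>'\<bar> powr p)) \<omega>
               \<le> ennreal (C * (1 + X t \<omega>) powr (p - 2 - \<delta>)))"
    and alpha_nonneg: "\<alpha> \<ge> 0"
  shows
    "(r \<le> 1 \<longrightarrow> (\<forall>\<epsilon>>0. AE \<omega> in M. eventually (\<lambda>t.
         real t powr ((\<alpha> + 2) / 2) * ln (real t) powr (- ((\<alpha> + 2) * (4 + r) / (1 + r)) - \<epsilon>)
           \<le> Salpha X \<alpha> t \<omega> \<and>
         Salpha X \<alpha> t \<omega>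
           \<le> real t powr ((\<alpha> + 2) / 2) * ln (real t) powr ((3 * \<alpha> + 6) / (1 + r) + 2 + \<epsilon>))
       sequentially))
   \<and> (1 < r \<and> r \<le> 1 + \<alpha> \<longrightarrow> (\<forall>\<epsilon>>0. AE \<omega> in M. eventually (\<lambda>t.
         real t powr ((\<alpha> + 2) / (1 + r)) * ln (real t) powr (- ((\<alpha> + 2) / (1 + r)) - \<epsilon>)
           \<le> Salpha X \<alpha> t \<omega> \<and>
         Salpha X \<alpha> t \<omega>
           \<le> real t powr ((\<alpha> + 2) / (1 + r)) * ln (real t) powr ((2 * \<alpha> + 4) / (1 + r) + 2 + \<epsilon>))
       sequentially))
   \<and> (r > 1 + \<alpha> \<longrightarrow>
       (let L = (\<integral>\<^sup>+ \<omega>. xi1 X \<alpha> \<omega> \<partial>M) / (\<integral>\<^sup>+ \<omega>. ennreal_of_enat (eta X 1 \<omega>) \<partial>M) in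
          L = (\<Sum>\<^sub>\<infinity> x\<in>S. ennreal (rpow x \<alpha>) * stat_pi M X x) \<and> 0 < L \<and> L < \<infinity> \<and>
          (AE \<omega> in M. (\<lambda>t. Salpha X \<alpha> t \<omega> / real t) \<longlonglongrightarrow> enn2real L)))"
proof -
  obtain m :: "real \<Rightarrow> real \<Rightarrow> nat" and \<phi> :: "real \<Rightarrow> real \<Rightarrow> real" where
    m\<phi>: "\<forall>x\<in>S. \<forall>y\<in>S. m x y \<ge> 1 \<and> \<phi> x y > 0"
    and A1': "\<forall>y\<in>S. \<forall>t\<ge>1. AE \<omega> in M.
      real_cond_exp M (F t) (indicator {\<omega>' \<in> space M. X (t + m (X t \<omega>') y) \<omega>' = y}) \<omega> \<ge> \<phi> (X t \<omega>) y"
    using A1 by (elim exE conjE)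
  obtain p \<delta>' C' where p: "p > max 2 (1 + r)" and \<delta>': "\<delta>' > 0"
    and Mp': "\<forall>t\<ge>1. AE \<omega> in M. nn_cond_exp M (F t) (\<lambda>\<omega>'. ennreal (\<bar>X (t + 1) \<omega>' - X t \<omega>'\<bar> powr p)) \<omega>
               \<le> ennreal (C' * (1 + X t \<omega>) powr (p - 2 - \<delta>'))"
    using Mp by (elim exE conjE)
  define \<delta> where "\<delta> = min \<delta>' ((p - 1 - r) / 2)"
  define C where "C = max C' 1"
  have p2: "2 < p" "1 + r < p" using p by auto
  have \<delta>: "0 < \<delta>" "\<delta> \<le> \<delta>'" using \<delta>' p2 by (auto simp: \<delta>_def)
  have "\<delta> \<le> (p - 1 - r) / 2" by (simp only: \<delta>_def min.cobounded2)
  also have "(p - 1 - r) / 2 < p - 1 - r" using p2 by (simp add: field_simps)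
  finally have \<delta>_less: "\<delta> < p - 1 - r" .
  have C: "0 < C" "C' \<le> C" by (auto simp: C_def)
  have Mp'': "AE \<omega> in M. nn_cond_exp M (F t) (\<lambda>\<omega>'. ennreal (\<bar>X (t + 1) \<omega>' - X t \<omega>'\<bar> powr p)) \<omega>
               \<le> ennreal (C * (1 + X t \<omega>) powr (p - 2 - \<delta>))" if t: "t \<ge> 1" for t
    using Mp'[rule_format, OF t] AE_space
  proof eventually_elim
    case (elim \<omega>)
    have x: "0 \<le> X t \<omega>" using X_in_S[OF t elim(2)] S_nonneg by auto
    have "C' * (1 + X t \<omega>) powr (p - 2 - \<delta>') \<le> C * (1 + X t \<omega>) powr (p - 2 - \<delta>')"
      using C by (intro mult_right_mono) auto
    also have "\<dots> \<le> C * (1 + X t \<omega>) powr (p - 2 - \<delta>)"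
      using C \<delta> x by (intro mult_left_mono powr_mono) auto
    finally show ?case using elim(1) by (meson ennreal_leI order_trans)
  qed
  have m1: "m x y \<ge> 1" and \<phi>0: "\<phi> x y > 0" if "x \<in> S" "y \<in> S" for x y using m\<phi> that by auto
  interpret lamperti M F X S c s2 r m \<phi> p \<delta> C
    by (rule lamperti.intro[OF prob lamperti_axioms.intro[OF filt subalg S_lf S_unbdd S_nonneg S_zero X_adapted X_in_S
        X1 m1 \<phi>0 A1'[rule_format] s2_pos A2_mean A2_var r_def A3a A3b r_gt p2 \<delta>(1) \<delta>_less C(1) Mp'']])
  show ?thesis
    unfolding Let_def infsum_stat_pi
    using partial_sums_null_recurrent[OF alpha_nonneg] partial_sums_critical[OF alpha_nonneg]
      partial_sums_ergodic[OF alpha_nonneg] by blast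
qed

end
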